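(* Let $X=N+A$ be a process of class $\left(\sum(H)\right)$ (with non-decreasing part $A$) and of class $(\mathbb{D})$, such that $H\subset\{t: X_t=0\}$ and $A_{\overline{g}}=0$. Define $$\lambda(x)=\mathbb{E}'[X_\infty\mid A_\infty=x],$$ where $\mathbb{E}'$ is the expectation with respect to $\mathbb{P}'$, and assume that $\lambda(A_\infty)\ne0$. Then, with $b=\inf\{u:\ \mathbb{P}'(A_\infty\ge u)=0\}$, $$\mathbb{P}'(A_\infty>x)=\exp\left(-\int_0^x\frac{dz}{\lambda(z)}\right),\qquad x<b.$$
   Context: Setting: $\mathbb{Q}$ is a bounded (nonzero) signed measure on $(\Omega,\mathcal{F}_\infty)$ and $\mathbb{P}$ is a probability measure on $\mathcal{F}_\infty$ with $\mathbb{Q}\ll\mathbb{P}$. $(\mathcal{F}_t)_{t\ge0}$ is a right-continuous filtration, completed with respect to $\mathbb{P}$, with $\mathcal{F}_\infty=\bigvee_t\mathcal{F}_t$. Put $D_t=\frac{d\mathbb{Q}|_{\mathcal{F}_t}}{d\mathbb{P}|_{\mathcal{F}_t}}$; $D$ is assumed continuous (it is a uniformly integrable $\mathbb{P}$-martingale, with terminal value $D_\infty$). $H=\{t: D_t=0\}$, $g=\sup H$, $\overline{g}=0\vee g$, and $\mathbb{P}'=\frac{|D_\infty|}{\mathbb{E}(|D_\infty|)}\mathbb{P}$. A $(\mathbb{Q},\mathbb{P})$-local martingale is an adapted $\mathbb{P}$-semimartingale $X$ such that $XD$ is a $\mathbb{P}$-local martingale. A nonnegative $\mathbb{P}$-semimartingale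 $X$ is of class $\left(\sum(H)\right)$ if it decomposes as $X_t=N_t+A_t$ where: (i) $N$ is a càdlàg $(\mathbb{Q},\mathbb{P})$-local martingale with $N_0=0$; (ii) $A$ is a continuous non-decreasing (adapted) process with $A_0=0$; (iii) the measure $(dA_t)$ is carried by $\{t: X_t=0\}\cup H$. A process $X$ is of class $(\mathbb{D})$ if $\{X_\tau:\ \tau<\infty \text{ a stopping time}\}$ is uniformly integrable. $X_\infty$ and $A_\infty$ denote the limits of $X_t$ and $A_t$ as $t\to\infty$.
   Formalization: Class (D) is required under P' (uniform integrability of the X_τ with respect to P') rather than under P, under which the claim fails, e.g. when X ends with a strict local martingale piece under Q; the formula is stated for 0 ≤ x < b. *)

theory Defs
  imports "HOL-Probability.Probability"
begin

text \<open>
  Time is the half-line \<open>{0..}\<close> inside \<open>real\<close>; the values of filtrations and processes at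
  negative times play no role. All pathwise properties are required almost surely.
\<close>

subsection \<open>Paths and processes\<close>

definition cadlag :: "(real \<Rightarrow> real) \<Rightarrow> bool" where
  "cadlag f \<longleftrightarrow> (\<forall>t\<ge>0. continuous (at_right t) f \<and> (0 < t \<longrightarrow> (\<exists>l. (f \<longlongrightarrow> l) (at_left t))))"

definition locally_bounded_variation :: "(real \<Rightarrow> real) \<Rightarrow> bool" where
  "locally_bounded_variation f \<longleftrightarrow>
     (\<forall>T\<ge>0. \<exists>K. \<forall>n. \<forall>p :: nat \<Rightarrow> real. mono p \<and> range p \<subseteq> {0..T} \<longrightarrow>
        (\<Sum>i<n. \<bar>f (p (Suc i)) - f (p i)\<bar>) \<le> K)"

definition adapted :: "(real \<Rightarrow> 'a measure) \<Rightarrow> (real \<Rightarrow> 'a \<Rightarrow> real) \<Rightarrow> bool" where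
  "adapted F X \<longleftrightarrow> (\<forall>t\<ge>0. X t \<in> borel_measurable (F t))"

definition martingale ::
    "'a measure \<Rightarrow> (real \<Rightarrow> 'a measure) \<Rightarrow> (real \<Rightarrow> 'a \<Rightarrow> real) \<Rightarrow> bool" where
  "martingale P F X \<longleftrightarrow> adapted F X \<and> (\<forall>t\<ge>0. integrable P (X t)) \<and>
     (\<forall>s\<ge>0. \<forall>t\<ge>s. AE \<omega> in P. real_cond_exp P (F s) (X t) \<omega> = X s \<omega>)"

text \<open>
  Real-valued, hence everywhere finite, stopping times. They suffice for localisation,
  because a localising sequence \<open>T n\<close> may be replaced by \<open>min (T n) n\<close>.
\<close>

definition finite_stopping_time ::
    "'a measure \<Rightarrow> (real \<Rightarrow> 'a measure) \<Rightarrow> ('a \<Rightarrow> real) \<Rightarrow> bool" where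
  "finite_stopping_time P F T \<longleftrightarrow> stopping_time F T \<and> (\<forall>\<omega>\<in>space P. 0 \<le> T \<omega>)"

definition local_martingale ::
    "'a measure \<Rightarrow> (real \<Rightarrow> 'a measure) \<Rightarrow> (real \<Rightarrow> 'a \<Rightarrow> real) \<Rightarrow> bool" where
  "local_martingale P F X \<longleftrightarrow> adapted F X \<and> (AE \<omega> in P. cadlag (\<lambda>t. X t \<omega>)) \<and>
     (\<exists>T :: nat \<Rightarrow> 'a \<Rightarrow> real.
        (\<forall>n. finite_stopping_time P F (T n)) \<and>
        (AE \<omega> in P. incseq (\<lambda>n. T n \<omega>) \<and> filterlim (\<lambda>n. T n \<omega>) at_top sequentially) \<and>
        (\<forall>n. martingale P F (\<lambda>t \<omega>. X (min t (T n \<omega>)) \<omega> - X 0 \<omega>)))"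

definition semimartingale ::
    "'a measure \<Rightarrow> (real \<Rightarrow> 'a measure) \<Rightarrow> (real \<Rightarrow> 'a \<Rightarrow> real) \<Rightarrow> bool" where
  "semimartingale P F X \<longleftrightarrow> adapted F X \<and> (AE \<omega> in P. cadlag (\<lambda>t. X t \<omega>)) \<and>
     (\<exists>M V. local_martingale P F M \<and> adapted F V \<and>
        (AE \<omega> in P. cadlag (\<lambda>t. V t \<omega>) \<and> locally_bounded_variation (\<lambda>t. V t \<omega>)) \<and>
        (AE \<omega> in P. \<forall>t\<ge>0. X t \<omega> = M t \<omega> + V t \<omega>))"

definition uniformly_integrable :: "'a measure \<Rightarrow> ('a \<Rightarrow> real) set \<Rightarrow> bool" where
  "uniformly_integrable M S \<longleftrightarrow> S \<subseteq> borel_measurable M \<and>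
     (\<forall>e>0. \<exists>K. \<forall>f\<in>S.
        (\<integral>\<^sup>+ \<omega>. ennreal \<bar>f \<omega>\<bar> * indicator {\<omega>. K < \<bar>f \<omega>\<bar>} \<omega> \<partial>M) \<le> ennreal e)"

text \<open>
  Class (D) relative to a measure \<open>M\<close>. Below \<open>M\<close> is \<open>P'\<close>, the normalised total variation
  \<open>|Q|\<close>: uniform integrability under \<open>P\<close> alone would not control \<open>X D\<close>.
\<close>

definition class_D ::
    "'a measure \<Rightarrow> (real \<Rightarrow> 'a measure) \<Rightarrow> (real \<Rightarrow> 'a \<Rightarrow> real) \<Rightarrow> bool" where
  "class_D M F X \<longleftrightarrow>
     uniformly_integrable M {(\<lambda>\<omega>. X (T \<omega>) \<omega>) | T. finite_stopping_time M F T}"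

text \<open>\<open>terminal X\<close> is \<open>X\<^sub>\<infinity>\<close>; it is unspecified at points where the path has no real limit.\<close>

definition terminal :: "(real \<Rightarrow> 'a \<Rightarrow> real) \<Rightarrow> 'a \<Rightarrow> real" where
  "terminal X \<omega> = Lim at_top (\<lambda>t. X t \<omega>)"

text \<open>\<open>X\<^sub>\<tau>(\<omega>) = v\<close> for a time \<open>\<tau>\<close> in \<open>[0,\<infinity>]\<close>, the value at \<open>\<infinity>\<close> being the limit of the path.\<close>

definition has_value_at :: "(real \<Rightarrow> 'a \<Rightarrow> real) \<Rightarrow> 'a \<Rightarrow> ereal \<Rightarrow> real \<Rightarrow> bool" where
  "has_value_at X \<omega> \<tau> v \<longleftrightarrow>
     (if \<tau> = \<infinity> then ((\<lambda>t. X t \<omega>) \<longlongrightarrow> v) at_top else X (real_of_ereal \<tau>) \<omega> = v)"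

subsection \<open>Signed measures\<close>

text \<open>A countably additive real-valued set function on a \<open>\<sigma>\<close>-algebra is automatically bounded.\<close>

definition bounded_signed_measure :: "'a measure \<Rightarrow> ('a set \<Rightarrow> real) \<Rightarrow> bool" where
  "bounded_signed_measure M Q \<longleftrightarrow> Q {} = 0 \<and>
     (\<forall>B :: nat \<Rightarrow> 'a set. range B \<subseteq> sets M \<and> disjoint_family B \<longrightarrow>
        (\<lambda>n. Q (B n)) sums Q (\<Union>n. B n))"

definition is_signed_density ::
    "'a measure \<Rightarrow> 'a measure \<Rightarrow> ('a set \<Rightarrow> real) \<Rightarrow> ('a \<Rightarrow> real) \<Rightarrow> bool" where
  "is_signed_density P G Q f \<longleftrightarrow> f \<in> borel_measurable G \<and> integrable P f \<and>
     (\<forall>B\<in>sets G. Q B = (LINT \<omega>:B|P. f \<omega>))"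

locale signed_measure_setting =
  prob_space P + complete_measure P + filtration "space P" F
  for P :: "'a measure" and F :: "real \<Rightarrow> 'a measure" +
  fixes Q :: "'a set \<Rightarrow> real"
    and D :: "real \<Rightarrow> 'a \<Rightarrow> real"
    and D_inf :: "'a \<Rightarrow> real"
  assumes sets_F_inf: "sets P = sigma_sets (space P) (\<Union>t\<in>{0..}. sets (F t))"
    and right_continuous_F: "\<And>t. 0 \<le> t \<Longrightarrow> sets (F t) = (\<Inter>s\<in>{t<..}. sets (F s))"
    and null_sets_F0: "null_sets P \<subseteq> sets (F 0)"
    and signed_measure_Q: "bounded_signed_measure P Q"
    and Q_nonzero: "\<exists>B\<in>sets P. Q B \<noteq> 0"
    and Q_absolutely_continuous: "\<And>B. B \<in> null_sets P \<Longrightarrow> Q B = 0"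
    and density_D: "\<And>t. 0 \<le> t \<Longrightarrow> is_signed_density P (F t) Q (D t)"
    and density_D_inf: "is_signed_density P P Q D_inf"
    and continuous_D: "AE \<omega> in P. continuous_on {0..} (\<lambda>t. D t \<omega>)"

definition zero_times :: "(real \<Rightarrow> 'a \<Rightarrow> real) \<Rightarrow> 'a \<Rightarrow> real set" where
  "zero_times D \<omega> = {t. 0 \<le> t \<and> D t \<omega> = 0}"

definition last_zero :: "(real \<Rightarrow> 'a \<Rightarrow> real) \<Rightarrow> 'a \<Rightarrow> ereal" where
  "last_zero D \<omega> = Sup (ereal ` zero_times D \<omega>)"

text \<open>\<open>last_zero\<close> is \<open>-\<infinity>\<close> on paths without zeros.\<close>

definition last_zero_bar :: "(real \<Rightarrow> 'a \<Rightarrow> real) \<Rightarrow> 'a \<Rightarrow> ereal" where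
  "last_zero_bar D \<omega> = max 0 (last_zero D \<omega>)"

definition P_prime :: "'a measure \<Rightarrow> ('a \<Rightarrow> real) \<Rightarrow> 'a measure" where
  "P_prime P D_inf = density P (\<lambda>\<omega>. ennreal (\<bar>D_inf \<omega>\<bar> / (LINT \<omega>'|P. \<bar>D_inf \<omega>'\<bar>)))"

definition QP_local_martingale ::
    "'a measure \<Rightarrow> (real \<Rightarrow> 'a measure) \<Rightarrow> (real \<Rightarrow> 'a \<Rightarrow> real) \<Rightarrow> (real \<Rightarrow> 'a \<Rightarrow> real) \<Rightarrow> bool" where
  "QP_local_martingale P F D X \<longleftrightarrow>
     semimartingale P F X \<and> local_martingale P F (\<lambda>t \<omega>. X t \<omega> * D t \<omega>)"

text \<open>
  \<open>X\<close> is of class \<open>\<Sigma>(H)\<close> with decomposition \<open>X = N + A\<close>. In the last clause the path of \<open>A\<close>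
  is extended by its value at \<open>0\<close> to negative times, so that its Stieltjes measure \<open>dA\<close>
  lives on \<open>{0..}\<close>.
\<close>

definition class_Sigma_H ::
    "'a measure \<Rightarrow> (real \<Rightarrow> 'a measure) \<Rightarrow> (real \<Rightarrow> 'a \<Rightarrow> real) \<Rightarrow>
     (real \<Rightarrow> 'a \<Rightarrow> real) \<Rightarrow> (real \<Rightarrow> 'a \<Rightarrow> real) \<Rightarrow> (real \<Rightarrow> 'a \<Rightarrow> real) \<Rightarrow> bool" where
  "class_Sigma_H P F D X N A \<longleftrightarrow>
     semimartingale P F X \<and> (AE \<omega> in P. \<forall>t\<ge>0. 0 \<le> X t \<omega>) \<and>
     (AE \<omega> in P. \<forall>t\<ge>0. X t \<omega> = N t \<omega> + A t \<omega>) \<and>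
     QP_local_martingale P F D N \<and> (AE \<omega> in P. cadlag (\<lambda>t. N t \<omega>)) \<and> (AE \<omega> in P. N 0 \<omega> = 0) \<and>
     adapted F A \<and>
     (AE \<omega> in P. continuous_on {0..} (\<lambda>t. A t \<omega>) \<and> mono_on {0..} (\<lambda>t. A t \<omega>) \<and> A 0 \<omega> = 0) \<and>
     (AE \<omega> in P. AE t in interval_measure (\<lambda>t. A (max 0 t) \<omega>).
        t \<in> {t. 0 \<le> t \<and> X t \<omega> = 0} \<union> zero_times D \<omega>)"

text \<open>\<open>h\<close> is a version of \<open>x \<mapsto> E[Y | Z = x]\<close> under \<open>M\<close>.\<close>

definition is_cond_exp_given ::
    "'a measure \<Rightarrow> ('a \<Rightarrow> real) \<Rightarrow> ('a \<Rightarrow> real) \<Rightarrow> (real \<Rightarrow> real) \<Rightarrow> bool" where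
  "is_cond_exp_given M Y Z h \<longleftrightarrow> h \<in> borel_measurable borel \<and>
     (AE \<omega> in M. real_cond_exp M (vimage_algebra (space M) Z borel) Y \<omega> = h (Z \<omega>))"

text \<open>The infimum is \<open>\<infinity>\<close> if every tail of \<open>Z\<close> has positive probability.\<close>

definition upper_end :: "'a measure \<Rightarrow> ('a \<Rightarrow> real) \<Rightarrow> ereal" where
  "upper_end M Z = Inf {ereal u | u. measure M {\<omega> \<in> space M. u \<le> Z \<omega>} = 0}"

end

theory Submission
  imports Defs
begin

text \<open>
  Since \<open>A\<close> vanishes at the last zero of \<open>D\<close>, the process \<open>D\<close> has no zero after a time at
  which \<open>A\<close> is positive. From such a time on, \<open>D\<close> keeps its sign \<open>s\<close>, and \<open>s D_inf = \<bar>D_inf\<bar>\<close>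
  because \<open>D\<close> converges to \<open>D_inf\<close>. So once \<open>A\<close> has left \<open>0\<close>, the weight \<open>\<bar>D\<bar>\<close> under \<open>P\<close> is the
  weight of \<open>P'\<close> (\<open>sign_conversion\<close>), and the local martingale \<open>N D = (X - A) D\<close> under \<open>P\<close> makes
  \<open>X - A\<close> a local martingale under \<open>P'\<close>.

  Let \<open>\<tau>\<close> be the first time at which \<open>A\<close> exceeds a level \<open>u \<ge> 0\<close>. There \<open>A\<close> is equal to \<open>u\<close> and
  increases to the right. The measure \<open>dA\<close> is carried by the zeros of \<open>X\<close>, which include those of
  \<open>D\<close>, so \<open>X\<close> has zeros in every right neighbourhood of \<open>\<tau>\<close> and is \<open>0\<close> at \<open>\<tau>\<close>. Stopping \<open>X - A\<close> at
  \<open>\<tau>\<close> and letting time tend to infinity, which class (D) permits, gives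
  \<open>E'[X_inf; A_inf > u] = E'[(A_inf - u)^+]\<close>, where the right-hand side is the integral of
  \<open>P'(A_inf > z)\<close> over \<open>z > u\<close> (\<open>terminal_tail_identity\<close>). Instead of \<open>\<tau>\<close> the proof uses the first
  point of a finite grid at which \<open>A\<close> exceeds \<open>u\<close>, and then refines the grid: thus only the
  martingale property at fixed times is needed for \<open>N D\<close>
  (\<open>entry_identity\<close>, \<open>grid_tail_identity\<close>, \<open>stopped_tail_identity\<close>).

  Where \<open>A_inf = 0\<close>, also \<open>X_inf = 0\<close>. By the identity at \<open>u = 0\<close> this follows once
  \<open>E[sgn D * N D] \<le> 0\<close> at bounded stopping times. Along a grid this expectation can grow only
  when the sign of \<open>D\<close> switches; then \<open>D\<close> has just had a zero, \<open>X\<close> was \<open>0\<close> there and is still below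
  \<open>\<delta>\<close>, and the growth is at most \<open>\<delta>\<close> times that of \<open>E\<bar>D\<bar>\<close> (\<open>sign_switch_estimate\<close>).

  That \<open>X_inf\<close> exists is part of what has to be shown. The local martingale \<open>N D\<close> is bounded in
  \<open>L1\<close>, so it converges by the upcrossing inequality; \<open>D\<close> converges to \<open>D_inf\<close>, which does not
  vanish under \<open>P'\<close>, and \<open>A\<close> is bounded; hence \<open>X = N + A\<close> converges (\<open>terminal_limits\<close>).

  Finally let \<open>\<mu>\<close> be the law of \<open>A_inf\<close> under \<open>P'\<close> and \<open>G(z) = P'(A_inf > z)\<close>. By the definition of
  \<open>lam\<close>, the above says \<open>lam(z) \<mu>(dz) = G(z) dz\<close> on \<open>(0,\<infinity>)\<close> and \<open>lam(z) \<mu>(dz) = 0\<close> on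
  \<open>(-\<infinity>,0]\<close>. As \<open>lam\<close> does not vanish \<open>\<mu>\<close>-almost everywhere, \<open>- dG = \<mu> = (G / lam) dz\<close> with
  \<open>G(0) = 1\<close>, whose solution is the stated exponential (\<open>tail_exponential_of_cond_exp\<close>).
\<close>

section \<open>The law determined by tail expectations\<close>

text \<open>
  The last three hypotheses are an integrated form of \<open>dG = - G dL\<close>, without differentiability. Cut
  \<open>{0..x}\<close> into \<open>n\<close> pieces over which \<open>L\<close> grows by \<open>L x / n\<close>: each piece multiplies \<open>G\<close> by a factor
  between \<open>1 - L x / n\<close> and \<open>1 / (1 + L x / n)\<close>. The product tends to \<open>exp (- L x)\<close>.
\<close>

lemma exp_neg_of_multiplicative_increments:
  fixes G L :: "real \<Rightarrow> real" and x :: real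
  assumes x: "0 \<le> x" and L: "continuous_on {0..x} L" "L 0 = 0" and G0: "G 0 = 1"
    and pos: "\<And>y. 0 \<le> y \<Longrightarrow> y \<le> x \<Longrightarrow> 0 < G y"
    and lower: "\<And>y z. 0 \<le> y \<Longrightarrow> y \<le> z \<Longrightarrow> z \<le> x \<Longrightarrow> G z * (L z - L y) \<le> G y - G z"
    and upper: "\<And>y z. 0 \<le> y \<Longrightarrow> y \<le> z \<Longrightarrow> z \<le> x \<Longrightarrow> G y - G z \<le> G y * (L z - L y)"
    and Lmono: "\<And>y z. 0 \<le> y \<Longrightarrow> y \<le> z \<Longrightarrow> z \<le> x \<Longrightarrow> L y \<le> L z"
  shows "G x = exp (- L x)"
proof -
  define a where "a = L x"
  have a0: "0 \<le> a" using Lmono[of 0 x] x L(2) by (simp add: a_def)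
  have bounds: "(1 - a / real n) ^ n \<le> G x \<and> G x * (1 + a / real n) ^ n \<le> 1" if n: "a < real n" "0 < n" for n :: nat
  proof -
    have an: "0 \<le> a / n" "a / n < 1" using a0 n by (auto simp: field_simps)
    have step: "\<exists>y. 0 \<le> y \<and> y \<le> x \<and> L y = a * i / n \<and> (1 - a / n) ^ i \<le> G y \<and> G y * (1 + a / n) ^ i \<le> 1"
      if "i \<le> n" for i :: nat
      using that
    proof (induction i)
      case 0
      then show ?case using x L(2) G0 by (intro exI[of _ 0]) auto
    next
      case (Suc i)
      then obtain y where y: "0 \<le> y" "y \<le> x" "L y = a * i / n" "(1 - a / n) ^ i \<le> G y" "G y * (1 + a / n) ^ i \<le> 1"
        by auto
      have "L y \<le> a * Suc i / n" using y(3) a0 n by (auto simp: field_simps)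
      moreover have "a * Suc i / n \<le> L x"
        using Suc.prems a0 n mult_left_mono[of "real (Suc i)" "real n" a] by (auto simp: field_simps a_def)
      moreover have "continuous_on {y..x} L" using L(1) by (rule continuous_on_subset) (use y in auto)
      ultimately obtain z where z: "y \<le> z" "z \<le> x" "L z = a * Suc i / n"
        using IVT'[of L y "a * Suc i / n" x] y(2) by auto
      have d: "L z - L y = a / n" using z(3) y(3) n by (simp add: field_simps)
      have l: "G z * (1 + a / n) \<le> G y" using lower[OF y(1) z(1,2)] d by (simp add: algebra_simps)
      have u: "G y * (1 - a / n) \<le> G z" using upper[OF y(1) z(1,2)] d by (simp add: algebra_simps)
      have "(1 - a / n) ^ Suc i \<le> G y * (1 - a / n)"
        using mult_right_mono[OF y(4), of "1 - a / n"] an by (simp add: mult.commute)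
      moreover have "G z * (1 + a / n) ^ Suc i \<le> G y * (1 + a / n) ^ i"
        using mult_right_mono[OF l, of "(1 + a / n) ^ i"] an by (simp add: mult_ac)
      ultimately show ?case using u y(1,5) z by (intro exI[of _ z]) auto
    qed
    from step[of n] obtain y where y: "0 \<le> y" "y \<le> x" "L y = a" "(1 - a / n) ^ n \<le> G y" "G y * (1 + a / n) ^ n \<le> 1"
      using n by auto
    have "G y = G x" using lower[OF y(1,2)] upper[OF y(1,2)] y(2,3) by (simp add: a_def)
    then show ?thesis using y by simp
  qed
  have ev: "\<forall>\<^sub>F n in sequentially. a < real n \<and> 0 < n"
    using filterlim_real_sequentially[unfolded filterlim_at_top_dense, rule_format, of a] eventually_gt_at_top[of 0]
    by eventually_elim auto
  have "(\<lambda>n. (1 + (- a) / real n) ^ n) \<longlonglongrightarrow> exp (- a)"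
    by (rule tendsto_exp_limit_sequentially)
  then have "exp (- a) \<le> G x"
    by (rule tendsto_upperbound) (use ev in eventually_elim, use bounds in auto)
  moreover have "(\<lambda>n. G x * (1 + a / real n) ^ n) \<longlonglongrightarrow> G x * exp a"
    by (intro tendsto_intros tendsto_exp_limit_sequentially)
  then have "G x * exp a \<le> 1"
    by (rule tendsto_upperbound) (use ev in eventually_elim, use bounds in auto)
  then have "G x \<le> exp (- a)" by (simp add: exp_minus field_simps)
  ultimately show ?thesis by (simp add: a_def)
qed

lemma (in prob_space) tail_expectation_layer_cake:
  fixes Z :: "'a \<Rightarrow> real" and x :: real
  assumes [measurable]: "Z \<in> borel_measurable M"
  shows "(\<integral>\<^sup>+ \<omega>. ennreal (max 0 (Z \<omega> - x)) \<partial>M)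
    = (\<integral>\<^sup>+ z. ennreal (prob {\<omega>\<in>space M. z < Z \<omega>}) * indicator {x<..} z \<partial>lborel)"
proof -
  interpret pair_sigma_finite M lborel ..
  have "(\<integral>\<^sup>+ \<omega>. ennreal (max 0 (Z \<omega> - x)) \<partial>M) = (\<integral>\<^sup>+ \<omega>. \<integral>\<^sup>+ z. indicator {x<..<Z \<omega>} z \<partial>lborel \<partial>M)"
  proof (rule nn_integral_cong)
    fix \<omega>
    show "ennreal (max 0 (Z \<omega> - x)) = (\<integral>\<^sup>+ z. indicator {x<..<Z \<omega>} z \<partial>lborel)"
      by (cases "x \<le> Z \<omega>") (auto simp: max_def)
  qed
  also have "\<dots> = (\<integral>\<^sup>+ z. \<integral>\<^sup>+ \<omega>. indicator {x<..<Z \<omega>} z \<partial>M \<partial>lborel)"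
    by (rule Fubini'[symmetric]) (simp add: indicator_def greaterThanLessThan_iff)
  also have "\<dots> = (\<integral>\<^sup>+ z. ennreal (prob {\<omega>\<in>space M. z < Z \<omega>}) * indicator {x<..} z \<partial>lborel)"
  proof (rule nn_integral_cong)
    fix z :: real
    have "(\<integral>\<^sup>+ \<omega>. indicator {x<..<Z \<omega>} z \<partial>M) = (\<integral>\<^sup>+ \<omega>. indicator {x<..} z * indicator {\<omega>\<in>space M. z < Z \<omega>} \<omega> \<partial>M)"
      by (intro nn_integral_cong) (auto simp: indicator_def)
    also have "\<dots> = indicator {x<..} z * emeasure M {\<omega>\<in>space M. z < Z \<omega>}"
      by (subst nn_integral_cmult_indicator) auto
    finally show "(\<integral>\<^sup>+ \<omega>. indicator {x<..<Z \<omega>} z \<partial>M) = ennreal (prob {\<omega>\<in>space M. z < Z \<omega>}) * indicator {x<..} z"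
      by (simp add: emeasure_eq_measure mult.commute)
  qed
  finally show ?thesis .
qed

text \<open>
  The hypotheses \<open>stop\<close> and \<open>zero\<close> give the measure \<open>lam(z) \<nu>(dz)\<close>, for \<open>\<nu>\<close> the law of \<open>Z\<close>, on all half-lines;
  it is \<open>G(z) dz\<close> on \<open>(0,\<infinity>)\<close> for the tail function \<open>G\<close> of \<open>Z\<close>. Dividing by \<open>lam\<close> shows that \<open>\<nu>\<close> has no
  atom, not even at \<open>0\<close>, and has the density \<open>G / lam\<close>. With \<open>L\<close> the integral of \<open>1 / lam\<close>, monotonicity of
  \<open>G\<close> bounds its increments as the preceding lemma demands.
\<close>

lemma (in prob_space) tail_exponential_of_cond_exp:
  fixes Y Z :: "'a \<Rightarrow> real" and lam :: "real \<Rightarrow> real" and x :: real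
  assumes Ym [measurable]: "Y \<in> borel_measurable M" and Zm [measurable]: "Z \<in> borel_measurable M"
    and Ypos: "AE \<omega> in M. 0 \<le> Y \<omega>" and Yint: "integrable M Y"
    and Zint: "integrable M Z"
    and stop: "\<And>u. 0 \<le> u \<Longrightarrow> (\<integral>\<omega>. indicator {\<omega>. u < Z \<omega>} \<omega> * Y \<omega> \<partial>M) = (\<integral>\<omega>. max 0 (Z \<omega> - u) \<partial>M)"
    and zero: "AE \<omega> in M. Z \<omega> \<le> 0 \<longrightarrow> Y \<omega> = 0"
    and lam: "is_cond_exp_given M Y Z lam"
    and lam0: "AE \<omega> in M. lam (Z \<omega>) \<noteq> 0"
    and x: "0 \<le> x" "ereal x < upper_end M Z"
  shows "set_integrable lborel {0..x} (\<lambda>z. 1 / lam z) \<and>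
    measure M {\<omega> \<in> space M. x < Z \<omega>} = exp (- (LINT z:{0..x}|lborel. 1 / lam z))"
proof -
  define V where "V = vimage_algebra (space M) Z borel"
  have subV: "subalgebra M V"
    unfolding V_def subalgebra_def using Zm by (auto simp: sets_vimage_algebra2 intro: measurable_sets)
  interpret V: sigma_finite_subalgebra M V
    by (intro finite_measure_subalgebra_is_sigma_finite) (unfold_locales, fact subV)
  have lm [measurable]: "lam \<in> borel_measurable borel" using lam by (simp add: is_cond_exp_given_def)
  have ce: "AE \<omega> in M. real_cond_exp M V Y \<omega> = lam (Z \<omega>)" using lam by (simp add: is_cond_exp_given_def V_def)
  have lampos: "AE \<omega> in M. 0 \<le> lam (Z \<omega>)"
    using ce V.real_cond_exp_pos[OF Ypos Ym] by eventually_elim simp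
  have indV: "indicator {\<omega>. Z \<omega> \<in> B} \<in> borel_measurable V" if "B \<in> sets borel" for B :: "real set"
  proof -
    have "Z \<in> measurable V borel" unfolding V_def by (rule measurable_vimage_algebra1) auto
    then have "(\<lambda>\<omega>. indicator B (Z \<omega>)) \<in> borel_measurable V" using that by measurable
    then show ?thesis by (simp add: indicator_def[abs_def])
  qed
  have condE: "(\<integral>\<^sup>+ \<omega>. indicator B (Z \<omega>) * ennreal (lam (Z \<omega>)) \<partial>M) = ennreal (\<integral>\<omega>. indicator {\<omega>. Z \<omega> \<in> B} \<omega> * Y \<omega> \<partial>M)"
    if B [measurable]: "B \<in> sets borel" for B :: "real set"
  proof -
    have iM: "(\<lambda>\<omega>. indicator {\<omega>. Z \<omega> \<in> B} \<omega> :: real) \<in> borel_measurable M"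
      using measurable_from_subalg[OF subV indV[OF B]] .
    have i: "integrable M (\<lambda>\<omega>. indicator {\<omega>. Z \<omega> \<in> B} \<omega> * Y \<omega>)"
      by (rule Bochner_Integration.integrable_bound[OF Yint]) (use iM in \<open>auto simp: indicator_def\<close>)
    note * = V.real_cond_exp_intg[OF i indV[OF B] Ym]
    have "(\<integral>\<^sup>+ \<omega>. indicator B (Z \<omega>) * ennreal (lam (Z \<omega>)) \<partial>M)
        = (\<integral>\<^sup>+ \<omega>. ennreal (indicator {\<omega>. Z \<omega> \<in> B} \<omega> * real_cond_exp M V Y \<omega>) \<partial>M)"
      by (rule nn_integral_cong_AE, use ce in eventually_elim) (auto simp: indicator_def)
    also have "\<dots> = ennreal (\<integral>\<omega>. indicator {\<omega>. Z \<omega> \<in> B} \<omega> * real_cond_exp M V Y \<omega> \<partial>M)"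
      by (rule nn_integral_eq_integral[OF *(1)], use ce lampos in eventually_elim) (auto simp: indicator_def)
    finally show ?thesis using *(2) by simp
  qed
  define G where "G z = prob {\<omega>\<in>space M. z < Z \<omega>}" for z
  have Ganti: "G z \<le> G y" if "y \<le> z" for y z
    unfolding G_def by (intro finite_measure_mono) (use that in auto)
  have Gm [measurable]: "G \<in> borel_measurable borel"
  proof -
    have "mono (\<lambda>z. - G z)" using Ganti by (auto simp: mono_def)
    then have "(\<lambda>z. - (- G z)) \<in> borel_measurable borel" by (intro borel_measurable_uminus borel_measurable_mono)
    then show ?thesis by simp
  qed
  define \<nu> where "\<nu> = distr M borel Z"
  have [simp]: "sets \<nu> = sets borel" "space \<nu> = UNIV" by (auto simp: \<nu>_def)
  have [measurable_cong]: "sets \<nu> = sets borel" by simp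
  \<comment> \<open>the two sides of \<open>lam(z) \<nu>(dz) = G(z) dz\<close>\<close>
  define \<mu>1 where "\<mu>1 = density \<nu> (\<lambda>z. ennreal (lam z))"
  define \<mu>2 where "\<mu>2 = density lborel (\<lambda>z. ennreal (G z) * indicator {0<..} z)"
  have [simp]: "sets \<mu>1 = sets borel" "sets \<mu>2 = sets borel" by (auto simp: \<mu>1_def \<mu>2_def)
  have m1: "emeasure \<mu>1 B = ennreal (\<integral>\<omega>. indicator {\<omega>. Z \<omega> \<in> B} \<omega> * Y \<omega> \<partial>M)" if [measurable]: "B \<in> sets borel" for B
  proof -
    have "emeasure \<mu>1 B = (\<integral>\<^sup>+ z. ennreal (lam z) * indicator B z \<partial>\<nu>)"
      unfolding \<mu>1_def by (rule emeasure_density) (auto simp: \<nu>_def)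
    also have "\<dots> = (\<integral>\<^sup>+ \<omega>. ennreal (lam (Z \<omega>)) * indicator B (Z \<omega>) \<partial>M)"
      unfolding \<nu>_def by (rule nn_integral_distr) auto
    finally show ?thesis using condE[OF that] by (simp add: mult.commute)
  qed
  have m2: "emeasure \<mu>2 {u<..} = ennreal (\<integral>\<omega>. max 0 (Z \<omega> - u) \<partial>M)" if "0 \<le> u" for u
  proof -
    have "emeasure \<mu>2 {u<..} = (\<integral>\<^sup>+ z. ennreal (G z) * indicator {0<..} z * indicator {u<..} z \<partial>lborel)"
      unfolding \<mu>2_def by (rule emeasure_density) auto
    also have "\<dots> = (\<integral>\<^sup>+ z. ennreal (G z) * indicator {u<..} z \<partial>lborel)"
      by (intro nn_integral_cong) (use that in \<open>auto simp: indicator_def\<close>)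
    also have "\<dots> = (\<integral>\<^sup>+ \<omega>. ennreal (max 0 (Z \<omega> - u)) \<partial>M)"
      unfolding G_def tail_expectation_layer_cake[OF Zm] ..
    also have "\<dots> = ennreal (\<integral>\<omega>. max 0 (Z \<omega> - u) \<partial>M)"
      by (rule nn_integral_eq_integral) (auto intro!: Bochner_Integration.integrable_max Zint)
    finally show ?thesis .
  qed
  have m1eq: "emeasure \<mu>1 {u<..} = emeasure \<mu>2 {u<..}" if "0 \<le> u" for u
    using m1[of "{u<..}"] m2[OF that] stop[OF that] by simp
  have m1neg: "emeasure \<mu>1 {..0} = 0"
  proof -
    have "(\<integral>\<omega>. indicator {\<omega>. Z \<omega> \<in> {..0}} \<omega> * Y \<omega> \<partial>M) = 0"
      by (rule integral_eq_zero_AE, use zero in eventually_elim) (auto simp: indicator_def)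
    then show ?thesis using m1[of "{..0}"] by simp
  qed
  have m2neg: "emeasure \<mu>2 {..0} = 0"
    unfolding \<mu>2_def by (subst emeasure_density) (auto simp: indicator_def intro!: nn_integral_zero')
  have mu: "\<mu>1 = \<mu>2"
  proof (rule measure_eqI_lessThan)
    fix u :: real
    show "emeasure \<mu>1 {u<..} < \<infinity>" using m1[of "{u<..}"] by simp
    show "emeasure \<mu>1 {u<..} = emeasure \<mu>2 {u<..}"
    proof (cases "0 \<le> u")
      case False
      then have "emeasure \<mu> {u<..} = emeasure \<mu> {0<..}" if "emeasure \<mu> {..0} = 0" "sets \<mu> = sets borel" for \<mu> :: "real measure"
      proof -
        have "{u<..} = {u<..0} \<union> {0<..}" using False by auto
        moreover have "emeasure \<mu> {u<..0} = 0"
          using emeasure_mono[of "{u<..0}" "{..0}" \<mu>] that by (auto simp: subset_eq)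
        ultimately show ?thesis using that emeasure_Un_null_set[of "{0<..}" \<mu> "{u<..0}"]
          by (auto simp: null_sets_def Un_commute)
      qed
      then show ?thesis using m1neg m2neg m1eq[of 0] by simp
    qed (rule m1eq)
  qed auto
  define h where "h z = ennreal (1 / lam z)" for z
  have hm [measurable]: "h \<in> borel_measurable borel" unfolding h_def by measurable
  have law: "emeasure \<nu> B = (\<integral>\<^sup>+ z. h z * ennreal (G z) * indicator ({0<..} \<inter> B) z \<partial>lborel)"
    if [measurable]: "B \<in> sets borel" for B
  proof -
    have "AE z in \<nu>. 0 \<le> lam z \<and> lam z \<noteq> 0"
      unfolding \<nu>_def using lampos lam0 by (subst AE_distr_iff) (auto elim: eventually_elim2)
    then have "(\<integral>\<^sup>+ z. indicator B z \<partial>\<nu>) = (\<integral>\<^sup>+ z. ennreal (lam z) * (h z * indicator B z) \<partial>\<nu>)"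
      by (intro nn_integral_cong_AE, elim eventually_mono)
        (auto simp: h_def mult.assoc[symmetric] ennreal_mult[symmetric] simp del: ennreal_mult)
    also have "\<dots> = (\<integral>\<^sup>+ z. h z * indicator B z \<partial>\<mu>1)"
      unfolding \<mu>1_def by (subst nn_integral_density) auto
    also have "\<dots> = (\<integral>\<^sup>+ z. ennreal (G z) * indicator {0<..} z * (h z * indicator B z) \<partial>lborel)"
      unfolding mu unfolding \<mu>2_def by (subst nn_integral_density) auto
    also have "\<dots> = (\<integral>\<^sup>+ z. h z * ennreal (G z) * indicator ({0<..} \<inter> B) z \<partial>lborel)"
      by (intro nn_integral_cong) (auto simp: indicator_def mult.commute)
    finally show ?thesis by simp
  qed
  \<comment> \<open>only here the upper end of \<open>Z\<close> enters; it keeps \<open>G\<close> away from \<open>0\<close> on \<open>{0..x}\<close>\<close>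
  have Gx: "0 < G x"
  proof (rule ccontr)
    assume "\<not> 0 < G x"
    then have G0: "G x = 0" by (simp add: G_def zero_less_measure_iff)
    obtain u where u: "ereal x < ereal u" "ereal u < upper_end M Z"
      using ereal_dense2[OF x(2)] by auto
    have "measure M {\<omega>\<in>space M. u \<le> Z \<omega>} \<le> G x"
      unfolding G_def by (intro finite_measure_mono) (use u(1) in auto)
    then have "measure M {\<omega>\<in>space M. u \<le> Z \<omega>} = 0" using G0 measure_nonneg[of M] by (metis order_antisym)
    then have "upper_end M Z \<le> ereal u" unfolding upper_end_def by (intro Inf_lower) auto
    then show False using u(2) by simp
  qed
  \<comment> \<open>\<open>{lam \<le> 0}\<close> is null for \<open>\<mu>1\<close>, hence for \<open>\<mu>2\<close>, whose density is positive on \<open>(0, x]\<close>; so the convention \<open>1 / 0 = 0\<close> is harmless\<close>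
  have lpos: "AE z in lborel. 0 < z \<longrightarrow> z \<le> x \<longrightarrow> 0 < lam z"
  proof -
    have "emeasure \<mu>2 {z. lam z \<le> 0} = 0"
      unfolding mu[symmetric] unfolding \<mu>1_def
      by (subst emeasure_density) (auto simp: indicator_def ennreal_eq_0_iff intro!: nn_integral_zero' AE_I2)
    then have "(\<integral>\<^sup>+ z. ennreal (G z) * indicator {0<..} z * indicator {z. lam z \<le> 0} z \<partial>lborel) = 0"
      unfolding \<mu>2_def by (subst (asm) emeasure_density) auto
    then have "AE z in lborel. ennreal (G z) * indicator {0<..} z * indicator {z. lam z \<le> 0} z = 0"
      by (subst (asm) nn_integral_0_iff_AE) auto
    then show ?thesis
    proof eventually_elim
      case (elim z)
      then show ?case using Ganti[of z x] Gx by (auto simp: indicator_def not_le split: if_splits)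
    qed
  qed
  have nuG: "emeasure \<nu> {y<..z} = ennreal (G y - G z)" if "y \<le> z" for y z
  proof -
    have "emeasure \<nu> {y<..z} = emeasure M {\<omega>\<in>space M. y < Z \<omega> \<and> Z \<omega> \<le> z}"
      unfolding \<nu>_def by (subst emeasure_distr) (auto intro!: arg_cong[where f="emeasure M"])
    also have "{\<omega>\<in>space M. y < Z \<omega> \<and> Z \<omega> \<le> z} = {\<omega>\<in>space M. y < Z \<omega>} - {\<omega>\<in>space M. z < Z \<omega>}"
      by auto
    finally show ?thesis unfolding G_def emeasure_eq_measure
      using that by (subst (asm) finite_measure_Diff) (auto simp: emeasure_eq_measure)
  qed
  have G0: "G 0 = 1"
  proof -
    have "emeasure \<nu> {..0} = 0" using law[of "{..0}"] by (auto simp: indicator_def intro!: nn_integral_zero')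
    then have "emeasure M {\<omega>\<in>space M. Z \<omega> \<le> 0} = 0"
      unfolding \<nu>_def by (subst (asm) emeasure_distr) (auto simp: vimage_def Int_def conj_commute)
    then have "AE \<omega> in M. \<not> Z \<omega> \<le> 0" by (subst AE_iff_measurable[OF _ refl]) auto
    then show ?thesis unfolding G_def by (subst prob_eq_1) (auto elim: eventually_mono)
  qed
  have hfin: "(\<integral>\<^sup>+ z. h z * indicator {0<..x} z \<partial>lborel) < \<infinity>"
  proof -
    have "ennreal (G x) * (\<integral>\<^sup>+ z. h z * indicator {0<..x} z \<partial>lborel) = (\<integral>\<^sup>+ z. ennreal (G x) * (h z * indicator {0<..x} z) \<partial>lborel)"
      by (rule nn_integral_cmult[symmetric]) auto
    also have "\<dots> \<le> (\<integral>\<^sup>+ z. h z * ennreal (G z) * indicator ({0<..} \<inter> {0<..x}) z \<partial>lborel)"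
      by (intro nn_integral_mono) (auto simp: indicator_def mult.commute intro!: mult_left_mono ennreal_leI Ganti)
    also have "\<dots> = emeasure \<nu> {0<..x}" by (rule law[symmetric]) auto
    also have "\<dots> < \<infinity>" using nuG[of 0 x] x by simp
    finally show ?thesis using Gx by (auto simp: ennreal_mult_less_top)
  qed
  have ae0: "AE z in lborel. z \<noteq> (0::real)" by (rule AE_lborel_singleton)
  have int: "set_integrable lborel {0..x} (\<lambda>z. 1 / lam z)"
    unfolding set_integrable_def
  proof (rule integrableI_bounded)
    have "(\<integral>\<^sup>+ z. ennreal (norm (indicator {0..x} z *\<^sub>R (1 / lam z))) \<partial>lborel) = (\<integral>\<^sup>+ z. h z * indicator {0<..x} z \<partial>lborel)"
      by (rule nn_integral_cong_AE, use lpos ae0 in eventually_elim) (auto simp: h_def indicator_def)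
    then show "(\<integral>\<^sup>+ z. ennreal (norm (indicator {0..x} z *\<^sub>R (1 / lam z))) \<partial>lborel) < \<infinity>" using hfin by simp
  qed measurable
  define L where "L y = (LINT z:{0..y}|lborel. 1 / lam z)" for y
  have sub: "set_integrable lborel {y..z} (\<lambda>z. 1 / lam z)" if "0 \<le> y" "z \<le> x" for y z
    by (rule set_integrable_subset[OF int]) (use that in auto)
  have Ldiff: "ennreal (L z - L y) = (\<integral>\<^sup>+ t. h t * indicator {y<..z} t \<partial>lborel) \<and> L y \<le> L z" if yz: "0 \<le> y" "y \<le> z" "z \<le> x" for y z
  proof -
    have s: "set_integrable lborel {y<..z} (\<lambda>z. 1 / lam z)"
      by (rule set_integrable_subset[OF sub[OF yz(1,3)]]) auto
    have split: "{0..z} = {0..y} \<union> {y<..z}" using yz by auto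
    have Lz: "L z = L y + (LINT t:{y<..z}|lborel. 1 / lam t)"
      unfolding L_def split by (rule set_integral_Un) (use sub[of 0 y] yz s in auto)
    have nn: "AE t in lborel. 0 \<le> indicator {y<..z} t *\<^sub>R (1 / lam t)"
      using lpos by eventually_elim (use yz in \<open>auto simp: indicator_def\<close>)
    have "(\<integral>\<^sup>+ t. h t * indicator {y<..z} t \<partial>lborel) = (\<integral>\<^sup>+ t. ennreal (indicator {y<..z} t *\<^sub>R (1 / lam t)) \<partial>lborel)"
      by (intro nn_integral_cong) (auto simp: h_def indicator_def)
    also have "\<dots> = ennreal (LINT t:{y<..z}|lborel. 1 / lam t)"
      unfolding set_lebesgue_integral_def
      by (rule nn_integral_eq_integral[OF s[unfolded set_integrable_def] nn])
    finally have I: "(\<integral>\<^sup>+ t. h t * indicator {y<..z} t \<partial>lborel) = ennreal (LINT t:{y<..z}|lborel. 1 / lam t)" .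
    have "0 \<le> (LINT t:{y<..z}|lborel. 1 / lam t)"
      unfolding set_lebesgue_integral_def by (rule integral_nonneg_AE[OF nn])
    then show ?thesis using Lz I by simp
  qed
  have L0: "L 0 = 0"
  proof -
    have "AE z in lborel. indicator {0..0} z *\<^sub>R (1 / lam z) = 0"
      using ae0 by eventually_elim (auto simp: indicator_def)
    then show ?thesis unfolding L_def set_lebesgue_integral_def by (rule integral_eq_zero_AE)
  qed
  have Lcont: "continuous_on {0..x} L"
  proof -
    have "continuous_on {0..x} (\<lambda>y. integral {0..y} (\<lambda>z. 1 / lam z))"
      by (rule indefinite_integral_continuous_1) (rule set_borel_integral_eq_integral(1)[OF int])
    then show ?thesis
      by (rule continuous_on_eq) (auto simp: L_def set_borel_integral_eq_integral(2)[OF sub])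
  qed
  have Gdiff: "ennreal (G y - G z) = (\<integral>\<^sup>+ t. ennreal (G t) * (h t * indicator {y<..z} t) \<partial>lborel)"
    if yz: "0 \<le> y" "y \<le> z" for y z
    using law[of "{y<..z}"] nuG[OF yz(2)] yz
    by (auto simp: indicator_def mult_ac intro!: nn_integral_cong)
  have "G x = exp (- L x)"
  proof (rule exp_neg_of_multiplicative_increments[where G = G and L = L, OF x(1) Lcont L0 G0])
    fix y assume "0 \<le> y" "y \<le> x"
    then show "0 < G y" using Gx Ganti[of y x] by simp
  next
    fix y z assume yz: "0 \<le> y" "y \<le> z" "z \<le> x"
    note LD = Ldiff[OF yz] and GD = Gdiff[OF yz(1,2)]
    have Gnn: "0 \<le> G t" for t by (simp add: G_def)
    show "L y \<le> L z" using LD by simp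
    have "ennreal (G z * (L z - L y)) = (\<integral>\<^sup>+ t. ennreal (G z) * (h t * indicator {y<..z} t) \<partial>lborel)"
      using LD Gnn by (simp add: ennreal_mult nn_integral_cmult)
    also have "\<dots> \<le> ennreal (G y - G z)"
      unfolding GD by (intro nn_integral_mono) (auto simp: indicator_def intro!: mult_right_mono ennreal_leI Ganti)
    finally show "G z * (L z - L y) \<le> G y - G z" using Ganti[OF yz(2)] by simp
    have "ennreal (G y - G z) \<le> (\<integral>\<^sup>+ t. ennreal (G y) * (h t * indicator {y<..z} t) \<partial>lborel)"
      unfolding GD by (intro nn_integral_mono) (auto simp: indicator_def intro!: mult_right_mono ennreal_leI Ganti)
    also have "\<dots> = ennreal (G y * (L z - L y))"
      using LD Gnn by (simp add: ennreal_mult nn_integral_cmult)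
    finally show "G y - G z \<le> G y * (L z - L y)" using LD Gnn by simp
  qed
  then show ?thesis using int by (simp add: G_def L_def)
qed

section \<open>Averaging over sub-sigma-algebras and uniform integrability\<close>

text \<open>
  Truncate at a level \<open>K\<close>: the parts beyond \<open>K\<close> are small uniformly along the sequence, hence by Fatou also
  for the limit, and the truncated functions converge boundedly.
\<close>

lemma vitali_convergence:
  fixes f :: "nat \<Rightarrow> 'a \<Rightarrow> real" and g :: "'a \<Rightarrow> real"
  assumes fin: "finite_measure M"
    and meas [measurable]: "\<And>n. f n \<in> borel_measurable M" "g \<in> borel_measurable M"
    and lim: "AE \<omega> in M. (\<lambda>n. f n \<omega>) \<longlonglongrightarrow> g \<omega>"
    and ui: "\<And>e. 0 < e \<Longrightarrow> \<exists>K. \<forall>n. (\<integral>\<^sup>+ \<omega>. ennreal \<bar>f n \<omega>\<bar> * indicator {\<omega>. K < \<bar>f n \<omega>\<bar>} \<omega> \<partial>M) \<le> ennreal e"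
  shows "\<And>n. integrable M (f n)" "integrable M g" "(\<lambda>n. \<integral>\<omega>. f n \<omega> \<partial>M) \<longlonglongrightarrow> (\<integral>\<omega>. g \<omega> \<partial>M)"
proof -
  interpret finite_measure M by fact
  define c :: "real \<Rightarrow> real \<Rightarrow> real" where "c K y = max (- K) (min K y)" for K y
  have c_meas [measurable]: "(\<lambda>\<omega>. c K (h \<omega>)) \<in> borel_measurable M" if "h \<in> borel_measurable M" for K h
    using that unfolding c_def by measurable
  have c_bound: "\<bar>c K y\<bar> \<le> K" if "0 \<le> K" for K y using that by (auto simp: c_def)
  have c_int: "integrable M (\<lambda>\<omega>. c K (h \<omega>))" if "h \<in> borel_measurable M" "0 \<le> K" for K h
    by (rule integrable_const_bound[of _ K]) (use that c_bound in auto)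
  have c_diff: "ennreal \<bar>y - c K y\<bar> \<le> ennreal \<bar>y\<bar> * indicator {\<omega>. K < \<bar>y\<bar>} w" if "0 \<le> K" for K y w
    using that by (auto simp: c_def indicator_def)
  have trunc: "\<exists>K\<ge>0. (\<forall>n. (\<integral>\<^sup>+ \<omega>. ennreal \<bar>f n \<omega> - c K (f n \<omega>)\<bar> \<partial>M) \<le> ennreal e)
      \<and> (\<integral>\<^sup>+ \<omega>. ennreal \<bar>g \<omega> - c K (g \<omega>)\<bar> \<partial>M) \<le> ennreal e" if e: "0 < e" for e
  proof -
    obtain K' where K': "\<And>n. (\<integral>\<^sup>+ \<omega>. ennreal \<bar>f n \<omega>\<bar> * indicator {\<omega>. K' < \<bar>f n \<omega>\<bar>} \<omega> \<partial>M) \<le> ennreal e"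
      using ui[OF e] by blast
    define K where "K = max 0 K'"
    have A: "(\<integral>\<^sup>+ \<omega>. ennreal \<bar>f n \<omega> - c K (f n \<omega>)\<bar> \<partial>M) \<le> ennreal e" for n
    proof -
      have "(\<integral>\<^sup>+ \<omega>. ennreal \<bar>f n \<omega> - c K (f n \<omega>)\<bar> \<partial>M) \<le> (\<integral>\<^sup>+ \<omega>. ennreal \<bar>f n \<omega>\<bar> * indicator {\<omega>. K' < \<bar>f n \<omega>\<bar>} \<omega> \<partial>M)"
        by (intro nn_integral_mono order_trans[OF c_diff]) (auto simp: K_def indicator_def)
      then show ?thesis using K' by (rule order_trans)
    qed
    have "(\<integral>\<^sup>+ \<omega>. ennreal \<bar>g \<omega> - c K (g \<omega>)\<bar> \<partial>M) \<le> (\<integral>\<^sup>+ \<omega>. liminf (\<lambda>n. ennreal \<bar>f n \<omega> - c K (f n \<omega>)\<bar>) \<partial>M)"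
    proof (rule nn_integral_mono_AE, use lim in eventually_elim)
      fix \<omega> assume "(\<lambda>n. f n \<omega>) \<longlonglongrightarrow> g \<omega>"
      then have "(\<lambda>n. ennreal \<bar>f n \<omega> - c K (f n \<omega>)\<bar>) \<longlonglongrightarrow> ennreal \<bar>g \<omega> - c K (g \<omega>)\<bar>"
        unfolding c_def by (intro tendsto_intros)
      then show "ennreal \<bar>g \<omega> - c K (g \<omega>)\<bar> \<le> liminf (\<lambda>n. ennreal \<bar>f n \<omega> - c K (f n \<omega>)\<bar>)"
        using lim_imp_Liminf by (metis order_refl trivial_limit_sequentially)
    qed
    also have "\<dots> \<le> liminf (\<lambda>n. \<integral>\<^sup>+ \<omega>. ennreal \<bar>f n \<omega> - c K (f n \<omega>)\<bar> \<partial>M)"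
      by (intro nn_integral_liminf) auto
    also have "\<dots> \<le> liminf (\<lambda>n. ennreal e)"
      by (intro Liminf_mono) (use A in auto)
    finally show ?thesis using A by (intro exI[of _ K]) (auto simp: K_def Liminf_const)
  qed
  have tail_int: "integrable M h \<and> \<bar>(\<integral>\<omega>. h \<omega> \<partial>M) - (\<integral>\<omega>. c K (h \<omega>) \<partial>M)\<bar> \<le> e"
    if h: "h \<in> borel_measurable M" "0 \<le> K" "0 \<le> e" "(\<integral>\<^sup>+ \<omega>. ennreal \<bar>h \<omega> - c K (h \<omega>)\<bar> \<partial>M) \<le> ennreal e" for h K e
  proof -
    have i: "integrable M (\<lambda>\<omega>. h \<omega> - c K (h \<omega>))"
      using h by (intro integrableI_bounded) (auto intro: le_less_trans)
    have ih: "integrable M h" using Bochner_Integration.integrable_add[OF i c_int[OF h(1,2)]] by simp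
    have "\<bar>\<integral>\<omega>. h \<omega> - c K (h \<omega>) \<partial>M\<bar> \<le> (\<integral>\<omega>. \<bar>h \<omega> - c K (h \<omega>)\<bar> \<partial>M)" by (rule integral_abs_bound)
    also have "ennreal \<dots> \<le> ennreal e"
      using h(4) i by (subst nn_integral_eq_integral[symmetric]) auto
    then have "(\<integral>\<omega>. \<bar>h \<omega> - c K (h \<omega>)\<bar> \<partial>M) \<le> e" using h(3) by simp
    finally show ?thesis using ih i c_int[OF h(1,2)] by (subst Bochner_Integration.integral_diff[symmetric]) auto
  qed
  obtain K1 where "0 \<le> K1" "\<And>n. (\<integral>\<^sup>+ \<omega>. ennreal \<bar>f n \<omega> - c K1 (f n \<omega>)\<bar> \<partial>M) \<le> ennreal 1"
      "(\<integral>\<^sup>+ \<omega>. ennreal \<bar>g \<omega> - c K1 (g \<omega>)\<bar> \<partial>M) \<le> ennreal 1"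
    using trunc[of 1] by auto
  then show "\<And>n. integrable M (f n)" "integrable M g" using tail_int by (meson meas zero_le_one)+
  show "(\<lambda>n. \<integral>\<omega>. f n \<omega> \<partial>M) \<longlonglongrightarrow> (\<integral>\<omega>. g \<omega> \<partial>M)"
  proof (rule LIMSEQ_I)
    fix r :: real assume "0 < r"
    define e where "e = r / 3"
    have e: "0 < e" using \<open>0 < r\<close> by (simp add: e_def)
    obtain K where K: "0 \<le> K" "\<And>n. (\<integral>\<^sup>+ \<omega>. ennreal \<bar>f n \<omega> - c K (f n \<omega>)\<bar> \<partial>M) \<le> ennreal e"
      "(\<integral>\<^sup>+ \<omega>. ennreal \<bar>g \<omega> - c K (g \<omega>)\<bar> \<partial>M) \<le> ennreal e" using trunc[OF e] by auto
    have "(\<lambda>n. \<integral>\<omega>. c K (f n \<omega>) \<partial>M) \<longlonglongrightarrow> (\<integral>\<omega>. c K (g \<omega>) \<partial>M)"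
    proof (rule integral_dominated_convergence[where w="\<lambda>_. K"])
      show "AE \<omega> in M. (\<lambda>n. c K (f n \<omega>)) \<longlonglongrightarrow> c K (g \<omega>)"
        using lim by eventually_elim (auto simp: c_def intro!: tendsto_intros)
    qed (use c_bound K in auto)
    from LIMSEQ_D[OF this e] obtain n0 where n0: "\<And>n. n \<ge> n0 \<Longrightarrow> \<bar>(\<integral>\<omega>. c K (f n \<omega>) \<partial>M) - (\<integral>\<omega>. c K (g \<omega>) \<partial>M)\<bar> < e"
      unfolding real_norm_def by blast
    have "\<bar>(\<integral>\<omega>. f n \<omega> \<partial>M) - (\<integral>\<omega>. g \<omega> \<partial>M)\<bar> < r" if "n \<ge> n0" for n
      using tail_int[OF meas(1) K(1) less_imp_le[OF e] K(2), of n] tail_int[OF meas(2) K(1) less_imp_le[OF e] K(3)] n0[OF that]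
      unfolding e_def by argo
    then show "\<exists>no. \<forall>n\<ge>no. norm ((\<integral>\<omega>. f n \<omega> \<partial>M) - (\<integral>\<omega>. g \<omega> \<partial>M)) < r" by auto
  qed
qed

text \<open>
  For processes restricted to an event: uniform integrability is known for the values at stopping times,
  not for their restrictions.
\<close>

lemma vitali_convergence_dominated:
  fixes f w :: "nat \<Rightarrow> 'a \<Rightarrow> real" and g :: "'a \<Rightarrow> real"
  assumes "finite_measure M" "\<And>n. f n \<in> borel_measurable M" "g \<in> borel_measurable M"
    and "AE \<omega> in M. (\<lambda>n. f n \<omega>) \<longlonglongrightarrow> g \<omega>"
    and dom: "\<And>n \<omega>. \<bar>f n \<omega>\<bar> \<le> \<bar>w n \<omega>\<bar>"
    and ui: "\<And>e. 0 < e \<Longrightarrow> \<exists>K. \<forall>n. (\<integral>\<^sup>+ \<omega>. ennreal \<bar>w n \<omega>\<bar> * indicator {\<omega>. K < \<bar>w n \<omega>\<bar>} \<omega> \<partial>M) \<le> ennreal e"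
  shows "integrable M g" "(\<lambda>n. \<integral>\<omega>. f n \<omega> \<partial>M) \<longlonglongrightarrow> (\<integral>\<omega>. g \<omega> \<partial>M)"
proof -
  have ui': "\<exists>K. \<forall>n. (\<integral>\<^sup>+ \<omega>. ennreal \<bar>f n \<omega>\<bar> * indicator {\<omega>. K < \<bar>f n \<omega>\<bar>} \<omega> \<partial>M) \<le> ennreal e" if e: "0 < e" for e
  proof -
    obtain K where K: "\<And>n. (\<integral>\<^sup>+ \<omega>. ennreal \<bar>w n \<omega>\<bar> * indicator {\<omega>. K < \<bar>w n \<omega>\<bar>} \<omega> \<partial>M) \<le> ennreal e"
      using ui[OF e] by blast
    have "ennreal \<bar>f n \<omega>\<bar> * indicator {\<omega>. K < \<bar>f n \<omega>\<bar>} \<omega> \<le> ennreal \<bar>w n \<omega>\<bar> * indicator {\<omega>. K < \<bar>w n \<omega>\<bar>} \<omega>" for n \<omega>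
      using dom[of n \<omega>] by (auto simp: indicator_def intro!: ennreal_leI)
    then show ?thesis by (intro exI[of _ K] allI order_trans[OF nn_integral_mono K])
  qed
  show "integrable M g" "(\<lambda>n. \<integral>\<omega>. f n \<omega> \<partial>M) \<longlonglongrightarrow> (\<integral>\<omega>. g \<omega> \<partial>M)"
    using vitali_convergence(2,3)[OF assms(1-4) ui'] by auto
qed

lemma integrable_bounded_mult:
  fixes f h :: "'a \<Rightarrow> real"
  assumes "integrable M f" "h \<in> borel_measurable M" "\<And>\<omega>. \<bar>h \<omega>\<bar> \<le> 1"
  shows "integrable M (\<lambda>\<omega>. h \<omega> * f \<omega>)"
  by (rule Bochner_Integration.integrable_bound[OF assms(1)])
    (use assms in \<open>auto simp: abs_mult mult_left_le_one_le\<close>)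

lemma abs_sgn_le_1: "\<bar>sgn (r::real)\<bar> \<le> 1"
  by (simp add: sgn_real_def)

text \<open>
  In the following, \<open>f\<close> is a version of the conditional expectation of \<open>Z\<close> given \<open>G\<close>. The hypothesis is put
  as an equality of averages because that is what martingales and optional stopping provide.
\<close>

context
  fixes M G :: "'a measure" and f Z :: "'a \<Rightarrow> real"
  assumes prob: "prob_space M" and sub: "subalgebra M G"
    and Z: "integrable M Z" and f: "f \<in> borel_measurable G" "integrable M f"
    and avg: "\<And>B. B \<in> sets G \<Longrightarrow> (LINT \<omega>:B|M. Z \<omega>) = (LINT \<omega>:B|M. f \<omega>)"
begin

interpretation prob_space M by (rule prob)

interpretation G: sigma_finite_subalgebra M G
  by (intro finite_measure_subalgebra_is_sigma_finite) (unfold_locales, rule sub)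

lemma averaging_abs_le:
  assumes [measurable]: "h \<in> borel_measurable G"
  shows "(\<integral>\<^sup>+ \<omega>. h \<omega> * ennreal \<bar>f \<omega>\<bar> \<partial>M) \<le> (\<integral>\<^sup>+ \<omega>. h \<omega> * ennreal \<bar>Z \<omega>\<bar> \<partial>M)"
proof -
  have [measurable]: "Z \<in> borel_measurable M" using Z by auto
  have "AE \<omega> in M. real_cond_exp M G Z \<omega> = f \<omega>"
    by (rule G.real_cond_exp_charact[OF avg Z f(2) f(1)])
  moreover have "AE \<omega> in M. ennreal \<bar>real_cond_exp M G Z \<omega>\<bar> \<le> nn_cond_exp M G (\<lambda>\<omega>. ennreal \<bar>Z \<omega>\<bar>) \<omega>"
    by (rule G.real_cond_exp_abs) measurable
  ultimately have "(\<integral>\<^sup>+ \<omega>. h \<omega> * ennreal \<bar>f \<omega>\<bar> \<partial>M) \<le> (\<integral>\<^sup>+ \<omega>. h \<omega> * nn_cond_exp M G (\<lambda>\<omega>. ennreal \<bar>Z \<omega>\<bar>) \<omega> \<partial>M)"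
    by (intro nn_integral_mono_AE) (auto elim!: eventually_elim2 intro!: mult_left_mono)
  also have "\<dots> = (\<integral>\<^sup>+ \<omega>. h \<omega> * ennreal \<bar>Z \<omega>\<bar> \<partial>M)"
    by (rule G.nn_cond_exp_intg) auto
  finally show ?thesis .
qed

text \<open>
  Equality holds in the previous bound where \<open>f\<close> has the sign of \<open>Z\<close>. For \<open>Z = D_inf\<close> this is how a weight
  \<open>\<bar>D\<bar>\<close> becomes the weight of \<open>P'\<close> once the sign of \<open>D\<close> no longer changes.
\<close>

lemma averaging_abs_eq:
  assumes h [measurable]: "h \<in> borel_measurable G"
    and sgn: "AE \<omega> in M. h \<omega> \<noteq> 0 \<longrightarrow> sgn (f \<omega>) * Z \<omega> = \<bar>Z \<omega>\<bar>"
  shows "(\<integral>\<^sup>+ \<omega>. h \<omega> * ennreal \<bar>f \<omega>\<bar> \<partial>M) = (\<integral>\<^sup>+ \<omega>. h \<omega> * ennreal \<bar>Z \<omega>\<bar> \<partial>M)"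
proof -
  have Zm [measurable]: "Z \<in> borel_measurable M" using Z by auto
  have fG [measurable]: "f \<in> borel_measurable G" by (rule f)
  have sp: "space G = space M" using sub by (simp add: subalgebra_def)
  have fM [measurable]: "f \<in> borel_measurable M" by (rule measurable_from_subalg[OF sub f(1)])
  have hM [measurable]: "h \<in> borel_measurable M" by (rule measurable_from_subalg[OF sub h])
  define S where "S = {\<omega>\<in>space G. h \<omega> \<noteq> 0}"
  have S: "S \<in> sets G" unfolding S_def by measurable
  have SM: "B \<in> sets G \<Longrightarrow> B \<in> sets M" for B using sub by (auto simp: subalgebra_def)
  have ZS: "(\<lambda>\<omega>. ennreal \<bar>Z \<omega>\<bar> * indicator S \<omega>) \<in> borel_measurable M"
    using SM[OF S] by (intro borel_measurable_times_ennreal borel_measurable_indicator) auto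
  have fS: "(\<lambda>\<omega>. ennreal \<bar>f \<omega>\<bar> * indicator S \<omega>) \<in> borel_measurable G"
    using S by (intro borel_measurable_times_ennreal borel_measurable_indicator) auto
  have key: "AE \<omega> in M. ennreal \<bar>f \<omega>\<bar> * indicator S \<omega> = nn_cond_exp M G (\<lambda>\<omega>. ennreal \<bar>Z \<omega>\<bar> * indicator S \<omega>) \<omega>"
  proof (rule G.nn_cond_exp_charact)
    fix B assume B: "B \<in> sets G"
    define B1 where "B1 = {\<omega>\<in>space G. \<omega> \<in> B \<inter> S \<and> 0 < f \<omega>}"
    define B2 where "B2 = {\<omega>\<in>space G. \<omega> \<in> B \<inter> S \<and> f \<omega> < 0}"
    have "B1 = (B \<inter> S) \<inter> {\<omega>\<in>space G. 0 < f \<omega>}" "B2 = (B \<inter> S) \<inter> {\<omega>\<in>space G. f \<omega> < 0}"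
      by (auto simp: B1_def B2_def)
    moreover have "{\<omega>\<in>space G. 0 < f \<omega>} \<in> sets G" "{\<omega>\<in>space G. f \<omega> < 0} \<in> sets G" by measurable
    ultimately have B12: "B1 \<in> sets G" "B2 \<in> sets G" using B S by auto
    have BM: "B1 \<in> sets M" "B2 \<in> sets M" using B12 SM by auto
    have i: "integrable M (\<lambda>\<omega>. indicator B1 \<omega> * k \<omega>)" "integrable M (\<lambda>\<omega>. indicator B2 \<omega> * k \<omega>)" if "integrable M k" for k :: "'a \<Rightarrow> real"
      using integrable_mult_indicator[OF BM(1) that] integrable_mult_indicator[OF BM(2) that] by simp_all
    have "(\<integral>\<^sup>+ \<omega>. ennreal \<bar>Z \<omega>\<bar> * indicator S \<omega> * indicator B \<omega> \<partial>M) = (\<integral>\<^sup>+ \<omega>. ennreal (indicator B1 \<omega> * Z \<omega> - indicator B2 \<omega> * Z \<omega>) \<partial>M)"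
    proof (rule nn_integral_cong_AE, use sgn AE_space in eventually_elim)
      case (elim \<omega>)
      then show ?case by (cases "f \<omega>" "0::real" rule: linorder_cases) (auto simp: B1_def B2_def S_def sp indicator_def)
    qed
    also have "\<dots> = ennreal (\<integral> \<omega>. indicator B1 \<omega> * Z \<omega> - indicator B2 \<omega> * Z \<omega> \<partial>M)"
    proof (rule nn_integral_eq_integral)
      show "AE \<omega> in M. 0 \<le> indicator B1 \<omega> * Z \<omega> - indicator B2 \<omega> * Z \<omega>"
        using sgn
      proof eventually_elim
        case (elim \<omega>)
        then show ?case by (auto simp: B1_def B2_def S_def sp indicator_def)
      qed
    qed (intro Bochner_Integration.integrable_diff i Z)
    also have "(\<integral> \<omega>. indicator B1 \<omega> * Z \<omega> - indicator B2 \<omega> * Z \<omega> \<partial>M) = (\<integral> \<omega>. indicator B1 \<omega> * f \<omega> - indicator B2 \<omega> * f \<omega> \<partial>M)"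
      using avg[OF B12(1)] avg[OF B12(2)] i[OF Z] i[OF f(2)] by (simp add: set_lebesgue_integral_def)
    also have "ennreal \<dots> = (\<integral>\<^sup>+ \<omega>. ennreal (indicator B1 \<omega> * f \<omega> - indicator B2 \<omega> * f \<omega>) \<partial>M)"
      by (rule nn_integral_eq_integral[OF Bochner_Integration.integrable_diff[OF i[OF f(2)]], symmetric])
        (auto simp: B1_def B2_def indicator_def intro!: AE_I2)
    also have "\<dots> = (\<integral>\<^sup>+ \<omega>. ennreal \<bar>f \<omega>\<bar> * indicator S \<omega> * indicator B \<omega> \<partial>M)"
      by (rule nn_integral_cong) (auto simp: B1_def B2_def S_def sp indicator_def)
    finally show "(\<integral>\<^sup>+ \<omega>\<in>B. (ennreal \<bar>Z \<omega>\<bar> * indicator S \<omega>) \<partial>M) = (\<integral>\<^sup>+ \<omega>\<in>B. (ennreal \<bar>f \<omega>\<bar> * indicator S \<omega>) \<partial>M)" .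
  qed (fact ZS fS)+
  have "(\<integral>\<^sup>+ \<omega>. h \<omega> * ennreal \<bar>f \<omega>\<bar> \<partial>M) = (\<integral>\<^sup>+ \<omega>. h \<omega> * (ennreal \<bar>f \<omega>\<bar> * indicator S \<omega>) \<partial>M)"
    by (rule nn_integral_cong) (auto simp: S_def sp indicator_def)
  also have "\<dots> = (\<integral>\<^sup>+ \<omega>. h \<omega> * nn_cond_exp M G (\<lambda>\<omega>. ennreal \<bar>Z \<omega>\<bar> * indicator S \<omega>) \<omega> \<partial>M)"
    by (rule nn_integral_cong_AE, use key in eventually_elim) simp
  also have "\<dots> = (\<integral>\<^sup>+ \<omega>. h \<omega> * (ennreal \<bar>Z \<omega>\<bar> * indicator S \<omega>) \<partial>M)"
    by (rule G.nn_cond_exp_intg[OF h ZS])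
  also have "\<dots> = (\<integral>\<^sup>+ \<omega>. h \<omega> * ennreal \<bar>Z \<omega>\<bar> \<partial>M)"
    by (rule nn_integral_cong) (auto simp: S_def sp indicator_def)
  finally show ?thesis .
qed

lemma averaging_mult:
  assumes h: "h \<in> borel_measurable G" and hZ: "integrable M (\<lambda>\<omega>. h \<omega> * Z \<omega>)"
  shows "(\<integral>\<omega>. h \<omega> * Z \<omega> \<partial>M) = (\<integral>\<omega>. h \<omega> * f \<omega> \<partial>M)"
proof -
  have Zm: "Z \<in> borel_measurable M" using Z by auto
  have [measurable]: "f \<in> borel_measurable M" "h \<in> borel_measurable M"
    using measurable_from_subalg[OF sub f(1)] measurable_from_subalg[OF sub h] by auto
  have ae: "AE \<omega> in M. real_cond_exp M G Z \<omega> = f \<omega>"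
    by (rule G.real_cond_exp_charact[OF avg Z f(2) f(1)])
  have "(\<integral>\<omega>. h \<omega> * Z \<omega> \<partial>M) = (\<integral>\<omega>. h \<omega> * real_cond_exp M G Z \<omega> \<partial>M)"
    by (rule G.real_cond_exp_intg(2)[OF hZ h Zm, symmetric])
  also have "\<dots> = (\<integral>\<omega>. h \<omega> * f \<omega> \<partial>M)"
    by (rule integral_cong_AE) (use ae in auto)
  finally show ?thesis .
qed

end

text \<open>
  The tail of \<open>f n\<close> beyond \<open>K\<close> is at most the integral of \<open>\<bar>Z\<bar>\<close> over \<open>{K < \<bar>f n\<bar>}\<close>, whose probability is at most
  \<open>E\<bar>Z\<bar> / K\<close> by Markov; split \<open>\<bar>Z\<bar>\<close> at a high level \<open>L\<close>.
\<close>

lemma averaging_uniformly_integrable: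
  fixes f :: "'i \<Rightarrow> 'a \<Rightarrow> real"
  assumes prob: "prob_space M" and sub: "\<And>n. subalgebra M (G n)"
    and Z: "integrable M Z" and f: "\<And>n. f n \<in> borel_measurable (G n)" "\<And>n. integrable M (f n)"
    and avg: "\<And>n B. B \<in> sets (G n) \<Longrightarrow> (LINT \<omega>:B|M. Z \<omega>) = (LINT \<omega>:B|M. f n \<omega>)"
    and e: "0 < e"
  shows "\<exists>K. \<forall>n. (\<integral>\<^sup>+ \<omega>. ennreal \<bar>f n \<omega>\<bar> * indicator {\<omega>. K < \<bar>f n \<omega>\<bar>} \<omega> \<partial>M) \<le> ennreal e"
proof -
  interpret prob_space M by fact
  have Zm [measurable]: "Z \<in> borel_measurable M" using Z by auto
  have fM [measurable]: "f n \<in> borel_measurable M" for n using f(2) by auto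
  have le: "(\<integral>\<^sup>+ \<omega>. h \<omega> * ennreal \<bar>f n \<omega>\<bar> \<partial>M) \<le> (\<integral>\<^sup>+ \<omega>. h \<omega> * ennreal \<bar>Z \<omega>\<bar> \<partial>M)"
    if "h \<in> borel_measurable (G n)" for h n
    using that by (intro averaging_abs_le[OF prob sub Z f]) (rule avg)
  have lim: "(\<lambda>L. \<integral>\<omega>. \<bar>Z \<omega>\<bar> * indicator {\<omega>. real L < \<bar>Z \<omega>\<bar>} \<omega> \<partial>M) \<longlonglongrightarrow> (\<integral>\<omega>. 0 \<partial>M)"
  proof (rule integral_dominated_convergence[where w="\<lambda>\<omega>. \<bar>Z \<omega>\<bar>"])
    show "AE \<omega> in M. (\<lambda>L. \<bar>Z \<omega>\<bar> * indicator {\<omega>. real L < \<bar>Z \<omega>\<bar>} \<omega>) \<longlonglongrightarrow> 0"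
    proof (rule AE_I2)
      fix \<omega>
      obtain N :: nat where "\<bar>Z \<omega>\<bar> < N" using reals_Archimedean2 by blast
      then have "\<bar>Z \<omega>\<bar> * indicator {\<omega>. real L < \<bar>Z \<omega>\<bar>} \<omega> = 0" if "N \<le> L" for L
        using that by (auto simp: indicator_def)
      then have "\<forall>\<^sub>F L in sequentially. \<bar>Z \<omega>\<bar> * indicator {\<omega>. real L < \<bar>Z \<omega>\<bar>} \<omega> = 0"
        unfolding eventually_sequentially by blast
      then show "(\<lambda>L. \<bar>Z \<omega>\<bar> * indicator {\<omega>. real L < \<bar>Z \<omega>\<bar>} \<omega>) \<longlonglongrightarrow> 0"
        by (rule tendsto_eventually)
    qed
  qed (use Z in \<open>auto simp: indicator_def\<close>)
  then have "\<forall>\<^sub>F L in sequentially. (\<integral>\<omega>. \<bar>Z \<omega>\<bar> * indicator {\<omega>. real L < \<bar>Z \<omega>\<bar>} \<omega> \<partial>M) < e / 2"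
    using e by (intro order_tendstoD(2)) auto
  then obtain L :: nat where L: "(\<integral>\<omega>. \<bar>Z \<omega>\<bar> * indicator {\<omega>. real L < \<bar>Z \<omega>\<bar>} \<omega> \<partial>M) < e / 2"
    unfolding eventually_sequentially by blast
  have Zi: "integrable M (\<lambda>\<omega>. \<bar>Z \<omega>\<bar> * indicator {\<omega>. real L < \<bar>Z \<omega>\<bar>} \<omega>)"
    by (rule Bochner_Integration.integrable_bound[OF Z]) (auto simp: indicator_def)
  define c where "c = (\<integral>\<omega>. \<bar>Z \<omega>\<bar> \<partial>M)"
  have c: "0 \<le> c" by (simp add: c_def)
  \<comment> \<open>chosen so that \<open>L\<close> times the probability of \<open>{K < \<bar>f n\<bar>}\<close> is at most \<open>e / 2\<close>; the two summands \<open>1\<close> keep \<open>K\<close> positive\<close>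
  define K where "K = 2 * (real L + 1) * (c + 1) / e"
  have K: "0 < K" using e c by (auto simp: K_def)
  show ?thesis
  proof (intro exI[of _ K] allI)
    fix n
    let ?B = "{\<omega>. K < \<bar>f n \<omega>\<bar>}"
    have hG: "(\<lambda>\<omega>. indicator ?B \<omega> :: ennreal) \<in> borel_measurable (G n)"
      using f(1)[of n] by (simp add: indicator_def)
    have hM: "(\<lambda>\<omega>. indicator ?B \<omega> :: ennreal) \<in> borel_measurable M"
      using fM[of n] by (simp add: indicator_def)
    have "ennreal K * emeasure M {\<omega>\<in>space M. K < \<bar>f n \<omega>\<bar>} = (\<integral>\<^sup>+ \<omega>. ennreal K * indicator {\<omega>\<in>space M. K < \<bar>f n \<omega>\<bar>} \<omega> \<partial>M)"
      by (subst nn_integral_cmult_indicator) auto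
    also have "\<dots> \<le> (\<integral>\<^sup>+ \<omega>. 1 * ennreal \<bar>f n \<omega>\<bar> \<partial>M)"
      by (intro nn_integral_mono) (auto simp: indicator_def intro!: ennreal_leI)
    also have "\<dots> \<le> (\<integral>\<^sup>+ \<omega>. 1 * ennreal \<bar>Z \<omega>\<bar> \<partial>M)" by (rule le) auto
    also have "\<dots> = ennreal c" unfolding c_def using Z by (subst nn_integral_eq_integral[symmetric]) auto
    finally have Kp: "K * prob {\<omega>\<in>space M. K < \<bar>f n \<omega>\<bar>} \<le> c"
      using K c by (simp add: emeasure_eq_measure ennreal_mult[symmetric])
    have "real L * prob {\<omega>\<in>space M. K < \<bar>f n \<omega>\<bar>} \<le> e / 2"
    proof -
      have "2 * (real L + 1) * (c + 1) * prob {\<omega>\<in>space M. K < \<bar>f n \<omega>\<bar>} \<le> c * e"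
        using Kp e by (simp add: K_def field_simps)
      also have "\<dots> \<le> (c + 1) * e" using e by (simp add: algebra_simps)
      finally have "(c + 1) * (2 * (real L + 1) * prob {\<omega>\<in>space M. K < \<bar>f n \<omega>\<bar>}) \<le> (c + 1) * e"
        by (simp add: mult_ac)
      then have "2 * (real L + 1) * prob {\<omega>\<in>space M. K < \<bar>f n \<omega>\<bar>} \<le> e"
        using c by (subst (asm) mult_le_cancel_left_pos) auto
      moreover have "real L * prob {\<omega>\<in>space M. K < \<bar>f n \<omega>\<bar>} \<le> (real L + 1) * prob {\<omega>\<in>space M. K < \<bar>f n \<omega>\<bar>}"
        by (rule mult_right_mono) auto
      ultimately show ?thesis by linarith
    qed
    then have LP: "ennreal (real L) * emeasure M {\<omega>\<in>space M. K < \<bar>f n \<omega>\<bar>} \<le> ennreal (e / 2)"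
      by (simp add: emeasure_eq_measure ennreal_mult[symmetric] ennreal_leI)
    have "(\<integral>\<^sup>+ \<omega>. ennreal \<bar>f n \<omega>\<bar> * indicator ?B \<omega> \<partial>M) = (\<integral>\<^sup>+ \<omega>. indicator ?B \<omega> * ennreal \<bar>f n \<omega>\<bar> \<partial>M)"
      by (simp add: mult.commute)
    also have "\<dots> \<le> (\<integral>\<^sup>+ \<omega>. indicator ?B \<omega> * ennreal \<bar>Z \<omega>\<bar> \<partial>M)" by (rule le[OF hG])
    also have "\<dots> \<le> (\<integral>\<^sup>+ \<omega>. ennreal (\<bar>Z \<omega>\<bar> * indicator {\<omega>. real L < \<bar>Z \<omega>\<bar>} \<omega>)
        + ennreal (real L) * indicator {\<omega>\<in>space M. K < \<bar>f n \<omega>\<bar>} \<omega> \<partial>M)"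
      by (intro nn_integral_mono) (auto simp: indicator_def not_less intro!: ennreal_leI)
    also have "\<dots> = (\<integral>\<^sup>+ \<omega>. ennreal (\<bar>Z \<omega>\<bar> * indicator {\<omega>. real L < \<bar>Z \<omega>\<bar>} \<omega>) \<partial>M)
        + ennreal (real L) * emeasure M {\<omega>\<in>space M. K < \<bar>f n \<omega>\<bar>}"
      by (subst nn_integral_add) (auto simp: nn_integral_cmult_indicator)
    also have "(\<integral>\<^sup>+ \<omega>. ennreal (\<bar>Z \<omega>\<bar> * indicator {\<omega>. real L < \<bar>Z \<omega>\<bar>} \<omega>) \<partial>M) \<le> ennreal (e / 2)"
      using Zi L by (subst nn_integral_eq_integral) (auto intro!: ennreal_leI)
    finally have "(\<integral>\<^sup>+ \<omega>. ennreal \<bar>f n \<omega>\<bar> * indicator ?B \<omega> \<partial>M) \<le> ennreal (e / 2) + ennreal (real L) * emeasure M {\<omega>\<in>space M. K < \<bar>f n \<omega>\<bar>}"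
      by (simp add: add_right_mono)
    also have "\<dots> \<le> ennreal (e / 2) + ennreal (e / 2)" by (rule add_left_mono[OF LP])
    also have "\<dots> = ennreal e" using e by (simp flip: ennreal_plus)
    finally show "(\<integral>\<^sup>+ \<omega>. ennreal \<bar>f n \<omega>\<bar> * indicator ?B \<omega> \<partial>M) \<le> ennreal e" .
  qed
qed

section \<open>Upcrossings\<close>

text \<open>
  The betting strategy behind the upcrossing inequality: buy as soon as the sequence is at or below \<open>a\<close>,
  sell as soon as it is at or above \<open>b\<close>. An upcrossing is a completed sale.
\<close>

primrec holding :: "real \<Rightarrow> real \<Rightarrow> (nat \<Rightarrow> real) \<Rightarrow> nat \<Rightarrow> bool" where
  "holding a b y 0 \<longleftrightarrow> y 0 \<le> a"
| "holding a b y (Suc n) \<longleftrightarrow> (if holding a b y n then y (Suc n) < b else y (Suc n) \<le> a)"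

primrec upcrossings :: "real \<Rightarrow> real \<Rightarrow> (nat \<Rightarrow> real) \<Rightarrow> nat \<Rightarrow> nat" where
  "upcrossings a b y 0 = 0"
| "upcrossings a b y (Suc n) = upcrossings a b y n + (if holding a b y n \<and> b \<le> y (Suc n) then 1 else 0)"

lemma upcrossings_mono: "m \<le> n \<Longrightarrow> upcrossings a b y m \<le> upcrossings a b y n"
  by (rule lift_Suc_mono_le[of "upcrossings a b y"]) auto

lemma upcrossings_cong:
  assumes "\<And>i. i \<le> n \<Longrightarrow> y i = z i"
  shows "holding a b y n = holding a b z n \<and> upcrossings a b y n = upcrossings a b z n"
  using assms by (induction n) auto

lemma upcrossings_gain:
  assumes "a < b" "i < j" "y i \<le> a" "b \<le> y j"
  shows "upcrossings a b y i < upcrossings a b y j"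
proof -
  have h: "holding a b y i" using assms(1,3) by (cases i) auto
  have "upcrossings a b y i < upcrossings a b y n \<or> holding a b y n \<and> n < j" if "i \<le> n" "n \<le> j" for n
    using that
  proof (induction n rule: dec_induct)
    case base
    then show ?case using h assms(2) by simp
  next
    case (step n)
    then show ?case using assms(4) upcrossings_mono[OF step.hyps(1), of a b y]
      by (cases "Suc n = j") (auto simp: not_less less_Suc_eq_le)
  qed
  from this[of j] show ?thesis using assms(2) by auto
qed

text \<open>
  Each sale yields at least \<open>b - a\<close>, and a position that is still open was bought at or below \<open>a\<close>, so it has
  lost at most \<open>\<bar>y n\<bar> + \<bar>a\<bar>\<close>.
\<close>

lemma upcrossings_le_gains:
  assumes "a < b"
  shows "(b - a) * upcrossings a b y n
    \<le> (\<Sum>j<n. (if holding a b y j then 1 else 0) * (y (Suc j) - y j)) + \<bar>y n\<bar> + \<bar>a\<bar>"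
proof -
  have "(b - a) * upcrossings a b y n + (if holding a b y n then y n - a else 0)
    \<le> (\<Sum>j<n. (if holding a b y j then 1 else 0) * (y (Suc j) - y j))"
  proof (induction n)
    case (Suc n)
    then show ?case using assms by (auto simp: algebra_simps split: if_splits)
  qed (use assms in auto)
  then show ?thesis using abs_ge_minus_self[of "y n"] abs_ge_self[of a]
    by (auto split: if_splits)
qed

text \<open>
  The decision to hold is taken with the information of the present, so the gains against a martingale
  have mean zero. The tail form of the inequality is the one that survives a limit along grids.
\<close>

lemma upcrossing_inequality:
  fixes Y :: "nat \<Rightarrow> 'a \<Rightarrow> real" and G :: "nat \<Rightarrow> 'a measure"
  assumes prob: "prob_space M" and ab: "a < b"
    and sub: "\<And>i. subalgebra M (G i)" and incr: "\<And>i. sets (G i) \<subseteq> sets (G (Suc i))"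
    and meas: "\<And>i. Y i \<in> borel_measurable (G i)" and int: "\<And>i. integrable M (Y i)"
    and mart: "\<And>i B. B \<in> sets (G i) \<Longrightarrow> (LINT \<omega>:B|M. Y (Suc i) \<omega>) = (LINT \<omega>:B|M. Y i \<omega>)"
  shows "(\<lambda>\<omega>. upcrossings a b (\<lambda>i. Y i \<omega>) n) \<in> measurable M (count_space UNIV)"
    and "(b - a) * real K * measure M {\<omega>\<in>space M. K \<le> upcrossings a b (\<lambda>i. Y i \<omega>) n} \<le> (\<integral>\<omega>. \<bar>Y n \<omega>\<bar> \<partial>M) + \<bar>a\<bar>"
proof -
  interpret prob_space M by fact
  have mono: "sets (G i) \<subseteq> sets (G j)" if "i \<le> j" for i j
    using lift_Suc_mono_le[of "\<lambda>i. sets (G i)", OF incr that] .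
  have sp: "space (G i) = space M" for i using sub by (simp add: subalgebra_def)
  have hold: "Measurable.pred (G n) (\<lambda>\<omega>. holding a b (\<lambda>i. Y i \<omega>) n)" for n
  proof (induction n)
    case 0
    show ?case using meas[of 0] by simp
  next
    case (Suc n)
    note [measurable] = meas[of "Suc n"]
    have [measurable]: "Measurable.pred (G (Suc n)) (\<lambda>\<omega>. holding a b (\<lambda>i. Y i \<omega>) n)"
      using Suc mono[of n "Suc n"] by (auto simp: pred_def sp)
    show ?case by simp
  qed
  have YM [measurable]: "Y i \<in> borel_measurable M" for i
    using measurable_from_subalg[OF sub meas] .
  have holdM [measurable]: "Measurable.pred M (\<lambda>\<omega>. holding a b (\<lambda>i. Y i \<omega>) n)" for n
    using measurable_from_subalg[OF sub hold] .
  show upM [measurable]: "(\<lambda>\<omega>. upcrossings a b (\<lambda>i. Y i \<omega>) n) \<in> measurable M (count_space UNIV)" for n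
    by (induction n) auto
  have gain: "(\<integral>\<omega>. (if holding a b (\<lambda>i. Y i \<omega>) j then 1 else 0) * (Y (Suc j) \<omega> - Y j \<omega>) \<partial>M) = 0 \<and>
    integrable M (\<lambda>\<omega>. (if holding a b (\<lambda>i. Y i \<omega>) j then 1 else 0) * (Y (Suc j) \<omega> - Y j \<omega>))" for j
  proof -
    define B where "B = {\<omega>\<in>space M. holding a b (\<lambda>i. Y i \<omega>) j}"
    have B: "B \<in> sets (G j)" using hold[of j] by (simp add: B_def pred_def sp)
    have BM: "B \<in> sets M" by (simp add: B_def)
    have eq: "(if holding a b (\<lambda>i. Y i \<omega>) j then 1 else 0) * (Y (Suc j) \<omega> - Y j \<omega>) = indicator B \<omega> * Y (Suc j) \<omega> - indicator B \<omega> * Y j \<omega>"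
      if "\<omega> \<in> space M" for \<omega> using that by (auto simp: B_def)
    have i: "integrable M (\<lambda>\<omega>. indicator B \<omega> * Y i \<omega>)" for i
      using integrable_mult_indicator[OF BM int[of i]] by simp
    have "(\<integral>\<omega>. (if holding a b (\<lambda>i. Y i \<omega>) j then 1 else 0) * (Y (Suc j) \<omega> - Y j \<omega>) \<partial>M)
        = (\<integral>\<omega>. indicator B \<omega> * Y (Suc j) \<omega> \<partial>M) - (\<integral>\<omega>. indicator B \<omega> * Y j \<omega> \<partial>M)"
      unfolding Bochner_Integration.integral_diff[OF i i, symmetric]
      by (rule Bochner_Integration.integral_cong[OF refl eq])
    also have "\<dots> = 0" using mart[OF B] by (simp add: set_lebesgue_integral_def)
    finally show ?thesis using i[of j] i[of "Suc j"]
      by (auto simp: eq cong: Bochner_Integration.integrable_cong)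
  qed
  let ?U = "\<lambda>\<omega>. upcrossings a b (\<lambda>i. Y i \<omega>) n"
  let ?g = "\<lambda>\<omega>. (\<Sum>j<n. (if holding a b (\<lambda>i. Y i \<omega>) j then 1 else 0) * (Y (Suc j) \<omega> - Y j \<omega>)) + \<bar>Y n \<omega>\<bar> + \<bar>a\<bar>"
  have gi: "integrable M ?g" using gain int by (intro Bochner_Integration.integrable_add integrable_abs Bochner_Integration.integrable_sum) auto
  have S: "{\<omega>\<in>space M. K \<le> ?U \<omega>} \<in> sets M" by measurable
  have "(b - a) * real K * measure M {\<omega>\<in>space M. K \<le> ?U \<omega>} = (\<integral>\<omega>. (b - a) * real K * indicator {\<omega>\<in>space M. K \<le> ?U \<omega>} \<omega> \<partial>M)"
    using S by simp
  also have "\<dots> \<le> (\<integral>\<omega>. ?g \<omega> \<partial>M)"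
  proof (rule integral_mono[OF _ gi])
    fix \<omega> assume "\<omega> \<in> space M"
    have "(b - a) * real K * indicator {\<omega>\<in>space M. K \<le> ?U \<omega>} \<omega> \<le> (b - a) * ?U \<omega>"
      using ab by (auto simp: indicator_def)
    then show "(b - a) * real K * indicator {\<omega>\<in>space M. K \<le> ?U \<omega>} \<omega> \<le> ?g \<omega>"
      using upcrossings_le_gains[OF ab, of "\<lambda>i. Y i \<omega>" n] by linarith
  next
    have "integrable M (indicator {\<omega>\<in>space M. K \<le> ?U \<omega>} :: 'a \<Rightarrow> real)"
      using S by (intro integrable_real_indicator) (auto simp: emeasure_eq_measure)
    then show "integrable M (\<lambda>\<omega>. (b - a) * real K * indicator {\<omega>\<in>space M. K \<le> ?U \<omega>} \<omega>)"
      by (intro Bochner_Integration.integrable_mult_right)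
  qed
  also have "\<dots> = (\<integral>\<omega>. \<bar>Y n \<omega>\<bar> \<partial>M) + \<bar>a\<bar>"
    using gain int by (subst Bochner_Integration.integral_add)
      (auto intro!: Bochner_Integration.integrable_add Bochner_Integration.integrable_sum simp: prob_space)
  finally show "(b - a) * real K * measure M {\<omega>\<in>space M. K \<le> ?U \<omega>} \<le> (\<integral>\<omega>. \<bar>Y n \<omega>\<bar> \<partial>M) + \<bar>a\<bar>" .
qed

lemma right_neighbourhood_in_open:
  fixes f :: "real \<Rightarrow> real"
  assumes "continuous (at_right p) f" "f p \<in> U" "open U"
  obtains e where "0 < e" "\<And>s. p < s \<Longrightarrow> s < p + e \<Longrightarrow> f s \<in> U"
proof -
  have "\<forall>\<^sub>F s in at_right p. f s \<in> U"
    using assms topological_tendstoD unfolding continuous_within by blast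
  then obtain d where "p < d" "\<forall>s>p. s < d \<longrightarrow> f s \<in> U" unfolding eventually_at_right_field by blast
  then show ?thesis by (intro that[of "d - p"]) auto
qed

lemma eventually_grid_point:
  fixes p e :: real
  assumes "0 \<le> p" "0 < e"
  shows "\<forall>\<^sub>F k in sequentially. \<exists>i::nat. p < i / k \<and> i / k < p + e"
proof -
  have "\<forall>\<^sub>F k in sequentially. 1 / e < real k \<and> 0 < k"
    using filterlim_real_sequentially[unfolded filterlim_at_top_dense, rule_format, of "1/e"] eventually_gt_at_top[of 0]
    by eventually_elim auto
  then show ?thesis
  proof eventually_elim
    case (elim k)
    define i where "i = Suc (nat \<lfloor>p * k\<rfloor>)"
    have "0 \<le> p * k" using assms by auto
    then have i: "p * k < i" "real i \<le> p * k + 1" by (auto simp: i_def) linarith+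
    have "1 < e * k" using elim assms by (simp add: field_simps)
    then have "real i < (p + e) * k" using i by (simp add: algebra_simps)
    then show ?case using i elim by (intro exI[of _ i]) (auto simp: field_simps)
  qed
qed

text \<open>
  Finitely many crossings of a right-continuous path are seen on every sufficiently fine grid, since each
  extreme value persists for a short time. The grid \<open>{0, 1/k, ..., k}\<close> becomes finer and longer with \<open>k\<close>, and
  stopping after the last of these crossings does not affect them.
\<close>

lemma oscillation_upcrossings:
  fixes f :: "real \<Rightarrow> real"
  assumes rc: "\<And>t. 0 \<le> t \<Longrightarrow> continuous (at_right t) f" and ab: "a < b"
    and fa: "\<exists>\<^sub>F t in at_top. f t < a" and fb: "\<exists>\<^sub>F t in at_top. b < f t"
  shows "\<exists>H. \<forall>\<^sub>F k in sequentially. \<forall>T\<ge>H. K \<le> upcrossings a b (\<lambda>i. f (min T (i / k))) (k * k)"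
proof -
  have "\<exists>H\<ge>0. \<forall>\<^sub>F k in sequentially. \<exists>n::nat. n / k \<le> H \<and> 0 < k \<and> K \<le> upcrossings a b (\<lambda>i. f (i / k)) n"
  proof (induction K)
    case 0
    have "\<forall>\<^sub>F k in sequentially. \<exists>n::nat. n / k \<le> 0 \<and> 0 < k \<and> 0 \<le> upcrossings a b (\<lambda>i. f (i / k)) n"
      using eventually_gt_at_top[of "0::nat"] by eventually_elim (rule exI[of _ 0], simp)
    then show ?case by (intro exI[of _ 0]) auto
  next
    case (Suc K)
    then obtain H where H: "0 \<le> H" "\<forall>\<^sub>F k in sequentially. \<exists>n::nat. n / k \<le> H \<and> 0 < k \<and> K \<le> upcrossings a b (\<lambda>i. f (i / k)) n"
      by auto
    obtain p where p: "H \<le> p" "f p < a"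
      using fa[unfolded frequently_def eventually_at_top_linorder] by (meson not_le_imp_less)
    obtain e where e: "0 < e" "\<And>s. p < s \<Longrightarrow> s < p + e \<Longrightarrow> f s \<in> {..<a}"
      using right_neighbourhood_in_open[OF rc, of p "{..<a}"] p H(1) by auto
    obtain q where q: "p + e \<le> q" "b < f q"
      using fb[unfolded frequently_def eventually_at_top_linorder] by (meson not_le_imp_less)
    obtain d where d: "0 < d" "\<And>s. q < s \<Longrightarrow> s < q + d \<Longrightarrow> f s \<in> {b<..}"
      using right_neighbourhood_in_open[OF rc, of q "{b<..}"] q p H(1) e(1) by auto
    have evp: "\<forall>\<^sub>F k in sequentially. \<exists>i::nat. p < i / k \<and> i / k < p + e"
      and evq: "\<forall>\<^sub>F k in sequentially. \<exists>i::nat. q < i / k \<and> i / k < q + d"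
      using H p q e(1) d(1) by (auto intro!: eventually_grid_point)
    have "\<forall>\<^sub>F k in sequentially. \<exists>n::nat. n / k \<le> q + d \<and> 0 < k \<and> Suc K \<le> upcrossings a b (\<lambda>i. f (i / k)) n"
      using H(2) evp evq
    proof (eventually_elim)
      fix k :: nat assume "\<exists>n::nat. n / k \<le> H \<and> 0 < k \<and> K \<le> upcrossings a b (\<lambda>i. f (i / k)) n"
        "\<exists>i::nat. p < i / k \<and> i / k < p + e" "\<exists>i::nat. q < i / k \<and> i / k < q + d"
      then obtain n i j :: nat where *: "n / k \<le> H" "0 < k" "K \<le> upcrossings a b (\<lambda>i. f (i / k)) n"
        "p < i / k" "i / k < p + e" "q < j / k" "j / k < q + d" by auto
      have "real n / k < real i / k" "real i / k < real j / k" using * p q by linarith+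
      then have "n < i" "i < j" using *(2) by (auto simp: divide_less_cancel)
      then have "upcrossings a b (\<lambda>i. f (i / k)) n \<le> upcrossings a b (\<lambda>i. f (i / k)) i"
        "upcrossings a b (\<lambda>i. f (i / k)) i < upcrossings a b (\<lambda>i. f (i / k)) j"
        using e(2)[of "i/k"] d(2)[of "j/k"] * ab by (auto intro!: upcrossings_mono upcrossings_gain)
      then show "\<exists>n::nat. n / k \<le> q + d \<and> 0 < k \<and> Suc K \<le> upcrossings a b (\<lambda>i. f (i / k)) n"
        using * by (intro exI[of _ j]) auto
    qed
    then show ?case using H p q e d by (intro exI[of _ "q + d"]) auto
  qed
  then obtain H where H: "0 \<le> H" "\<forall>\<^sub>F k in sequentially. \<exists>n::nat. n / k \<le> H \<and> 0 < k \<and> K \<le> upcrossings a b (\<lambda>i. f (i / k)) n"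
    by auto
  have "\<forall>\<^sub>F k in sequentially. H < real k"
    using filterlim_real_sequentially[unfolded filterlim_at_top_dense] by blast
  with H(2) have "\<forall>\<^sub>F k in sequentially. \<forall>T\<ge>H. K \<le> upcrossings a b (\<lambda>i. f (min T (i / k))) (k * k)"
  proof eventually_elim
    case (elim k)
    then obtain n :: nat where n: "n / k \<le> H" "0 < k" "K \<le> upcrossings a b (\<lambda>i. f (i / k)) n" by auto
    have "real n \<le> H * k" using n by (simp add: field_simps)
    also have "\<dots> \<le> real k * k" using elim(2) by (intro mult_right_mono) auto
    finally have nk: "n \<le> k * k" by (metis of_nat_le_iff of_nat_mult)
    show ?case
    proof (intro allI impI)
      fix T assume T: "H \<le> T"
      have "upcrossings a b (\<lambda>i. f (min T (i / k))) n = upcrossings a b (\<lambda>i. f (i / k)) n"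
      proof (rule upcrossings_cong[THEN conjunct2])
        fix i assume "i \<le> n"
        then have "real i / k \<le> real n / k" by (simp add: divide_right_mono)
        then have "min T (i / k) = i / k" using n(1) T by linarith
        then show "f (min T (i / k)) = f (i / k)" by simp
      qed
      then show "K \<le> upcrossings a b (\<lambda>i. f (min T (i / k))) (k * k)"
        using n(3) upcrossings_mono[OF nk, of a b "\<lambda>i. f (min T (i / k))"] by simp
    qed
  qed
  then show ?thesis by blast
qed

lemma converges_or_oscillates:
  fixes f :: "real \<Rightarrow> real"
  obtains l :: ereal where "((\<lambda>t. ereal (f t)) \<longlongrightarrow> l) at_top"
  | a b :: real where "a \<in> \<rat>" "b \<in> \<rat>" "a < b" "\<exists>\<^sub>F t in at_top. f t < a" "\<exists>\<^sub>F t in at_top. b < f t"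
proof (cases "Liminf at_top (\<lambda>t. ereal (f t)) = Limsup at_top (\<lambda>t. ereal (f t))")
  case True
  then show ?thesis using that(1) Liminf_eq_Limsup[of at_top "\<lambda>t. ereal (f t)"] by (metis trivial_limit_at_top_linorder)
next
  case False
  then have lt: "Liminf at_top (\<lambda>t. ereal (f t)) < Limsup at_top (\<lambda>t. ereal (f t))"
    using Liminf_le_Limsup[of at_top "\<lambda>t. ereal (f t)"] by (simp add: order_less_le)
  then obtain c d where cd: "Liminf at_top (\<lambda>t. ereal (f t)) < ereal c" "c < d" "ereal d < Limsup at_top (\<lambda>t. ereal (f t))"
    by (metis ereal_dense2 ereal_less(1) less_ereal.simps(1))
  obtain a where a: "a \<in> \<rat>" "c < a" "a < (c + d) / 2" using Rats_dense_in_real[of c "(c+d)/2"] cd by auto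
  obtain b where b: "b \<in> \<rat>" "(c + d) / 2 < b" "b < d" using Rats_dense_in_real[of "(c+d)/2" d] cd by auto
  have "\<exists>\<^sub>F t in at_top. f t < a"
  proof (rule ccontr)
    assume "\<not> ?thesis"
    then have "\<forall>\<^sub>F t in at_top. ereal c \<le> ereal (f t)" unfolding not_frequently
      by (rule eventually_mono) (use a in auto)
    from Liminf_bounded[OF this] show False using cd(1) by simp
  qed
  moreover have "\<exists>\<^sub>F t in at_top. b < f t"
  proof (rule ccontr)
    assume "\<not> ?thesis"
    then have "\<forall>\<^sub>F t in at_top. ereal (f t) \<le> ereal d" unfolding not_frequently
      by (rule eventually_mono) (use b in auto)
    from Limsup_bounded[OF this] show False using cd(3) by simp
  qed
  ultimately show ?thesis using that(2)[of a b] a b by auto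
qed

section \<open>Paths\<close>

lemma right_continuous_sequence:
  fixes f :: "real \<Rightarrow> real"
  assumes "continuous (at_right r) f" "\<And>n. r \<le> s n" "s \<longlonglongrightarrow> r"
  shows "(\<lambda>n. f (s n)) \<longlonglongrightarrow> f r"
proof -
  have "continuous (at r within {r..}) f"
    using assms(1) by (simp add: at_within_Ici_at_right)
  then show ?thesis using assms(2,3) unfolding continuous_within_sequentially comp_def by auto
qed

lemma tendsto_add_inverse_Suc: "(\<lambda>n. r + 1 / real (Suc n)) \<longlonglongrightarrow> (r::real)"
  using tendsto_add[OF tendsto_const LIMSEQ_inverse_real_of_nat, of r] by (simp add: inverse_eq_divide)

lemma continuous_on_imp_right_continuous:
  fixes f :: "real \<Rightarrow> real"
  assumes "continuous_on {0..} f" "0 \<le> t"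
  shows "continuous (at_right t) f"
proof -
  have "continuous (at t within {0..}) f" using assms by (simp add: continuous_on_eq_continuous_within)
  then show ?thesis by (rule continuous_within_subset) (use assms(2) in auto)
qed

definition grid_ceiling :: "nat \<Rightarrow> real \<Rightarrow> real" where
  "grid_ceiling n r = of_int \<lceil>r * real (Suc n)\<rceil> / real (Suc n)"

lemma grid_ceiling_ge: "r \<le> grid_ceiling n r"
proof -
  have "r * real (Suc n) \<le> of_int \<lceil>r * real (Suc n)\<rceil>" by (rule le_of_int_ceiling)
  then show ?thesis unfolding grid_ceiling_def by (subst pos_le_divide_eq) auto
qed

lemma grid_ceiling_le: "grid_ceiling n r \<le> r + 1 / real (Suc n)"
proof -
  have "of_int \<lceil>r * real (Suc n)\<rceil> \<le> r * real (Suc n) + 1" by (rule of_int_ceiling_le_add_one)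
  then show ?thesis unfolding grid_ceiling_def by (simp add: divide_simps add.commute mult.commute)
qed

lemma grid_ceiling_tendsto: "(\<lambda>n. grid_ceiling n r) \<longlonglongrightarrow> r"
proof (rule tendsto_sandwich[OF _ _ tendsto_const tendsto_add_inverse_Suc])
qed (use grid_ceiling_ge grid_ceiling_le in \<open>auto intro!: always_eventually simp del: of_nat_Suc\<close>)

lemma bounded_mono_converges:
  fixes f :: "real \<Rightarrow> real"
  assumes mono: "\<And>s t. 0 \<le> s \<Longrightarrow> s \<le> t \<Longrightarrow> f s \<le> f t" and bd: "\<And>t. 0 \<le> t \<Longrightarrow> f t \<le> b"
  shows "\<exists>l. (f \<longlongrightarrow> l) at_top"
proof
  have bdd: "bdd_above (f ` {0..})" using bd by (intro bdd_aboveI2) auto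
  show "(f \<longlongrightarrow> Sup (f ` {0..})) at_top"
  proof (rule order_tendstoI)
    fix y assume "y < Sup (f ` {0..})"
    then obtain s where s: "0 \<le> s" "y < f s" using less_cSup_iff[OF _ bdd] by auto
    show "\<forall>\<^sub>F t in at_top. y < f t"
      using eventually_ge_at_top[of s] by eventually_elim (use mono[OF s(1)] s(2) less_le_trans in blast)
  next
    fix y assume y: "Sup (f ` {0..}) < y"
    show "\<forall>\<^sub>F t in at_top. f t < y"
      using eventually_ge_at_top[of 0]
    proof eventually_elim
      case (elim t)
      then have "f t \<le> Sup (f ` {0..})" by (intro cSup_upper bdd) simp
      then show ?case using y by simp
    qed
  qed
qed

lemma terminal_eqI: "((\<lambda>t. Y t \<omega>) \<longlongrightarrow> l) at_top \<Longrightarrow> terminal Y \<omega> = l"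
  unfolding terminal_def by (rule tendsto_Lim) simp_all

lemma continuous_sign_constant:
  fixes d :: "real \<Rightarrow> real"
  assumes c: "continuous_on {0..} d" and u: "0 \<le> u" "u \<le> v" and nz: "\<And>w. u \<le> w \<Longrightarrow> w \<le> v \<Longrightarrow> d w \<noteq> 0"
  shows "sgn (d v) = sgn (d u)"
proof (rule ccontr)
  assume ne: "sgn (d v) \<noteq> sgn (d u)"
  have cc: "continuous_on {u..v} d" using c by (rule continuous_on_subset) (use u in auto)
  have "d u \<noteq> 0" "d v \<noteq> 0" using nz u by auto
  with ne consider "d u < 0" "0 < d v" | "d v < 0" "0 < d u" by (auto simp: sgn_real_def split: if_splits)
  then show False
  proof cases
    case 1
    then obtain w where "u \<le> w" "w \<le> v" "d w = 0" using IVT'[of d u 0 v] u cc by auto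
    then show False using nz by blast
  next
    case 2
    then obtain w where "u \<le> w" "w \<le> v" "d w = 0" using IVT2'[of d v 0 u] u cc by auto
    then show False using nz by blast
  qed
qed

lemma sign_of_limit:
  fixes d :: "real \<Rightarrow> real"
  assumes "(d \<longlongrightarrow> l) at_top" and s: "\<And>v. u \<le> v \<Longrightarrow> sgn (d v) = s"
  shows "s * l = \<bar>l\<bar>"
proof -
  have lim: "((\<lambda>v. s * d v) \<longlongrightarrow> s * l) at_top" "((\<lambda>v. \<bar>d v\<bar>) \<longlongrightarrow> \<bar>l\<bar>) at_top"
    using assms(1) by (auto intro!: tendsto_intros)
  have "\<forall>\<^sub>F v in at_top. \<bar>d v\<bar> = s * d v"
    using eventually_ge_at_top[of u]
  proof eventually_elim
    case (elim v)
    show ?case unfolding s[OF elim, symmetric] by (simp add: sgn_real_def)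
  qed
  then have "((\<lambda>v. s * d v) \<longlongrightarrow> \<bar>l\<bar>) at_top" by (rule Lim_transform_eventually[OF lim(2)])
  then show ?thesis using lim(1) by (intro tendsto_unique[OF trivial_limit_at_top_linorder])
qed

text \<open>
  Every interval \<open>(\<tau>, \<tau> + \<eta>]\<close> has positive mass under \<open>da\<close>, hence contains a zero of \<open>x\<close>; right continuity
  carries the zeros to \<open>\<tau>\<close>.
\<close>

lemma zero_at_point_of_increase:
  fixes a x :: "real \<Rightarrow> real"
  assumes ac: "continuous_on {0..} a" and am: "mono_on {0..} a"
    and carried: "AE t in interval_measure (\<lambda>t. a (max 0 t)). 0 \<le> t \<longrightarrow> x t = 0"
    and rc: "continuous (at_right \<tau>) x" and \<tau>: "0 \<le> \<tau>" and inc: "\<And>\<eta>. 0 < \<eta> \<Longrightarrow> a \<tau> < a (\<tau> + \<eta>)"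
  shows "x \<tau> = 0"
proof -
  have mono: "a (max 0 s) \<le> a (max 0 t)" if "s \<le> t" for s t
    using am that by (auto simp: mono_on_def max_def)
  have cont: "continuous_on UNIV (\<lambda>t. a (max 0 t))"
    by (rule continuous_on_compose2[OF ac]) (auto intro!: continuous_intros)
  have rcont: "continuous (at_right t) (\<lambda>t. a (max 0 t))" for t
    using cont by (simp add: continuous_on_eq_continuous_at continuous_at_imp_continuous_within)
  have ex: "\<exists>s. \<tau> < s \<and> s \<le> \<tau> + \<eta> \<and> x s = 0" if \<eta>: "0 < \<eta>" for \<eta>
  proof (rule ccontr)
    assume no: "\<not> ?thesis"
    have "AE t in interval_measure (\<lambda>t. a (max 0 t)). t \<notin> {\<tau><..\<tau>+\<eta>}"
      using carried by eventually_elim (use no \<tau> in auto)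
    then have "emeasure (interval_measure (\<lambda>t. a (max 0 t))) {\<tau><..\<tau>+\<eta>} = 0"
      by (subst (asm) AE_iff_measurable[of "{\<tau><..\<tau>+\<eta>}"]) auto
    moreover have "emeasure (interval_measure (\<lambda>t. a (max 0 t))) {\<tau><..\<tau>+\<eta>} = a (max 0 (\<tau>+\<eta>)) - a (max 0 \<tau>)"
      by (rule emeasure_interval_measure_Ioc) (use \<eta> mono rcont in auto)
    ultimately show False using inc[OF \<eta>] \<tau> \<eta> by (simp add: max_def)
  qed
  have "\<forall>n. \<exists>s. \<tau> < s \<and> s \<le> \<tau> + 1 / real (Suc n) \<and> x s = 0" by (intro allI ex) simp
  from choice[OF this] obtain s where s: "\<And>n. \<tau> < s n" "\<And>n. s n \<le> \<tau> + 1 / real (Suc n)" "\<And>n. x (s n) = 0"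
    by blast
  have "s \<longlonglongrightarrow> \<tau>"
  proof (rule tendsto_sandwich[OF _ _ tendsto_const])
    show "(\<lambda>n. \<tau> + 1 / real (Suc n)) \<longlonglongrightarrow> \<tau>" by (rule tendsto_add_inverse_Suc)
  qed (use s in \<open>auto intro!: always_eventually less_imp_le simp del: of_nat_Suc\<close>)
  then have "(\<lambda>n. x (s n)) \<longlonglongrightarrow> x \<tau>" by (rule right_continuous_sequence[OF rc less_imp_le[OF s(1)]])
  then show ?thesis using s(3) by (simp add: LIMSEQ_const_iff)
qed

text \<open>
  Between \<open>p n\<close> and \<open>q n\<close> lies the last time \<open>\<tau>\<close> with \<open>a \<tau> \<le> y\<close>. Hence \<open>q n\<close> tends to \<open>\<tau>\<close> strictly from the
  right, and \<open>\<tau>\<close> is a point of increase of \<open>a\<close>.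
\<close>

lemma values_after_level_crossing:
  fixes a x :: "real \<Rightarrow> real" and p q :: "nat \<Rightarrow> real"
  assumes ac: "continuous_on {0..} a" and am: "mono_on {0..} a" and a0: "a 0 = 0" and y: "0 \<le> y"
    and carried: "AE t in interval_measure (\<lambda>t. a (max 0 t)). 0 \<le> t \<longrightarrow> x t = 0"
    and rc: "\<And>t. 0 \<le> t \<Longrightarrow> continuous (at_right t) x"
    and pq: "\<forall>\<^sub>F n in sequentially. 0 \<le> p n \<and> p n \<le> q n \<and> a (p n) \<le> y \<and> y < a (q n) \<and> q n - p n \<le> e n"
    and e: "e \<longlonglongrightarrow> 0"
  shows "(\<lambda>n. x (q n)) \<longlonglongrightarrow> 0" "(\<lambda>n. a (q n)) \<longlonglongrightarrow> y"
proof -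
  have le: "a s \<le> a t" if "0 \<le> s" "s \<le> t" for s t using am that by (auto simp: mono_on_def)
  define E where "E = {u\<in>{0..}. a u \<le> y}"
  obtain b where b: "0 \<le> b" "y < a b"
    using eventually_happens[OF pq] order_trans by (metis trivial_limit_sequentially)
  have below: "u < t" if "u \<in> E" "0 \<le> t" "y < a t" for u t
    using le[of t u] that unfolding E_def by force
  have ne: "E \<noteq> {}" using a0 y by (auto simp: E_def)
  have bdd: "bdd_above E" using below[OF _ b] by (meson bdd_above.I less_imp_le)
  have cl: "closed E" unfolding E_def
    using continuous_on_closed_Collect_le[OF ac continuous_on_const closed_atLeast] by simp
  define \<tau> where "\<tau> = Sup E"
  have \<tau>E: "\<tau> \<in> E" unfolding \<tau>_def by (rule closed_contains_Sup[OF ne bdd cl])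
  then have \<tau>0: "0 \<le> \<tau>" "a \<tau> \<le> y" by (auto simp: E_def)
  have above: "y < a t" if "\<tau> < t" for t
  proof (rule ccontr)
    assume "\<not> y < a t"
    then have "t \<in> E" using that \<tau>0 by (simp add: E_def)
    then have "t \<le> \<tau>" unfolding \<tau>_def by (rule cSup_upper[OF _ bdd])
    then show False using that by simp
  qed
  have ev: "\<forall>\<^sub>F n in sequentially. \<tau> < q n \<and> q n \<le> \<tau> + e n"
    using pq
  proof eventually_elim
    case (elim n)
    then have "p n \<le> \<tau>" unfolding \<tau>_def by (intro cSup_upper bdd) (auto simp: E_def)
    moreover have "\<tau> < q n" using below[OF \<tau>E, of "q n"] elim by auto
    ultimately show ?case using elim by auto
  qed
  define r where "r n = max \<tau> (q n)" for n
  have qr: "\<forall>\<^sub>F n in sequentially. r n = q n" using ev by eventually_elim (simp add: r_def)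
  have rlim: "r \<longlonglongrightarrow> \<tau>"
  proof (rule tendsto_sandwich[OF _ _ tendsto_const])
    show "(\<lambda>n. \<tau> + e n) \<longlonglongrightarrow> \<tau>" using tendsto_add[OF tendsto_const e, of \<tau>] by simp
    show "\<forall>\<^sub>F n in sequentially. r n \<le> \<tau> + e n" using ev by eventually_elim (simp add: r_def)
  qed (simp add: r_def)
  have rca: "continuous (at_right \<tau>) a" by (rule continuous_on_imp_right_continuous[OF ac \<tau>0(1)])
  have r\<tau>: "\<tau> \<le> r n" for n by (simp add: r_def)
  have "(\<lambda>n. a (r n)) \<longlonglongrightarrow> a \<tau>" by (rule right_continuous_sequence[OF rca r\<tau> rlim])
  then have aq: "(\<lambda>n. a (q n)) \<longlonglongrightarrow> a \<tau>" by (rule Lim_transform_eventually) (use qr in eventually_elim, simp)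
  have "y \<le> a \<tau>"
    by (rule tendsto_lowerbound[OF aq]) (use pq in eventually_elim, auto)
  then have ay: "a \<tau> = y" using \<tau>0 by simp
  then show "(\<lambda>n. a (q n)) \<longlonglongrightarrow> y" using aq by simp
  have "x \<tau> = 0"
    by (rule zero_at_point_of_increase[OF ac am carried rc]) (use \<tau>0 ay above in auto)
  moreover have "(\<lambda>n. x (r n)) \<longlonglongrightarrow> x \<tau>"
    by (rule right_continuous_sequence[OF rc[OF \<tau>0(1)] r\<tau> rlim])
  ultimately have "(\<lambda>n. x (r n)) \<longlonglongrightarrow> 0" by simp
  then show "(\<lambda>n. x (q n)) \<longlonglongrightarrow> 0" by (rule Lim_transform_eventually) (use qr in eventually_elim, simp)
qed

text \<open>
  Otherwise zeros \<open>z n\<close> of \<open>d\<close> and times \<open>r n \<ge> z n\<close> with \<open>x (r n) > \<delta>\<close> accumulate at one point \<open>\<rho>\<close>, where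
  \<open>d\<close> and \<open>x\<close> vanish. By right continuity, \<open>r n < \<rho>\<close> eventually. But then \<open>x\<close> has its left limit at \<open>\<rho>\<close> along
  both sequences, and this limit would be \<open>0\<close> and at least \<open>\<delta>\<close>. Jumps of \<open>x\<close> at the end of an excursion
  of \<open>d\<close> are therefore no obstacle.
\<close>

lemma small_shortly_after_zero:
  fixes d x :: "real \<Rightarrow> real"
  assumes dc: "continuous_on {0..} d" and x: "cadlag x"
    and zeros: "\<And>s. 0 \<le> s \<Longrightarrow> d s = 0 \<Longrightarrow> x s = 0"
    and \<delta>: "0 < \<delta>" and t: "0 \<le> t" and e: "e \<longlonglongrightarrow> (0::real)"
  shows "\<forall>\<^sub>F n in sequentially. \<forall>z r. 0 \<le> z \<longrightarrow> z \<le> r \<longrightarrow> r \<le> t \<longrightarrow> r - z \<le> e n \<longrightarrow> d z = 0 \<longrightarrow> x r \<le> \<delta>"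
proof (rule ccontr)
  let ?P = "\<lambda>n z r. 0 \<le> z \<and> z \<le> r \<and> r \<le> t \<and> r - z \<le> e n \<and> d z = 0 \<and> \<delta> < x r"
  assume "\<not> ?thesis"
  then have "\<exists>\<^sub>F n in sequentially. \<exists>z r. ?P n z r" by (simp add: not_eventually not_le)
  then have "infinite {n. \<exists>z r. ?P n z r}"
    unfolding cofinite_eq_sequentially[symmetric] frequently_cofinite .
  then obtain f :: "nat \<Rightarrow> nat" where f: "strict_mono f" "\<And>n. f n \<in> {n. \<exists>z r. ?P n z r}"
    using infinite_enumerate by blast
  then obtain z r where zr: "\<And>n. ?P (f n) (z n) (r n)" by simp metis
  have "seq_compact {0..t}" using compact_Icc by (simp add: compact_eq_seq_compact_metric)
  moreover have "\<forall>n. r n \<in> {0..t}" using zr by (auto intro: order_trans)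
  ultimately obtain \<rho> g where g: "\<rho> \<in> {0..t}" "strict_mono (g :: nat \<Rightarrow> nat)" "(r \<circ> g) \<longlonglongrightarrow> \<rho>"
    unfolding seq_compact_def by metis
  define r' where "r' n = r (g n)" for n
  define z' where "z' n = z (g n)" for n
  have r': "r' \<longlonglongrightarrow> \<rho>" using g(3) by (simp add: r'_def[abs_def] comp_def)
  have P: "0 \<le> z' n" "z' n \<le> r' n" "r' n - z' n \<le> e (f (g n))" "d (z' n) = 0" "\<delta> < x (r' n)" for n
    using zr[of "g n"] by (auto simp: r'_def z'_def)
  have "strict_mono (f \<circ> g)" using f(1) g(2) by (rule strict_mono_o)
  then have "(\<lambda>n. e (f (g n))) \<longlonglongrightarrow> 0" using LIMSEQ_subseq_LIMSEQ[OF e] by (simp add: comp_def)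
  then have zl: "(\<lambda>n. r' n - e (f (g n))) \<longlonglongrightarrow> \<rho>" using tendsto_diff[OF r'] by fastforce
  have z': "z' \<longlonglongrightarrow> \<rho>"
    by (rule tendsto_sandwich[OF _ _ zl r']) (use P in \<open>auto intro!: always_eventually simp: algebra_simps\<close>)
  have \<rho>0: "0 \<le> \<rho>" using g by simp
  have "(\<lambda>n. d (z' n)) \<longlonglongrightarrow> d \<rho>"
    by (rule continuous_on_tendsto_compose[OF dc z']) (use \<rho>0 P in auto)
  then have "d \<rho> = 0" using P(4) by (simp add: LIMSEQ_const_iff)
  then have x\<rho>: "x \<rho> = 0" using zeros \<rho>0 by simp
  have rc: "continuous (at_right \<rho>) x" using x \<rho>0 by (simp add: cadlag_def)
  obtain \<epsilon> where \<epsilon>: "0 < \<epsilon>" "\<And>s. \<rho> < s \<Longrightarrow> s < \<rho> + \<epsilon> \<Longrightarrow> x s \<in> {..<\<delta>}"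
    by (rule right_neighbourhood_in_open[OF rc, of "{..<\<delta>}"]) (use x\<rho> \<delta> in auto)
  have "\<forall>\<^sub>F n in sequentially. r' n < \<rho> + \<epsilon>" using r' \<epsilon>(1) by (intro order_tendstoD(2)) auto
  then have lt: "\<forall>\<^sub>F n in sequentially. r' n < \<rho>"
  proof eventually_elim
    case (elim n)
    show ?case
    proof (rule ccontr)
      assume "\<not> r' n < \<rho>"
      then have "x (r' n) \<le> \<delta>" using \<epsilon>(2)[of "r' n"] elim x\<rho> \<delta> by (cases "r' n = \<rho>") auto
      then show False using P(5)[of n] by simp
    qed
  qed
  then obtain n where "r' n < \<rho>" using eventually_happens by (metis trivial_limit_sequentially)
  then have "0 < \<rho>" using P(1,2)[of n] by linarith
  then obtain l where l: "(x \<longlongrightarrow> l) (at_left \<rho>)" using x unfolding cadlag_def by (meson less_imp_le)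
  have fr: "filterlim r' (at_left \<rho>) sequentially"
    using r' lt by (auto simp: filterlim_at elim: eventually_mono)
  have fz: "filterlim z' (at_left \<rho>) sequentially"
  proof -
    have "\<forall>\<^sub>F n in sequentially. z' n < \<rho>" using lt by eventually_elim (use P(2) in \<open>rule le_less_trans\<close>)
    then show ?thesis using z' by (auto simp: filterlim_at elim: eventually_mono)
  qed
  have "(\<lambda>n. x (z' n)) \<longlonglongrightarrow> l" using filterlim_compose[OF l fz] .
  then have "l = 0" using P(1,4) zeros by (simp add: LIMSEQ_const_iff)
  moreover have "(\<lambda>n. x (r' n)) \<longlonglongrightarrow> l" using filterlim_compose[OF l fr] .
  then have "\<delta> \<le> l" by (rule tendsto_lowerbound) (use P(5) in \<open>auto intro!: always_eventually less_imp_le\<close>)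
  ultimately show False using \<delta> by simp
qed

section \<open>Sign switches along a discrete martingale\<close>

text \<open>
  Since \<open>sgn (d i)\<close> is known at step \<open>i\<close>, the expectation of \<open>sgn (d i) * m i\<close> changes in the next step by that
  of \<open>(sgn d' - sgn d) * m' = v' * (\<bar>d'\<bar> - sgn d * d')\<close>, where the prime marks step \<open>i + 1\<close>. The second factor is
  nonnegative, vanishes unless the sign switches, and has the expectation of \<open>\<bar>d'\<bar> - \<bar>d\<bar>\<close>. So as long as
  \<open>v' \<le> x' \<le> \<delta>\<close> at switches, the total growth is at most \<open>\<delta> * E\<bar>d k\<bar>\<close>. A path is dropped at its first bad switch;
  by the martingale property the loss is at most the integral of \<open>\<bar>m k\<bar>\<close> over the dropped paths.
\<close>

lemma sign_switch_estimate:
  fixes m d x v :: "nat \<Rightarrow> 'a \<Rightarrow> real" and G :: "nat \<Rightarrow> 'a measure" and k :: nat and \<delta> :: real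
  defines "bad \<equiv> \<lambda>i \<omega>. \<exists>j<i. sgn (d (Suc j) \<omega>) \<noteq> sgn (d j \<omega>) \<and> \<delta> < x (Suc j) \<omega>"
  assumes prob: "prob_space M" and \<delta>: "0 \<le> \<delta>"
    and sub: "\<And>i. i \<le> k \<Longrightarrow> subalgebra M (G i)" and incr: "\<And>i j. i \<le> j \<Longrightarrow> j \<le> k \<Longrightarrow> sets (G i) \<subseteq> sets (G j)"
    and meas: "\<And>i. i \<le> k \<Longrightarrow> m i \<in> borel_measurable (G i)" "\<And>i. i \<le> k \<Longrightarrow> d i \<in> borel_measurable (G i)"
      "\<And>i. i \<le> k \<Longrightarrow> x i \<in> borel_measurable (G i)"
    and int: "\<And>i. i \<le> k \<Longrightarrow> integrable M (m i)" "\<And>i. i \<le> k \<Longrightarrow> integrable M (d i)"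
    and avg_m: "\<And>i B. i \<le> k \<Longrightarrow> B \<in> sets (G i) \<Longrightarrow> (LINT \<omega>:B|M. m k \<omega>) = (LINT \<omega>:B|M. m i \<omega>)"
    and avg_d: "\<And>i B. i \<le> k \<Longrightarrow> B \<in> sets (G i) \<Longrightarrow> (LINT \<omega>:B|M. d k \<omega>) = (LINT \<omega>:B|M. d i \<omega>)"
    and start: "AE \<omega> in M. m 0 \<omega> = 0"
    and prod: "AE \<omega> in M. \<forall>i\<le>k. m i \<omega> = v i \<omega> * d i \<omega> \<and> v i \<omega> \<le> x i \<omega>"
  shows "(\<integral>\<omega>. of_bool (\<not> bad k \<omega>) * (sgn (d k \<omega>) * m k \<omega>) \<partial>M)
    \<le> \<delta> * (\<integral>\<omega>. \<bar>d k \<omega>\<bar> \<partial>M) + (\<integral>\<omega>. of_bool (bad k \<omega>) * \<bar>m k \<omega>\<bar> \<partial>M)"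
proof -
  interpret prob_space M by fact
  have sp: "space (G i) = space M" if "i \<le> k" for i using sub[OF that] by (simp add: subalgebra_def)
  have up: "f \<in> borel_measurable (G j)" if "f \<in> borel_measurable (G i)" "i \<le> j" "j \<le> k" for f :: "'a \<Rightarrow> real" and i j
  proof (rule measurable_from_subalg[OF _ that(1)])
    show "subalgebra (G j) (G i)"
      unfolding subalgebra_def using incr[OF that(2,3)] sp[of i] sp[of j] that(2,3) by simp
  qed
  have toM: "f \<in> borel_measurable M" if "f \<in> borel_measurable (G i)" "i \<le> k" for f :: "'a \<Rightarrow> real" and i
    by (rule measurable_from_subalg[OF sub[OF that(2)] that(1)])
  have badG: "Measurable.pred (G i) (bad i)" if "i \<le> k" for i
  proof -
    have dx: "d j \<in> borel_measurable (G i)" "x j \<in> borel_measurable (G i)" if "j \<le> i" for j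
      using up[OF meas(2)[of j] that \<open>i \<le> k\<close>] up[OF meas(3)[of j] that \<open>i \<le> k\<close>] that \<open>i \<le> k\<close> by auto
    have "Measurable.pred (G i) (\<lambda>\<omega>. \<exists>j\<in>{..<i}. sgn (d (Suc j) \<omega>) \<noteq> sgn (d j \<omega>) \<and> \<delta> < x (Suc j) \<omega>)"
    proof (rule pred_intros_finite(4))
      fix j assume "j \<in> {..<i}"
      then have [measurable]: "d (Suc j) \<in> borel_measurable (G i)" "d j \<in> borel_measurable (G i)" "x (Suc j) \<in> borel_measurable (G i)"
        using dx by auto
      show "Measurable.pred (G i) (\<lambda>\<omega>. sgn (d (Suc j) \<omega>) \<noteq> sgn (d j \<omega>) \<and> \<delta> < x (Suc j) \<omega>)"
        by measurable
    qed simp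
    moreover have "bad i = (\<lambda>\<omega>. \<exists>j\<in>{..<i}. sgn (d (Suc j) \<omega>) \<noteq> sgn (d j \<omega>) \<and> \<delta> < x (Suc j) \<omega>)"
      unfolding bad_def by auto
    ultimately show ?thesis by (rule ssubst[rotated])
  qed
  have bm: "(\<lambda>\<omega>. of_bool (bad i \<omega>) :: real) \<in> borel_measurable (G i)"
    and bm': "(\<lambda>\<omega>. of_bool (\<not> bad i \<omega>) :: real) \<in> borel_measurable (G i)" if "i \<le> k" for i
    unfolding of_bool_def using badG[OF that] pred_intros_logic(2)[OF badG[OF that]] unfolding pred_def
    by (auto intro!: measurable_If)
  have sgnm: "(\<lambda>\<omega>. sgn (d i \<omega>)) \<in> borel_measurable (G i)" if "i \<le> k" for i
    by (rule measurable_compose[OF meas(2)[OF that] borel_measurable_sgn])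
  have main: "i \<le> k \<Longrightarrow> (\<integral>\<omega>. of_bool (\<not> bad i \<omega>) * (sgn (d i \<omega>) * m i \<omega>) \<partial>M)
    \<le> \<delta> * ((\<integral>\<omega>. \<bar>d i \<omega>\<bar> \<partial>M) - (\<integral>\<omega>. \<bar>d 0 \<omega>\<bar> \<partial>M)) + (\<integral>\<omega>. of_bool (bad i \<omega>) * \<bar>m k \<omega>\<bar> \<partial>M)" for i
  proof (induction i)
    case 0
    have "(\<integral>\<omega>. of_bool (\<not> bad 0 \<omega>) * (sgn (d 0 \<omega>) * m 0 \<omega>) \<partial>M) = 0"
      by (rule integral_eq_zero_AE, use start in eventually_elim) simp
    then show ?case by (simp add: bad_def)
  next
    case (Suc i)
    then have ik: "i \<le> k" "Suc i \<le> k" by auto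
    define h where "h \<omega> = of_bool (\<not> bad i \<omega>) * sgn (d i \<omega>)" for \<omega>
    have hG: "h \<in> borel_measurable (G i)" unfolding h_def[abs_def] using bm'[OF ik(1)] sgnm[OF ik(1)] by simp
    have hM: "h \<in> borel_measurable M" using toM[OF hG ik(1)] .
    have h1: "\<bar>h \<omega>\<bar> \<le> 1" for \<omega> by (auto simp: h_def abs_sgn_le_1)
    define g :: "'a \<Rightarrow> real" where "g \<omega> = of_bool (bad (Suc i) \<omega> \<and> \<not> bad i \<omega>)" for \<omega>
    have gG: "(\<lambda>\<omega>. g \<omega> :: real) \<in> borel_measurable (G (Suc i))"
    proof -
      have "(\<lambda>\<omega>. of_bool (bad (Suc i) \<omega>) * of_bool (\<not> bad i \<omega>) :: real) \<in> borel_measurable (G (Suc i))"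
        using bm[OF ik(2)] up[OF bm'[OF ik(1)], of "Suc i"] ik by simp
      then show ?thesis by (simp add: g_def[abs_def] of_bool_conj)
    qed
    have gM: "(\<lambda>\<omega>. g \<omega> :: real) \<in> borel_measurable M" using toM[OF gG ik(2)] .
    have bM: "(\<lambda>\<omega>. of_bool (bad j \<omega>) :: real) \<in> borel_measurable M" "(\<lambda>\<omega>. of_bool (\<not> bad j \<omega>) :: real) \<in> borel_measurable M"
      "(\<lambda>\<omega>. sgn (d j \<omega>)) \<in> borel_measurable M" if "j \<le> k" for j
      using toM[OF bm[OF that] that] toM[OF bm'[OF that] that] toM[OF sgnm[OF that] that] by auto
    have hm: "integrable M (\<lambda>\<omega>. h \<omega> * m j \<omega>)" "integrable M (\<lambda>\<omega>. sgn (d i \<omega>) * d j \<omega>)" if "j \<le> k" for j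
      using int[OF that] hM h1 bM(3)[OF ik(1)] abs_sgn_le_1 by (auto intro!: integrable_bounded_mult)
    have e1: "(\<integral>\<omega>. h \<omega> * m (Suc i) \<omega> \<partial>M) = (\<integral>\<omega>. h \<omega> * m i \<omega> \<partial>M)"
    proof -
      have "(\<integral>\<omega>. h \<omega> * m k \<omega> \<partial>M) = (\<integral>\<omega>. h \<omega> * m (Suc i) \<omega> \<partial>M)"
        using ik up[OF hG] int(1) meas(1) avg_m by (intro averaging_mult[OF prob sub[OF ik(2)]] hm) auto
      moreover have "(\<integral>\<omega>. h \<omega> * m k \<omega> \<partial>M) = (\<integral>\<omega>. h \<omega> * m i \<omega> \<partial>M)"
        using ik hG int(1) meas(1) avg_m by (intro averaging_mult[OF prob sub[OF ik(1)]] hm) auto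
      ultimately show ?thesis by simp
    qed
    have e2: "(\<integral>\<omega>. sgn (d i \<omega>) * d (Suc i) \<omega> \<partial>M) = (\<integral>\<omega>. \<bar>d i \<omega>\<bar> \<partial>M)"
    proof -
      have "(\<integral>\<omega>. sgn (d i \<omega>) * d k \<omega> \<partial>M) = (\<integral>\<omega>. sgn (d i \<omega>) * d (Suc i) \<omega> \<partial>M)"
        using ik up[OF sgnm] int(2) meas(2) avg_d by (intro averaging_mult[OF prob sub[OF ik(2)]] hm) auto
      moreover have "(\<integral>\<omega>. sgn (d i \<omega>) * d k \<omega> \<partial>M) = (\<integral>\<omega>. sgn (d i \<omega>) * d i \<omega> \<partial>M)"
        using ik sgnm int(2) meas(2) avg_d by (intro averaging_mult[OF prob sub[OF ik(1)]] hm) auto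
      moreover have "sgn (d i \<omega>) * d i \<omega> = \<bar>d i \<omega>\<bar>" for \<omega> by (simp add: sgn_real_def)
      ultimately show ?thesis by simp
    qed
    have gi: "integrable M (\<lambda>\<omega>. g \<omega> * \<bar>m j \<omega>\<bar>)" if "j \<le> k" for j
      using int(1)[OF that] gM by (intro integrable_bounded_mult) (auto simp: g_def)
    have e3: "(\<integral>\<omega>. g \<omega> * \<bar>m (Suc i) \<omega>\<bar> \<partial>M) \<le> (\<integral>\<omega>. g \<omega> * \<bar>m k \<omega>\<bar> \<partial>M)"
    proof -
      have "(\<integral>\<^sup>+ \<omega>. ennreal (g \<omega>) * ennreal \<bar>m (Suc i) \<omega>\<bar> \<partial>M) \<le> (\<integral>\<^sup>+ \<omega>. ennreal (g \<omega>) * ennreal \<bar>m k \<omega>\<bar> \<partial>M)"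
        using ik gG int(1) meas(1) avg_m by (intro averaging_abs_le[OF prob sub[OF ik(2)]]) auto
      moreover have "ennreal (g \<omega>) * ennreal \<bar>r\<bar> = ennreal (g \<omega> * \<bar>r\<bar>)" for \<omega> r
        by (simp add: g_def ennreal_mult)
      ultimately show ?thesis
        using gi[OF ik(2)] gi[of k] by (simp add: nn_integral_eq_integral g_def)
    qed
    let ?r = "\<lambda>\<omega>. h \<omega> * m (Suc i) \<omega> + g \<omega> * \<bar>m (Suc i) \<omega>\<bar> + \<delta> * (\<bar>d (Suc i) \<omega>\<bar> - sgn (d i \<omega>) * d (Suc i) \<omega>)"
    have ri: "integrable M ?r"
      using hm gi int ik by (intro Bochner_Integration.integrable_add Bochner_Integration.integrable_mult_right
          Bochner_Integration.integrable_diff integrable_abs) auto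
    have "(\<integral>\<omega>. of_bool (\<not> bad (Suc i) \<omega>) * (sgn (d (Suc i) \<omega>) * m (Suc i) \<omega>) \<partial>M) \<le> (\<integral>\<omega>. ?r \<omega> \<partial>M)"
    proof (rule integral_mono_AE[OF _ ri])
      show "integrable M (\<lambda>\<omega>. of_bool (\<not> bad (Suc i) \<omega>) * (sgn (d (Suc i) \<omega>) * m (Suc i) \<omega>))"
        using int(1)[OF ik(2)] bM[OF ik(2)] abs_sgn_le_1 by (intro integrable_bounded_mult) auto
      show "AE \<omega> in M. of_bool (\<not> bad (Suc i) \<omega>) * (sgn (d (Suc i) \<omega>) * m (Suc i) \<omega>) \<le> ?r \<omega>"
        using prod
      proof eventually_elim
        case (elim \<omega>)
        define s s' d' m' v' where "s = sgn (d i \<omega>)" and "s' = sgn (d (Suc i) \<omega>)" and "d' = d (Suc i) \<omega>"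
          and "m' = m (Suc i) \<omega>" and "v' = v (Suc i) \<omega>"
        have m': "m' = v' * d'" "v' \<le> x (Suc i) \<omega>" using elim ik by (auto simp: m'_def v'_def d'_def)
        have sd: "s' * d' = \<bar>d'\<bar>" by (simp add: s'_def d'_def sgn_real_def)
        have s1: "\<bar>s\<bar> \<le> 1" by (simp add: s_def abs_sgn_le_1)
        have "\<bar>s * z\<bar> \<le> \<bar>z\<bar>" for z using mult_right_mono[OF s1, of "\<bar>z\<bar>"] by (simp add: abs_mult)
        then have nn: "0 \<le> \<bar>d'\<bar> - s * d'" "0 \<le> \<bar>m'\<bar> + s * m'" by (smt (verit))+
        have badS: "bad (Suc i) \<omega> \<longleftrightarrow> bad i \<omega> \<or> s' \<noteq> s \<and> \<delta> < x (Suc i) \<omega>"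
          by (auto simp: bad_def less_Suc_eq s_def s'_def)
        have key: "s' * m' \<le> s * m' + \<delta> * (\<bar>d'\<bar> - s * d')" if "\<not> bad (Suc i) \<omega>"
        proof (cases "s' = s")
          case True
          then show ?thesis using nn(1) \<delta> by simp
        next
          case False
          then have "v' \<le> \<delta>" using that badS m'(2) by auto
          then have "v' * (\<bar>d'\<bar> - s * d') \<le> \<delta> * (\<bar>d'\<bar> - s * d')" by (rule mult_right_mono[OF _ nn(1)])
          moreover have "s' * m' - s * m' = v' * (s' * d' - s * d')" unfolding m'(1) by (simp add: algebra_simps)
          ultimately show ?thesis unfolding sd by simp
        qed
        show ?case
        proof (cases "bad (Suc i) \<omega>")
          case True
          then show ?thesis using nn \<delta> unfolding h_def g_def
            by (auto simp flip: s_def d'_def m'_def intro!: add_nonneg_nonneg)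
        next
          case False
          then have "\<not> bad i \<omega>" using badS by simp
          then show ?thesis using key[OF False] False
            by (simp add: h_def g_def s_def s'_def d'_def m'_def)
        qed
      qed
    qed
    also have "(\<integral>\<omega>. ?r \<omega> \<partial>M) = (\<integral>\<omega>. h \<omega> * m (Suc i) \<omega> \<partial>M) + (\<integral>\<omega>. g \<omega> * \<bar>m (Suc i) \<omega>\<bar> \<partial>M)
        + \<delta> * ((\<integral>\<omega>. \<bar>d (Suc i) \<omega>\<bar> \<partial>M) - (\<integral>\<omega>. sgn (d i \<omega>) * d (Suc i) \<omega> \<partial>M))"
      using hm[OF ik(2)] gi[OF ik(2)] int(2)[OF ik(2)] by simp
    also have "\<dots> \<le> (\<integral>\<omega>. of_bool (\<not> bad i \<omega>) * (sgn (d i \<omega>) * m i \<omega>) \<partial>M) + (\<integral>\<omega>. g \<omega> * \<bar>m k \<omega>\<bar> \<partial>M)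
        + \<delta> * ((\<integral>\<omega>. \<bar>d (Suc i) \<omega>\<bar> \<partial>M) - (\<integral>\<omega>. \<bar>d i \<omega>\<bar> \<partial>M))"
      using e1 e2 e3 by (simp add: h_def mult.assoc)
    also have "\<dots> \<le> \<delta> * ((\<integral>\<omega>. \<bar>d (Suc i) \<omega>\<bar> \<partial>M) - (\<integral>\<omega>. \<bar>d 0 \<omega>\<bar> \<partial>M))
        + ((\<integral>\<omega>. of_bool (bad i \<omega>) * \<bar>m k \<omega>\<bar> \<partial>M) + (\<integral>\<omega>. g \<omega> * \<bar>m k \<omega>\<bar> \<partial>M))"
      using Suc.IH[OF ik(1)] by (simp add: algebra_simps)
    also have "(\<integral>\<omega>. of_bool (bad i \<omega>) * \<bar>m k \<omega>\<bar> \<partial>M) + (\<integral>\<omega>. g \<omega> * \<bar>m k \<omega>\<bar> \<partial>M) = (\<integral>\<omega>. of_bool (bad (Suc i) \<omega>) * \<bar>m k \<omega>\<bar> \<partial>M)"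
    proof -
      have "integrable M (\<lambda>\<omega>. of_bool (bad i \<omega>) * \<bar>m k \<omega>\<bar>)"
        using int(1)[of k] bM(1)[OF ik(1)] by (intro integrable_bounded_mult) auto
      then have "(\<integral>\<omega>. of_bool (bad i \<omega>) * \<bar>m k \<omega>\<bar> \<partial>M) + (\<integral>\<omega>. g \<omega> * \<bar>m k \<omega>\<bar> \<partial>M) = (\<integral>\<omega>. of_bool (bad i \<omega>) * \<bar>m k \<omega>\<bar> + g \<omega> * \<bar>m k \<omega>\<bar> \<partial>M)"
        using gi[of k] by simp
      also have "\<dots> = (\<integral>\<omega>. of_bool (bad (Suc i) \<omega>) * \<bar>m k \<omega>\<bar> \<partial>M)"
        by (intro Bochner_Integration.integral_cong refl) (auto simp: g_def bad_def less_Suc_eq)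
      finally show ?thesis .
    qed
    finally show ?case .
  qed
  have "0 \<le> \<delta> * (\<integral>\<omega>. \<bar>d 0 \<omega>\<bar> \<partial>M)" using \<delta> by simp
  then show ?thesis using main[of k] by (simp add: right_diff_distrib)
qed

context signed_measure_setting
begin

section \<open>Optional stopping for the density process\<close>

lemma subalgebra_F: "0 \<le> t \<Longrightarrow> subalgebra P (F t)"
  unfolding subalgebra_def by (auto simp: space_F sets_F_inf)

text \<open>
  Paths are regular only almost surely. Because the filtration contains all null sets, almost sure limits
  of adapted quantities are still measurable.
\<close>

lemma measurable_cong_AE_complete:
  fixes f g :: "'a \<Rightarrow> real"
  assumes G: "space G = space P" "null_sets P \<subseteq> sets G"
    and f: "f \<in> borel_measurable G" and ae: "AE \<omega> in P. f \<omega> = g \<omega>"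
  shows "g \<in> borel_measurable G"
proof (rule measurableI)
  obtain N where N: "N \<in> null_sets P" "{\<omega>\<in>space P. f \<omega> \<noteq> g \<omega>} \<subseteq> N"
    using ae unfolding eventually_ae_filter by auto
  have sub: "B \<in> sets G" if "B \<subseteq> N" for B
  proof -
    have "B \<in> null_sets P" using N(1) that complete null_sets_subset by blast
    then show ?thesis using G(2) by auto
  qed
  fix B :: "real set" assume B: "B \<in> sets borel"
  have eq: "g -` B \<inter> space G = (f -` B \<inter> space G - N) \<union> (g -` B \<inter> space G \<inter> N)"
    using N(2) by (auto simp: G(1))
  show "g -` B \<inter> space G \<in> sets G"
    by (subst eq) (intro sets.Un sets.Diff measurable_sets[OF f B] sub, auto)
qed auto

lemma measurable_F_cong_AE:
  fixes f g :: "'a \<Rightarrow> real"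
  assumes "0 \<le> t" "f \<in> borel_measurable (F t)" "AE \<omega> in P. f \<omega> = g \<omega>"
  shows "g \<in> borel_measurable (F t)"
  by (rule measurable_cong_AE_complete[OF _ _ assms(2,3)])
    (use null_sets_F0 sets_F_mono[OF assms(1)] in \<open>auto simp: space_F\<close>)

abbreviation right_continuous_paths :: "(real \<Rightarrow> 'a \<Rightarrow> real) \<Rightarrow> bool" where
  "right_continuous_paths Y \<equiv> AE \<omega> in P. \<forall>t\<ge>0. continuous (at_right t) (\<lambda>t. Y t \<omega>)"

lemma stopping_nonneg: "finite_stopping_time P F R \<Longrightarrow> \<omega> \<in> space P \<Longrightarrow> 0 \<le> R \<omega>"
  by (simp add: finite_stopping_time_def)

lemma stopping: "finite_stopping_time P F R \<Longrightarrow> stopping_time F R"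
  by (simp add: finite_stopping_time_def)

lemma min_const_stopping:
  "finite_stopping_time P F R \<Longrightarrow> 0 \<le> u \<Longrightarrow> finite_stopping_time P F (\<lambda>\<omega>. min (R \<omega>) u)"
  unfolding finite_stopping_time_def by (auto intro!: stopping_time_min stopping_time_const)

text \<open>
  Approximate the stopping time from the right by grid times. They are capped at \<open>u\<close>, so that only values up
  to time \<open>u\<close> enter.
\<close>

lemma stopped_value_measurable:
  assumes Y: "adapted F Y" "right_continuous_paths Y" and R: "finite_stopping_time P F R" and u: "0 \<le> u"
  shows "(\<lambda>\<omega>. Y (min (R \<omega>) u) \<omega>) \<in> borel_measurable (F u)"
proof -
  have Ru: "(\<lambda>\<omega>. min (R \<omega>) u) \<in> borel_measurable (F u)"
  proof (rule borel_measurableI_le)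
    fix c
    have "{\<omega>\<in>space (F u). min (R \<omega>) u \<le> c} = (if u \<le> c then space (F u) else {\<omega>\<in>space (F u). R \<omega> \<le> c})"
      by (auto simp: min_le_iff_disj)
    then show "{\<omega>\<in>space (F u). min (R \<omega>) u \<le> c} \<in> sets (F u)"
      using stopping_time_le_const[OF stopping[OF R], of c u] by (auto simp: pred_def)
  qed
  define \<rho> where "\<rho> n \<omega> = min (grid_ceiling n (min (R \<omega>) u)) u" for n \<omega>
  have m: "(\<lambda>\<omega>. Y (\<rho> n \<omega>) \<omega>) \<in> borel_measurable (F u)" for n
  proof -
    define f where "f i \<omega> = Y (max 0 (min (of_int i / real (Suc n)) u)) \<omega>" for i :: int and \<omega>
    have fm: "f i \<in> borel_measurable (F u)" for i
    proof -
      have "Y (max 0 (min (of_int i / real (Suc n)) u)) \<in> borel_measurable (F (max 0 (min (of_int i / real (Suc n)) u)))"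
        using Y(1) by (simp add: adapted_def)
      moreover have "subalgebra (F u) (F (max 0 (min (of_int i / real (Suc n)) u)))"
        using u sets_F_mono[of "max 0 (min (of_int i / real (Suc n)) u)" u] by (auto simp: subalgebra_def space_F)
      ultimately show ?thesis unfolding f_def[abs_def] using measurable_from_subalg by blast
    qed
    have "(\<lambda>\<omega>. \<lceil>min (R \<omega>) u * real (Suc n)\<rceil>) \<in> measurable (F u) (count_space UNIV)"
      using Ru by measurable
    then have "(\<lambda>\<omega>. f \<lceil>min (R \<omega>) u * real (Suc n)\<rceil> \<omega>) \<in> borel_measurable (F u)"
      by (rule measurable_compose_countable[OF fm])
    moreover have "f \<lceil>min (R \<omega>) u * real (Suc n)\<rceil> \<omega> = Y (\<rho> n \<omega>) \<omega>" if "\<omega> \<in> space (F u)" for \<omega>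
    proof -
      have "0 \<le> min (R \<omega>) u" using u stopping_nonneg[OF R, of \<omega>] that by (simp add: space_F)
      then have "0 \<le> \<rho> n \<omega>" using grid_ceiling_ge[of "min (R \<omega>) u" n] u by (auto simp: \<rho>_def)
      then show ?thesis by (simp add: f_def \<rho>_def grid_ceiling_def max_def)
    qed
    ultimately show ?thesis by (simp cong: measurable_cong)
  qed
  have "(\<lambda>\<omega>. lim (\<lambda>n. Y (\<rho> n \<omega>) \<omega>)) \<in> borel_measurable (F u)"
    using m by (rule borel_measurable_lim_metric)
  moreover have "AE \<omega> in P. lim (\<lambda>n. Y (\<rho> n \<omega>) \<omega>) = Y (min (R \<omega>) u) \<omega>"
    using Y(2) AE_space
  proof eventually_elim
    case (elim \<omega>)
    have r0: "0 \<le> min (R \<omega>) u" using u stopping_nonneg[OF R elim(2)] by simp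
    have "(\<lambda>n. Y (\<rho> n \<omega>) \<omega>) \<longlonglongrightarrow> Y (min (R \<omega>) u) \<omega>"
    proof (rule right_continuous_sequence[where f="\<lambda>t. Y t \<omega>"])
      show "continuous (at_right (min (R \<omega>) u)) (\<lambda>t. Y t \<omega>)" using elim r0 by simp
      show "min (R \<omega>) u \<le> \<rho> n \<omega>" for n using grid_ceiling_ge[of "min (R \<omega>) u" n] by (simp add: \<rho>_def)
      have "(\<lambda>n. \<rho> n \<omega>) \<longlonglongrightarrow> min (min (R \<omega>) u) u"
        unfolding \<rho>_def by (intro tendsto_min grid_ceiling_tendsto tendsto_const)
      then show "(\<lambda>n. \<rho> n \<omega>) \<longlonglongrightarrow> min (R \<omega>) u" by simp
    qed
    then show ?case by (rule limI)
  qed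
  ultimately show ?thesis by (rule measurable_F_cong_AE[OF u])
qed

lemma value_at_stopping_time_measurable:
  assumes Y: "adapted F Y" "right_continuous_paths Y" and R: "finite_stopping_time P F R"
  shows "(\<lambda>\<omega>. Y (R \<omega>) \<omega>) \<in> borel_measurable (pre_sigma R)"
proof (rule measurableI)
  fix B :: "real set" assume B: "B \<in> sets borel"
  show "(\<lambda>\<omega>. Y (R \<omega>) \<omega>) -` B \<inter> space (pre_sigma R) \<in> sets (pre_sigma R)"
  proof (rule sets_pre_sigmaI[OF stopping[OF R]])
    fix t
    show "{\<omega> \<in> (\<lambda>\<omega>. Y (R \<omega>) \<omega>) -` B \<inter> space (pre_sigma R). R \<omega> \<le> t} \<in> sets (F t)"
    proof (cases "0 \<le> t")
      case True
      have "{\<omega> \<in> (\<lambda>\<omega>. Y (R \<omega>) \<omega>) -` B \<inter> space (pre_sigma R). R \<omega> \<le> t}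
        = ((\<lambda>\<omega>. Y (min (R \<omega>) t) \<omega>) -` B \<inter> space (F t)) \<inter> {\<omega>\<in>space (F t). R \<omega> \<le> t}"
        by (auto simp: space_pre_sigma space_F min_def)
      then show ?thesis
        using measurable_sets[OF stopped_value_measurable[OF Y R True] B] stopping_timeD[OF stopping[OF R], of t]
        by (auto simp: pred_def)
    next
      case False
      then have "{\<omega> \<in> (\<lambda>\<omega>. Y (R \<omega>) \<omega>) -` B \<inter> space (pre_sigma R). R \<omega> \<le> t} = {}"
        using stopping_nonneg[OF R] by (force simp: space_pre_sigma)
      then show ?thesis by (metis sets.empty_sets)
    qed
  qed
qed auto

lemma subalgebra_pre_sigma:
  assumes R: "finite_stopping_time P F R"
  shows "subalgebra P (pre_sigma R)"
  unfolding subalgebra_def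
proof
  show "sets (pre_sigma R) \<subseteq> sets P"
  proof
    fix A assume A: "A \<in> sets (pre_sigma R)"
    have "{\<omega>\<in>A. R \<omega> \<le> real n} \<in> sets P" for n :: nat
      using sets_pre_sigmaD[OF stopping[OF R] A, of "real n"] subalgebra_F[of "real n"] by (auto simp: subalgebra_def)
    then have "(\<Union>n::nat. {\<omega>\<in>A. R \<omega> \<le> real n}) \<in> sets P" by blast
    also have "(\<Union>n::nat. {\<omega>\<in>A. R \<omega> \<le> real n}) = A"
      using real_arch_simple by auto
    finally show "A \<in> sets P" .
  qed
qed (simp add: space_pre_sigma)

lemma pre_sigma_subset_F:
  assumes R: "finite_stopping_time P F R" and le: "\<And>\<omega>. \<omega> \<in> space P \<Longrightarrow> R \<omega> \<le> u"
  shows "sets (pre_sigma R) \<subseteq> sets (F u)"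
proof
  fix A assume A: "A \<in> sets (pre_sigma R)"
  have "{\<omega>\<in>A. R \<omega> \<le> u} = A" using sets.sets_into_space[OF A] le by (auto simp: space_pre_sigma)
  then show "A \<in> sets (F u)" using sets_pre_sigmaD[OF stopping[OF R] A, of u] by simp
qed

lemma D_inf_integrable: "integrable P D_inf"
  using density_D_inf by (simp add: is_signed_density_def)

lemma D_integrable: "0 \<le> t \<Longrightarrow> integrable P (D t)"
  using density_D by (simp add: is_signed_density_def)

lemma D_average: "0 \<le> t \<Longrightarrow> B \<in> sets (F t) \<Longrightarrow> (LINT \<omega>:B|P. D t \<omega>) = (LINT \<omega>:B|P. D_inf \<omega>)"
  using density_D[of t] density_D_inf subalgebra_F[of t] unfolding is_signed_density_def subalgebra_def
  by (metis subsetD)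

lemma adapted_D: "adapted F D"
  using density_D by (simp add: adapted_def is_signed_density_def)

lemma right_continuous_D: "right_continuous_paths D"
  using continuous_D by eventually_elim (simp add: continuous_on_imp_right_continuous)

lemma optional_stopping_D_finite_range:
  assumes R: "finite_stopping_time P F R" and V: "finite V" "\<And>\<omega>. \<omega> \<in> space P \<Longrightarrow> R \<omega> \<in> V"
  shows "integrable P (\<lambda>\<omega>. D (R \<omega>) \<omega>)"
    and "B \<in> sets (pre_sigma R) \<Longrightarrow> (LINT \<omega>:B|P. D_inf \<omega>) = (LINT \<omega>:B|P. D (R \<omega>) \<omega>)"
proof -
  define W where "W = V \<inter> {0..}"
  have W: "finite W" "\<And>\<omega>. \<omega> \<in> space P \<Longrightarrow> R \<omega> \<in> W" using V stopping_nonneg[OF R] by (auto simp: W_def)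
  define C where "C B v = {\<omega>\<in>B. R \<omega> = v}" for B v
  have CF: "C B v \<in> sets (F v)" if "B \<in> sets (pre_sigma R)" for B v
  proof -
    have "C B v = {\<omega>\<in>B. R \<omega> \<le> v} \<inter> {\<omega>\<in>space (F v). R \<omega> = v}"
      using sets.sets_into_space[OF that] by (auto simp: C_def space_pre_sigma space_F)
    then show ?thesis using sets_pre_sigmaD[OF stopping[OF R] that, of v] stopping_time_eq_const[OF stopping[OF R], of v]
      by (auto simp: pred_def)
  qed
  have CP: "C B v \<in> sets P" if "B \<in> sets (pre_sigma R)" "v \<in> W" for B v
    using CF[OF that(1), of v] subalgebra_F[of v] that(2) by (auto simp: subalgebra_def W_def)
  have split: "indicator B \<omega> * k (R \<omega>) \<omega> = (\<Sum>v\<in>W. indicator (C B v) \<omega> * k v \<omega>)" if "\<omega> \<in> space P" for B \<omega> and k :: "real \<Rightarrow> 'a \<Rightarrow> real"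
  proof -
    have "(\<Sum>v\<in>W. indicator (C B v) \<omega> * k v \<omega>) = (\<Sum>v\<in>W. if v = R \<omega> then indicator B \<omega> * k (R \<omega>) \<omega> else 0)"
      by (intro sum.cong) (auto simp: C_def indicator_def)
    then show ?thesis using W that by simp
  qed
  have iD: "integrable P (\<lambda>\<omega>. indicator (C B v) \<omega> * D v \<omega>)" if "B \<in> sets (pre_sigma R)" "v \<in> W" for B v
    using integrable_mult_indicator[OF CP[OF that] D_integrable[of v]] that by (simp add: W_def)
  have iDi: "integrable P (\<lambda>\<omega>. indicator (C B v) \<omega> * D_inf \<omega>)" if "B \<in> sets (pre_sigma R)" "v \<in> W" for B v
    using integrable_mult_indicator[OF CP[OF that] D_inf_integrable] by simp
  have "integrable P (\<lambda>\<omega>. \<Sum>v\<in>W. indicator (C (space P) v) \<omega> * D v \<omega>)"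
    by (intro Bochner_Integration.integrable_sum iD) (metis sets.top space_pre_sigma)
  then show "integrable P (\<lambda>\<omega>. D (R \<omega>) \<omega>)"
    using split[of _ "space P" D] by (subst Bochner_Integration.integrable_cong[OF refl]) (auto simp: indicator_def)
  assume B: "B \<in> sets (pre_sigma R)"
  have "(LINT \<omega>:B|P. D_inf \<omega>) = (\<integral>\<omega>. (\<Sum>v\<in>W. indicator (C B v) \<omega> * D_inf \<omega>) \<partial>P)"
    unfolding set_lebesgue_integral_def
    by (intro Bochner_Integration.integral_cong refl) (use split[of _ B "\<lambda>_. D_inf"] in simp)
  also have "\<dots> = (\<Sum>v\<in>W. \<integral>\<omega>. indicator (C B v) \<omega> * D_inf \<omega> \<partial>P)"
    by (intro Bochner_Integration.integral_sum iDi B)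
  also have "\<dots> = (\<Sum>v\<in>W. \<integral>\<omega>. indicator (C B v) \<omega> * D v \<omega> \<partial>P)"
    using D_average[OF _ CF[OF B]] by (intro sum.cong) (auto simp: set_lebesgue_integral_def W_def)
  also have "\<dots> = (\<integral>\<omega>. (\<Sum>v\<in>W. indicator (C B v) \<omega> * D v \<omega>) \<partial>P)"
    by (intro Bochner_Integration.integral_sum[symmetric] iD B)
  also have "\<dots> = (LINT \<omega>:B|P. D (R \<omega>) \<omega>)"
    unfolding set_lebesgue_integral_def
    by (intro Bochner_Integration.integral_cong refl) (use split[of _ B D] in simp)
  finally show "(LINT \<omega>:B|P. D_inf \<omega>) = (LINT \<omega>:B|P. D (R \<omega>) \<omega>)" .
qed

lemma grid_ceiling_stopping:
  assumes R: "finite_stopping_time P F R" and u: "0 \<le> u"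
  shows "finite_stopping_time P F (\<lambda>\<omega>. min (grid_ceiling n (R \<omega>)) u)"
  unfolding finite_stopping_time_def
proof
  have "stopping_time F (\<lambda>\<omega>. grid_ceiling n (R \<omega>))"
  proof
    fix t
    have *: "grid_ceiling n r \<le> t \<longleftrightarrow> r \<le> of_int \<lfloor>t * real (Suc n)\<rfloor> / real (Suc n)" for r
    proof -
      have "grid_ceiling n r \<le> t \<longleftrightarrow> of_int \<lceil>r * real (Suc n)\<rceil> \<le> t * real (Suc n)"
        unfolding grid_ceiling_def by (rule pos_divide_le_eq) simp
      also have "\<dots> \<longleftrightarrow> \<lceil>r * real (Suc n)\<rceil> \<le> \<lfloor>t * real (Suc n)\<rfloor>" by (rule le_floor_iff[symmetric])
      also have "\<dots> \<longleftrightarrow> r * real (Suc n) \<le> of_int \<lfloor>t * real (Suc n)\<rfloor>" by (rule ceiling_le_iff)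
      also have "\<dots> \<longleftrightarrow> r \<le> of_int \<lfloor>t * real (Suc n)\<rfloor> / real (Suc n)" by (rule pos_le_divide_eq[symmetric]) simp
      finally show ?thesis .
    qed
    have "of_int \<lfloor>t * real (Suc n)\<rfloor> / real (Suc n) \<le> t"
      by (subst pos_divide_le_eq) auto
    then show "Measurable.pred (F t) (\<lambda>\<omega>. grid_ceiling n (R \<omega>) \<le> t)"
      unfolding * by (rule stopping_time_le_const[OF stopping[OF R]])
  qed
  then show "stopping_time F (\<lambda>\<omega>. min (grid_ceiling n (R \<omega>)) u)" by (intro stopping_time_min stopping_time_const)
  show "\<forall>\<omega>\<in>space P. 0 \<le> min (grid_ceiling n (R \<omega>)) u"
  proof
    fix \<omega> assume "\<omega> \<in> space P"
    then show "0 \<le> min (grid_ceiling n (R \<omega>)) u"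
      using order_trans[OF stopping_nonneg[OF R] grid_ceiling_ge] u by simp
  qed
qed

text \<open>
  Grid times decrease to \<open>R\<close>, and for them optional stopping is a finite sum. The values of \<open>D\<close> at the grid
  times are conditional expectations of \<open>D_inf\<close>, hence uniformly integrable, and the averages converge.
\<close>

lemma optional_stopping_D:
  assumes R: "finite_stopping_time P F R" and le: "\<And>\<omega>. \<omega> \<in> space P \<Longrightarrow> R \<omega> \<le> u"
  shows "integrable P (\<lambda>\<omega>. D (R \<omega>) \<omega>)"
    and "B \<in> sets (pre_sigma R) \<Longrightarrow> (LINT \<omega>:B|P. D_inf \<omega>) = (LINT \<omega>:B|P. D (R \<omega>) \<omega>)"
proof -
  have u: "0 \<le> u" using le stopping_nonneg[OF R] not_empty by (meson equals0I order_trans)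
  define \<rho> where "\<rho> n \<omega> = min (grid_ceiling n (R \<omega>)) u" for n \<omega>
  have st: "finite_stopping_time P F (\<rho> n)" for n
    unfolding \<rho>_def[abs_def] by (rule grid_ceiling_stopping[OF R u])
  have V: "\<exists>V. finite V \<and> (\<forall>\<omega>\<in>space P. \<rho> n \<omega> \<in> V)" for n
  proof (intro exI conjI ballI)
    let ?V = "(\<lambda>i::int. min (of_int i / real (Suc n)) u) ` {0..\<lceil>u * real (Suc n)\<rceil>}"
    show "finite ?V" by simp
    fix \<omega> assume \<omega>: "\<omega> \<in> space P"
    have "R \<omega> * real (Suc n) \<le> u * real (Suc n)" using le[OF \<omega>] by (rule mult_right_mono) simp
    then have "\<lceil>R \<omega> * real (Suc n)\<rceil> \<le> \<lceil>u * real (Suc n)\<rceil>" by (rule ceiling_mono)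
    moreover have "0 \<le> R \<omega> * real (Suc n)" using stopping_nonneg[OF R \<omega>] by simp
    then have "0 \<le> \<lceil>R \<omega> * real (Suc n)\<rceil>" by linarith
    ultimately have "\<lceil>R \<omega> * real (Suc n)\<rceil> \<in> {0..\<lceil>u * real (Suc n)\<rceil>}" by simp
    then show "\<rho> n \<omega> \<in> ?V" unfolding \<rho>_def grid_ceiling_def by (rule rev_image_eqI) simp
  qed
  have iD: "integrable P (\<lambda>\<omega>. D (\<rho> n \<omega>) \<omega>)" for n
    using V[of n] optional_stopping_D_finite_range(1)[OF st] by blast
  have avg: "(LINT \<omega>:B|P. D_inf \<omega>) = (LINT \<omega>:B|P. D (\<rho> n \<omega>) \<omega>)" if "B \<in> sets (pre_sigma (\<rho> n))" for B n
    using V[of n] optional_stopping_D_finite_range(2)[OF st] that by blast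
  have sub: "sets (pre_sigma R) \<subseteq> sets (pre_sigma (\<rho> n))" for n
    by (rule mono_pre_sigma[OF stopping[OF R] stopping[OF st]]) (simp add: \<rho>_def grid_ceiling_ge le)
  have [measurable]: "(\<lambda>\<omega>. D (R \<omega>) \<omega>) \<in> borel_measurable P"
    by (rule measurable_from_subalg[OF subalgebra_pre_sigma[OF R]
          value_at_stopping_time_measurable[OF adapted_D right_continuous_D R]])
  have [measurable]: "(\<lambda>\<omega>. D (\<rho> n \<omega>) \<omega>) \<in> borel_measurable P" for n using iD by auto
  have lim: "AE \<omega> in P. (\<lambda>n. D (\<rho> n \<omega>) \<omega>) \<longlonglongrightarrow> D (R \<omega>) \<omega>"
    using right_continuous_D AE_space
  proof eventually_elim
    case (elim \<omega>)
    show ?case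
    proof (rule right_continuous_sequence[where f="\<lambda>t. D t \<omega>"])
      show "continuous (at_right (R \<omega>)) (\<lambda>t. D t \<omega>)" using elim stopping_nonneg[OF R] by simp
      show "R \<omega> \<le> \<rho> n \<omega>" for n using grid_ceiling_ge[of "R \<omega>" n] le[OF elim(2)] by (simp add: \<rho>_def)
      have "(\<lambda>n. \<rho> n \<omega>) \<longlonglongrightarrow> min (R \<omega>) u"
        unfolding \<rho>_def by (intro tendsto_min grid_ceiling_tendsto tendsto_const)
      then show "(\<lambda>n. \<rho> n \<omega>) \<longlonglongrightarrow> R \<omega>" using le[OF elim(2)] by (simp add: min_def)
    qed
  qed
  have main: "integrable P (\<lambda>\<omega>. indicator B \<omega> * D (R \<omega>) \<omega>) \<and> (LINT \<omega>:B|P. D_inf \<omega>) = (\<integral>\<omega>. indicator B \<omega> * D (R \<omega>) \<omega> \<partial>P)"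
    if B: "B \<in> sets (pre_sigma R)" for B
  proof -
    have BP [measurable]: "B \<in> sets P" using B subalgebra_pre_sigma[OF R] by (auto simp: subalgebra_def)
    have l: "AE \<omega> in P. (\<lambda>n. indicator B \<omega> * D (\<rho> n \<omega>) \<omega>) \<longlonglongrightarrow> indicator B \<omega> * D (R \<omega>) \<omega>"
      using lim by eventually_elim (intro tendsto_intros)
    have dom: "\<bar>indicator B \<omega> * D (\<rho> n \<omega>) \<omega>\<bar> \<le> \<bar>D (\<rho> n \<omega>) \<omega>\<bar>" for n \<omega> by (simp add: indicator_def)
    have ui: "\<exists>K. \<forall>n. (\<integral>\<^sup>+ \<omega>. ennreal \<bar>D (\<rho> n \<omega>) \<omega>\<bar> * indicator {\<omega>. K < \<bar>D (\<rho> n \<omega>) \<omega>\<bar>} \<omega> \<partial>P) \<le> ennreal e"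
      if e: "0 < e" for e
      by (rule averaging_uniformly_integrable[where f="\<lambda>n \<omega>. D (\<rho> n \<omega>) \<omega>" and G="\<lambda>n. pre_sigma (\<rho> n)",
          OF prob_space_axioms subalgebra_pre_sigma[OF st] D_inf_integrable
          value_at_stopping_time_measurable[OF adapted_D right_continuous_D st] iD _ e]) (rule avg)
    note * = vitali_convergence_dominated[OF finite_measure_axioms _ _ l dom ui]
    have "(\<lambda>n. \<integral>\<omega>. indicator B \<omega> * D (\<rho> n \<omega>) \<omega> \<partial>P) \<longlonglongrightarrow> (\<integral>\<omega>. indicator B \<omega> * D (R \<omega>) \<omega> \<partial>P)"
      by (rule *(2)) auto
    moreover have "(\<integral>\<omega>. indicator B \<omega> * D (\<rho> n \<omega>) \<omega> \<partial>P) = (LINT \<omega>:B|P. D_inf \<omega>)" for n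
      using avg[of B n] sub[of n] B by (auto simp: set_lebesgue_integral_def)
    ultimately have "(LINT \<omega>:B|P. D_inf \<omega>) = (\<integral>\<omega>. indicator B \<omega> * D (R \<omega>) \<omega> \<partial>P)"
      by (simp add: LIMSEQ_const_iff)
    moreover have "integrable P (\<lambda>\<omega>. indicator B \<omega> * D (R \<omega>) \<omega>)" by (rule *(1)) auto
    ultimately show ?thesis by simp
  qed
  have "space P \<in> sets (pre_sigma R)" by (metis sets.top space_pre_sigma)
  from main[OF this] show "integrable P (\<lambda>\<omega>. D (R \<omega>) \<omega>)"
    by (auto cong: Bochner_Integration.integrable_cong)
  show "B \<in> sets (pre_sigma R) \<Longrightarrow> (LINT \<omega>:B|P. D_inf \<omega>) = (LINT \<omega>:B|P. D (R \<omega>) \<omega>)"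
    using main by (simp add: set_lebesgue_integral_def)
qed

section \<open>Convergence at infinity\<close>

lemma sigma_finite_subalgebra_F: "0 \<le> s \<Longrightarrow> sigma_finite_subalgebra P (F s)"
  by (intro finite_measure_subalgebra_is_sigma_finite) (unfold_locales, rule subalgebra_F)

lemma martingale_average:
  assumes X: "martingale P F X" and s: "0 \<le> s" "s \<le> t" and B: "B \<in> sets (F s)"
  shows "(LINT \<omega>:B|P. X t \<omega>) = (LINT \<omega>:B|P. X s \<omega>)"
proof -
  interpret S: sigma_finite_subalgebra P "F s" by (rule sigma_finite_subalgebra_F[OF s(1)])
  have BP: "B \<in> sets P" using B subalgebra_F[OF s(1)] by (auto simp: subalgebra_def)
  have Xi: "integrable P (X t)" "integrable P (X s)" using X s by (auto simp: martingale_def)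
  have ae: "AE \<omega> in P. real_cond_exp P (F s) (X t) \<omega> = X s \<omega>" using X s by (auto simp: martingale_def)
  have [measurable]: "X s \<in> borel_measurable P" using Xi by auto
  have "(LINT \<omega>:B|P. X t \<omega>) = (LINT \<omega>:B|P. real_cond_exp P (F s) (X t) \<omega>)"
    by (rule S.real_cond_exp_intA[OF Xi(1) B])
  also have "\<dots> = (LINT \<omega>:B|P. X s \<omega>)"
    unfolding set_lebesgue_integral_def
    by (rule integral_cong_AE) (use ae BP in auto)
  finally show ?thesis .
qed

text \<open>
  On the grid \<open>{0, 1/k, ..., k}\<close> and stopped at \<open>T k\<close>, the process makes \<open>K\<close> upcrossings of \<open>[a, b]\<close> with
  probability at most \<open>(C + \<bar>a\<bar>) / ((b - a) K)\<close>, whatever \<open>k\<close>. A path that oscillates across \<open>[a, b]\<close> for ever makes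
  \<open>K\<close> upcrossings for all large \<open>k\<close>, for every \<open>K\<close>; such paths form a null set. Infinite limits are excluded by
  Fatou's lemma along the times \<open>min k (T k)\<close>.
\<close>

lemma bounded_local_martingale_converges:
  fixes W :: "real \<Rightarrow> 'a \<Rightarrow> real" and T :: "nat \<Rightarrow> 'a \<Rightarrow> real"
  assumes rc: "right_continuous_paths W"
    and lim: "AE \<omega> in P. filterlim (\<lambda>n. T n \<omega>) at_top sequentially"
    and mart: "\<And>n. martingale P F (\<lambda>t \<omega>. W (min t (T n \<omega>)) \<omega>)"
    and bound: "\<And>n t. 0 \<le> t \<Longrightarrow> (\<integral>\<omega>. \<bar>W (min t (T n \<omega>)) \<omega>\<bar> \<partial>P) \<le> C"
  shows "AE \<omega> in P. \<exists>l. ((\<lambda>t. W t \<omega>) \<longlongrightarrow> l) at_top"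
proof -
  have int: "integrable P (\<lambda>\<omega>. W (min t (T n \<omega>)) \<omega>)" if "0 \<le> t" for t n
    using mart[of n] that by (simp add: martingale_def)
  have no_osc: "AE \<omega> in P. \<not> ((\<exists>\<^sub>F t in at_top. W t \<omega> < a) \<and> (\<exists>\<^sub>F t in at_top. b < W t \<omega>))"
    if ab: "a < b" for a b :: real
  proof -
    define E where "E K k = {\<omega>\<in>space P. K \<le> upcrossings a b (\<lambda>i. W (min (real i / real k) (T k \<omega>)) \<omega>) (k * k)}" for K k :: nat
    define c where "c = (C + \<bar>a\<bar>) / (b - a)"
    have E: "E K k \<in> sets P \<and> real K * prob (E K k) \<le> c" for K k
    proof -
      have sub: "subalgebra P (F (real i / real k))" for i by (rule subalgebra_F) simp
      have incr: "sets (F (real i / real k)) \<subseteq> sets (F (real (Suc i) / real k))" for i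
        by (intro sets_F_mono divide_right_mono) auto
      have meas: "(\<lambda>\<omega>. W (min (real i / real k) (T k \<omega>)) \<omega>) \<in> borel_measurable (F (real i / real k))" for i
        using mart[of k] by (simp add: martingale_def adapted_def)
      have int': "integrable P (\<lambda>\<omega>. W (min (real i / real k) (T k \<omega>)) \<omega>)" for i
        by (rule int) simp
      have avg: "(LINT \<omega>:B|P. W (min (real (Suc i) / real k) (T k \<omega>)) \<omega>) = (LINT \<omega>:B|P. W (min (real i / real k) (T k \<omega>)) \<omega>)"
        if "B \<in> sets (F (real i / real k))" for B i
        by (rule martingale_average[OF mart _ _ that]) (auto intro: divide_right_mono)
      note U = upcrossing_inequality[where G="\<lambda>i. F (real i / real k)" and Y="\<lambda>i \<omega>. W (min (real i / real k) (T k \<omega>)) \<omega>"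
          and n="k * k", OF prob_space_axioms ab sub incr meas int' avg]
      have "(b - a) * real K * prob (E K k) \<le> (\<integral>\<omega>. \<bar>W (min (real (k * k) / real k) (T k \<omega>)) \<omega>\<bar> \<partial>P) + \<bar>a\<bar>"
        unfolding E_def by (rule U(2)) assumption
      also have "(\<integral>\<omega>. \<bar>W (min (real (k * k) / real k) (T k \<omega>)) \<omega>\<bar> \<partial>P) \<le> C" by (rule bound) auto
      finally have "real K * prob (E K k) \<le> c" using ab by (simp add: c_def field_simps)
      moreover have [measurable]: "(\<lambda>\<omega>. upcrossings a b (\<lambda>i. W (min (real i / real k) (T k \<omega>)) \<omega>) (k * k)) \<in> measurable P (count_space UNIV)"
        by (rule U(1)) assumption
      have "E K k \<in> sets P" unfolding E_def by measurable
      ultimately show ?thesis by simp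
    qed
    \<comment> \<open>paths with at least \<open>K\<close> upcrossings on all sufficiently fine grids\<close>
    define L where "L K = (\<Union>m. \<Inter>k\<in>{m..}. E K k)" for K
    have L: "L K \<in> sets P" "real K * prob (L K) \<le> c" for K
    proof -
      have I: "(\<Inter>k\<in>{m..}. E K k) \<in> sets P" for m
        by (rule sets.countable_INT') (use E in auto)
      then show "L K \<in> sets P" unfolding L_def by auto
      have "(\<lambda>m. prob (\<Inter>k\<in>{m..}. E K k)) \<longlonglongrightarrow> prob (L K)"
        unfolding L_def by (rule finite_Lim_measure_incseq) (use I in \<open>auto simp: incseq_def intro: order_trans\<close>)
      then have "(\<lambda>m. real K * prob (\<Inter>k\<in>{m..}. E K k)) \<longlonglongrightarrow> real K * prob (L K)"
        by (intro tendsto_intros)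
      then show "real K * prob (L K) \<le> c"
      proof (rule LIMSEQ_le_const2, intro exI allI impI)
        fix m :: nat
        have "prob (\<Inter>k\<in>{m..}. E K k) \<le> prob (E K m)" by (intro finite_measure_mono) (use E in auto)
        then show "real K * prob (\<Inter>k\<in>{m..}. E K k) \<le> c"
          using E[of K m] by (meson mult_left_mono of_nat_0_le_iff order_trans)
      qed
    qed
    have "prob (\<Inter>K. L K) = 0"
    proof (rule ccontr)
      assume "\<not> ?thesis"
      then have p: "0 < prob (\<Inter>K. L K)" by (simp add: zero_less_measure_iff)
      obtain K :: nat where K: "c / prob (\<Inter>K. L K) < K" using reals_Archimedean2 by blast
      have "prob (\<Inter>K. L K) \<le> prob (L K)" by (intro finite_measure_mono) (use L in auto)
      then have "real K * prob (\<Inter>K. L K) \<le> c"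
        using L(2)[of K] by (meson mult_left_mono of_nat_0_le_iff order_trans)
      then show False using K p by (simp add: field_simps)
    qed
    then have "(\<Inter>K. L K) \<in> null_sets P" using L by (auto simp: null_sets_def emeasure_eq_measure)
    then have "AE \<omega> in P. \<omega> \<notin> (\<Inter>K. L K)" by (rule AE_not_in)
    then show ?thesis using rc lim AE_space
    proof eventually_elim
      case (elim \<omega>)
      show ?case
      proof
        assume osc: "(\<exists>\<^sub>F t in at_top. W t \<omega> < a) \<and> (\<exists>\<^sub>F t in at_top. b < W t \<omega>)"
        have "\<omega> \<in> L K" for K
        proof -
          obtain H where H: "\<forall>\<^sub>F k in sequentially. \<forall>T\<ge>H. K \<le> upcrossings a b (\<lambda>i. W (min T (real i / real k)) \<omega>) (k * k)"
            using oscillation_upcrossings[of "\<lambda>t. W t \<omega>" a b K] elim(2) ab osc by auto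
          have "\<forall>\<^sub>F k in sequentially. H \<le> T k \<omega>" using elim(3) by (simp add: filterlim_at_top)
          with H have "\<forall>\<^sub>F k in sequentially. \<omega> \<in> E K k"
            by eventually_elim (use elim(4) in \<open>simp add: E_def min.commute\<close>)
          then show ?thesis unfolding eventually_sequentially L_def by auto
        qed
        then show False using elim(1) by auto
      qed
    qed
  qed
  have osc: "AE \<omega> in P. \<forall>a\<in>\<rat>. \<forall>b\<in>\<rat>. a < b \<longrightarrow> \<not> ((\<exists>\<^sub>F t in at_top. W t \<omega> < a) \<and> (\<exists>\<^sub>F t in at_top. b < W t \<omega>))"
    using no_osc by (intro AE_ball_countable' countable_rat) (auto simp: AE_conj_iff)
  have fin: "AE \<omega> in P. liminf (\<lambda>k. ennreal \<bar>W (min (real k) (T k \<omega>)) \<omega>\<bar>) \<noteq> \<infinity>"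
  proof (rule nn_integral_noteq_infinite)
    have m [measurable]: "(\<lambda>\<omega>. W (min (real k) (T k \<omega>)) \<omega>) \<in> borel_measurable P" for k
      using int[of "real k" k] by auto
    show "(\<lambda>\<omega>. liminf (\<lambda>k. ennreal \<bar>W (min (real k) (T k \<omega>)) \<omega>\<bar>)) \<in> borel_measurable P" by measurable
    have "(\<integral>\<^sup>+ \<omega>. liminf (\<lambda>k. ennreal \<bar>W (min (real k) (T k \<omega>)) \<omega>\<bar>) \<partial>P)
      \<le> liminf (\<lambda>k. \<integral>\<^sup>+ \<omega>. ennreal \<bar>W (min (real k) (T k \<omega>)) \<omega>\<bar> \<partial>P)"
      by (intro nn_integral_liminf) auto
    also have "\<dots> \<le> liminf (\<lambda>k. ennreal C)"
    proof (intro Liminf_mono always_eventually allI)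
      fix k :: nat
      have "(\<integral>\<^sup>+ \<omega>. ennreal \<bar>W (min (real k) (T k \<omega>)) \<omega>\<bar> \<partial>P) = ennreal (\<integral>\<omega>. \<bar>W (min (real k) (T k \<omega>)) \<omega>\<bar> \<partial>P)"
        by (rule nn_integral_eq_integral) (use int[of "real k" k] in auto)
      then show "(\<integral>\<^sup>+ \<omega>. ennreal \<bar>W (min (real k) (T k \<omega>)) \<omega>\<bar> \<partial>P) \<le> ennreal C"
        using bound[of "real k" k] by (simp add: ennreal_leI)
    qed
    also have "\<dots> = ennreal C" by (simp add: Liminf_const)
    finally show "(\<integral>\<^sup>+ \<omega>. liminf (\<lambda>k. ennreal \<bar>W (min (real k) (T k \<omega>)) \<omega>\<bar>) \<partial>P) \<noteq> \<infinity>"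
      by (auto simp: top_unique)
  qed
  show ?thesis using osc fin lim
  proof eventually_elim
    case (elim \<omega>)
    show ?case
    proof (rule converges_or_oscillates[of "\<lambda>t. W t \<omega>"])
      fix l :: ereal assume l: "((\<lambda>t. ereal (W t \<omega>)) \<longlongrightarrow> l) at_top"
      show ?thesis
      proof (cases l)
        case (real r)
        then show ?thesis using l by (auto simp: tendsto_ereal)
      next
        have S: "filterlim (\<lambda>k. min (real k) (T k \<omega>)) at_top sequentially"
          using elim(3) filterlim_real_sequentially unfolding filterlim_at_top
          by (simp add: eventually_conj_iff)
        have inf: False if "filterlim (\<lambda>k. \<bar>W (min (real k) (T k \<omega>)) \<omega>\<bar>) at_top sequentially"
        proof -
          have "(\<lambda>k. ennreal \<bar>W (min (real k) (T k \<omega>)) \<omega>\<bar>) \<longlonglongrightarrow> \<infinity>"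
            using that by (simp add: ennreal_tendsto_top_eq_at_top)
          then have "liminf (\<lambda>k. ennreal \<bar>W (min (real k) (T k \<omega>)) \<omega>\<bar>) = \<infinity>"
            by (intro lim_imp_Liminf) auto
          then show False using elim(2) by simp
        qed
        {
          case PInf
          then have "filterlim (\<lambda>t. W t \<omega>) at_top at_top" using l by (simp add: tendsto_PInfty_eq_at_top)
          then have "filterlim (\<lambda>k. W (min (real k) (T k \<omega>)) \<omega>) at_top sequentially"
            using S by (rule filterlim_compose)
          then have "filterlim (\<lambda>k. \<bar>W (min (real k) (T k \<omega>)) \<omega>\<bar>) at_top sequentially"
            by (rule filterlim_at_top_mono[OF _ always_eventually]) auto
          then show ?thesis using inf by simp
        next
          case MInf
          then have "((\<lambda>t. ereal (- W t \<omega>)) \<longlongrightarrow> \<infinity>) at_top"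
            using tendsto_uminus_ereal[OF l] by simp
          then have "filterlim (\<lambda>t. - W t \<omega>) at_top at_top" by (simp add: tendsto_PInfty_eq_at_top)
          then have "filterlim (\<lambda>k. - W (min (real k) (T k \<omega>)) \<omega>) at_top sequentially"
            using S by (rule filterlim_compose)
          then have "filterlim (\<lambda>k. \<bar>W (min (real k) (T k \<omega>)) \<omega>\<bar>) at_top sequentially"
            by (rule filterlim_at_top_mono[OF _ always_eventually]) auto
          then show ?thesis using inf by simp
        }
      qed
    next
      fix a b assume "a \<in> \<rat>" "b \<in> \<rat>" "a < b" "\<exists>\<^sub>F t in at_top. W t \<omega> < a" "\<exists>\<^sub>F t in at_top. b < W t \<omega>"
      then show ?thesis using elim(1) by blast
    qed
  qed
qed

lemma measurable_F_mono:
  "f \<in> borel_measurable (F s) \<Longrightarrow> s \<le> t \<Longrightarrow> f \<in> borel_measurable (F t)"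
  by (rule measurable_from_subalg[of "F t" "F s"]) (auto simp: subalgebra_def space_F sets_F_mono)

text \<open>
  The sets on which the integrals agree form a Dynkin system, and the events of all \<open>F t\<close> together are an
  intersection-stable generator.
\<close>

lemma integrals_determined_by_filtration:
  fixes f g :: "'a \<Rightarrow> real"
  assumes f: "integrable P f" and g: "integrable P g"
    and eq: "\<And>t B. 0 \<le> t \<Longrightarrow> B \<in> sets (F t) \<Longrightarrow> (LINT \<omega>:B|P. f \<omega>) = (LINT \<omega>:B|P. g \<omega>)"
  shows "AE \<omega> in P. f \<omega> = g \<omega>"
proof (rule density_unique_real[OF f g])
  let ?G = "\<Union>t\<in>{0..}. sets (F t)"
  have si: "set_integrable P B h" if "B \<in> sets P" "integrable P h" for B and h :: "'a \<Rightarrow> real"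
    using integrable_mult_indicator[OF that] by (simp add: set_integrable_def)
  have sp: "(LINT \<omega>:space P|P. f \<omega>) = (LINT \<omega>:space P|P. g \<omega>)"
    using eq[of 0 "space P"] sets.top[of "F 0"] by (simp add: space_F)
  have "Int_stable ?G"
  proof (rule Int_stableI)
    fix a b assume "a \<in> ?G" "b \<in> ?G"
    then obtain s t where "0 \<le> s" "0 \<le> t" "a \<in> sets (F s)" "b \<in> sets (F t)" by auto
    then have "a \<in> sets (F (max s t))" "b \<in> sets (F (max s t))" "0 \<le> max s t"
      using sets_F_mono[of s "max s t"] sets_F_mono[of t "max s t"] by auto
    then show "a \<inter> b \<in> ?G" by blast
  qed
  moreover have "?G \<subseteq> Pow (space P)"
    using sets.sets_into_space by (fastforce simp: space_F)
  moreover fix A assume "A \<in> sets P"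
  then have "A \<in> sigma_sets (space P) ?G" using sets_F_inf by simp
  ultimately show "(LINT \<omega>:A|P. f \<omega>) = (LINT \<omega>:A|P. g \<omega>)"
  proof (induction rule: sigma_sets_induct_disjoint)
    case (basic A)
    then show ?case using eq by auto
  next
    case (compl A)
    have A: "A \<in> sets P" using compl.hyps sets_F_inf by simp
    have "(LINT \<omega>:space P|P. h \<omega>) = (LINT \<omega>:space P - A|P. h \<omega>) + (LINT \<omega>:A|P. h \<omega>)" if "integrable P h" for h :: "'a \<Rightarrow> real"
    proof -
      have "space P = (space P - A) \<union> A" using sets.sets_into_space[OF A] by blast
      then show ?thesis using set_integral_Un[of "space P - A" A P h] si[OF _ that] A by auto
    qed
    then show ?case using f g sp compl.IH by fastforce
  next
    case (union A)
    have A: "A i \<in> sets P" for i using union.hyps sets_F_inf by auto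
    have "(LINT \<omega>:(\<Union>i. A i)|P. h \<omega>) = (\<Sum>i. LINT \<omega>:A i|P. h \<omega>)" if "integrable P h" for h :: "'a \<Rightarrow> real"
      using union.hyps(1) by (intro lebesgue_integral_countable_add A si that) (auto simp: disjoint_family_on_def A)
    then show ?case using f g union.IH by simp
  qed (simp add: set_lebesgue_integral_def)
qed

lemma D_abs_le: "0 \<le> t \<Longrightarrow> (\<integral>\<omega>. \<bar>D t \<omega>\<bar> \<partial>P) \<le> (\<integral>\<omega>. \<bar>D_inf \<omega>\<bar> \<partial>P)"
proof -
  assume t: "0 \<le> t"
  have "(\<integral>\<^sup>+ \<omega>. 1 * ennreal \<bar>D t \<omega>\<bar> \<partial>P) \<le> (\<integral>\<^sup>+ \<omega>. 1 * ennreal \<bar>D_inf \<omega>\<bar> \<partial>P)"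
    by (rule averaging_abs_le[OF prob_space_axioms subalgebra_F[OF t] D_inf_integrable _ D_integrable[OF t]])
      (use adapted_D t D_average in \<open>auto simp: adapted_def\<close>)
  then show ?thesis using D_integrable[OF t] D_inf_integrable
    by (simp add: nn_integral_eq_integral integrable_abs)
qed

text \<open>
  \<open>D\<close> has an almost sure limit \<open>d\<close>. By uniform integrability, averages of \<open>D n\<close> over an event of \<open>F t\<close> tend
  to those of \<open>d\<close>; but for \<open>n \<ge> t\<close> they are equal to those of \<open>D_inf\<close>.
\<close>

lemma D_tendsto_D_inf: "AE \<omega> in P. ((\<lambda>t. D t \<omega>) \<longlongrightarrow> D_inf \<omega>) at_top"
proof -
  have conv: "AE \<omega> in P. \<exists>l. ((\<lambda>t. D t \<omega> - D 0 \<omega>) \<longlongrightarrow> l) at_top"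
  proof (rule bounded_local_martingale_converges[where T="\<lambda>n \<omega>. real n" and C="2 * (\<integral>\<omega>. \<bar>D_inf \<omega>\<bar> \<partial>P)"])
    show "right_continuous_paths (\<lambda>t \<omega>. D t \<omega> - D 0 \<omega>)"
      using right_continuous_D by eventually_elim (auto intro!: continuous_intros)
    show "AE \<omega> in P. filterlim (\<lambda>n. real n) at_top sequentially" using filterlim_real_sequentially by simp
    have i: "integrable P (\<lambda>\<omega>. D (min t (real n)) \<omega> - D 0 \<omega>)" if "0 \<le> t" for t n
      using that by (intro Bochner_Integration.integrable_diff D_integrable) auto
    show "martingale P F (\<lambda>t \<omega>. D (min t (real n)) \<omega> - D 0 \<omega>)" for n
      unfolding martingale_def
    proof (intro conjI allI impI i)
      show ad: "adapted F (\<lambda>t \<omega>. D (min t (real n)) \<omega> - D 0 \<omega>)"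
        unfolding adapted_def
      proof (intro allI impI)
        fix t :: real assume t: "0 \<le> t"
        have "D (min t (real n)) \<in> borel_measurable (F t)" "D 0 \<in> borel_measurable (F t)"
          using t adapted_D by (auto simp: adapted_def intro: measurable_F_mono[of _ "min t (real n)"] measurable_F_mono[of _ 0])
        then show "(\<lambda>\<omega>. D (min t (real n)) \<omega> - D 0 \<omega>) \<in> borel_measurable (F t)" by simp
      qed
      fix s t :: real assume s: "0 \<le> s" "s \<le> t"
      interpret S: sigma_finite_subalgebra P "F s" by (rule sigma_finite_subalgebra_F[OF s(1)])
      show "AE \<omega> in P. real_cond_exp P (F s) (\<lambda>\<omega>. D (min t (real n)) \<omega> - D 0 \<omega>) \<omega> = D (min s (real n)) \<omega> - D 0 \<omega>"
      proof (rule S.real_cond_exp_charact)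
        fix B assume B: "B \<in> sets (F s)"
        show "(LINT \<omega>:B|P. D (min t (real n)) \<omega> - D 0 \<omega>) = (LINT \<omega>:B|P. D (min s (real n)) \<omega> - D 0 \<omega>)"
        proof (cases "s \<le> n")
          case True
          have BP: "B \<in> sets P" using B subalgebra_F[OF s(1)] by (auto simp: subalgebra_def)
          have si: "set_integrable P B (D r)" if "0 \<le> r" for r
            using integrable_mult_indicator[OF BP D_integrable[OF that]] by (simp add: set_integrable_def)
          have "B \<in> sets (F (min t (real n)))" using B sets_F_mono[of s "min t (real n)"] s True by auto
          then have "(LINT \<omega>:B|P. D (min t (real n)) \<omega>) = (LINT \<omega>:B|P. D s \<omega>)"
            using D_average[OF s(1) B] D_average[of "min t (real n)" B] s by simp
          moreover have "min s (real n) = s" using True by simp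
          ultimately show ?thesis using si[of "min t (real n)"] si[of s] si[of 0] s by simp
        next
          case False
          then show ?thesis using s by (simp add: min_def)
        qed
      qed (use i s ad in \<open>auto simp: adapted_def\<close>)
    qed
    show "(\<integral>\<omega>. \<bar>D (min t (real n)) \<omega> - D 0 \<omega>\<bar> \<partial>P) \<le> 2 * (\<integral>\<omega>. \<bar>D_inf \<omega>\<bar> \<partial>P)" if t: "0 \<le> t" for t n
    proof -
      have "(\<integral>\<omega>. \<bar>D (min t (real n)) \<omega> - D 0 \<omega>\<bar> \<partial>P) \<le> (\<integral>\<omega>. \<bar>D (min t (real n)) \<omega>\<bar> + \<bar>D 0 \<omega>\<bar> \<partial>P)"
        using t by (intro integral_mono integrable_abs i Bochner_Integration.integrable_add D_integrable) auto
      also have "\<dots> = (\<integral>\<omega>. \<bar>D (min t (real n)) \<omega>\<bar> \<partial>P) + (\<integral>\<omega>. \<bar>D 0 \<omega>\<bar> \<partial>P)"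
        using t by (intro Bochner_Integration.integral_add integrable_abs D_integrable) auto
      finally show ?thesis using D_abs_le[of "min t (real n)"] D_abs_le[of 0] t by simp
    qed
  qed
  define d where "d \<omega> = lim (\<lambda>n. D (real n) \<omega>)" for \<omega>
  have Dm [measurable]: "D (real n) \<in> borel_measurable P" for n using D_integrable[of "real n"] by auto
  have dm [measurable]: "d \<in> borel_measurable P" unfolding d_def[abs_def] by (rule borel_measurable_lim_metric) simp
  have lim: "AE \<omega> in P. ((\<lambda>t. D t \<omega>) \<longlongrightarrow> d \<omega>) at_top \<and> (\<lambda>n. D (real n) \<omega>) \<longlonglongrightarrow> d \<omega>"
    using conv
  proof eventually_elim
    case (elim \<omega>)
    then obtain l where "((\<lambda>t. D t \<omega> - D 0 \<omega>) \<longlongrightarrow> l) at_top" by auto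
    from tendsto_add[OF this tendsto_const, of "D 0 \<omega>"] have c: "((\<lambda>t. D t \<omega>) \<longlongrightarrow> l + D 0 \<omega>) at_top" by simp
    have n: "(\<lambda>n. D (real n) \<omega>) \<longlonglongrightarrow> l + D 0 \<omega>" using filterlim_compose[OF c filterlim_real_sequentially] .
    then show ?case using c by (simp add: d_def limI)
  qed
  have ui: "\<exists>K. \<forall>n. (\<integral>\<^sup>+ \<omega>. ennreal \<bar>D (real n) \<omega>\<bar> * indicator {\<omega>. K < \<bar>D (real n) \<omega>\<bar>} \<omega> \<partial>P) \<le> ennreal e" if "0 < e" for e
    by (rule averaging_uniformly_integrable[where G="\<lambda>n. F (real n)", OF prob_space_axioms subalgebra_F D_inf_integrable _ D_integrable _ that])
      (use adapted_D D_average in \<open>auto simp: adapted_def\<close>)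
  have di: "integrable P d"
    by (rule vitali_convergence(2)[OF finite_measure_axioms Dm dm _ ui]) (use lim in \<open>auto elim: eventually_mono\<close>)
  have "AE \<omega> in P. d \<omega> = D_inf \<omega>"
  proof (rule integrals_determined_by_filtration[OF di D_inf_integrable])
    fix t B assume t: "0 \<le> t" and B: "B \<in> sets (F t)"
    have BP [measurable]: "B \<in> sets P" using B subalgebra_F[OF t] by (auto simp: subalgebra_def)
    have "(\<lambda>n. \<integral>\<omega>. indicator B \<omega> * D (real n) \<omega> \<partial>P) \<longlonglongrightarrow> (\<integral>\<omega>. indicator B \<omega> * d \<omega> \<partial>P)"
    proof (rule vitali_convergence_dominated(2)[OF finite_measure_axioms _ _ _ _ ui])
      show "AE \<omega> in P. (\<lambda>n. indicator B \<omega> * D (real n) \<omega>) \<longlonglongrightarrow> indicator B \<omega> * d \<omega>"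
        using lim by eventually_elim (intro tendsto_mult tendsto_const, blast)
    qed (simp_all add: indicator_def)
    moreover have "\<forall>\<^sub>F n in sequentially. (\<integral>\<omega>. indicator B \<omega> * D (real n) \<omega> \<partial>P) = (LINT \<omega>:B|P. D_inf \<omega>)"
    proof -
      obtain m :: nat where m: "t \<le> real m" using real_arch_simple by blast
      have "(\<integral>\<omega>. indicator B \<omega> * D (real n) \<omega> \<partial>P) = (LINT \<omega>:B|P. D_inf \<omega>)" if "m \<le> n" for n
      proof -
        have "B \<in> sets (F (real n))" using B sets_F_mono[of t "real n"] m that by (meson of_nat_mono order_trans subsetD)
        from D_average[OF _ this] show ?thesis by (simp add: set_lebesgue_integral_def)
      qed
      then show ?thesis unfolding eventually_sequentially by blast
    qed
    ultimately have "(\<lambda>n::nat. LINT \<omega>:B|P. D_inf \<omega>) \<longlonglongrightarrow> (\<integral>\<omega>. indicator B \<omega> * d \<omega> \<partial>P)"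
      by (rule Lim_transform_eventually)
    then show "(LINT \<omega>:B|P. d \<omega>) = (LINT \<omega>:B|P. D_inf \<omega>)" by (simp add: LIMSEQ_const_iff set_lebesgue_integral_def)
  qed
  then show ?thesis using lim by eventually_elim simp
qed

lemma value_measurable_P:
  assumes Y: "adapted F Y" "right_continuous_paths Y" and R: "finite_stopping_time P F R"
  shows "(\<lambda>\<omega>. Y (R \<omega>) \<omega>) \<in> borel_measurable P"
  by (rule measurable_from_subalg[OF subalgebra_pre_sigma[OF R] value_at_stopping_time_measurable[OF Y R]])

text \<open>
  Where a path has no limit, \<open>Lim\<close> has one fixed value, so only the set of convergence has to be measurable. For
  right-continuous paths the Cauchy criterion can be tested at rational times. Convergence almost surely under
  \<open>P'\<close> would not suffice, because \<open>P'\<close> need not be complete on \<open>{D_inf = 0}\<close>.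
\<close>

lemma terminal_measurable:
  assumes Y: "adapted F Y" "right_continuous_paths Y"
  shows "terminal Y \<in> borel_measurable P"
proof -
  define y where "y q \<omega> = Y (max 0 (real_of_rat q)) \<omega>" for q \<omega>
  have ym: "y q \<in> borel_measurable P" for q
  proof -
    have "Y (max 0 (real_of_rat q)) \<in> borel_measurable (F (max 0 (real_of_rat q)))" using Y(1) by (simp add: adapted_def)
    then show ?thesis unfolding y_def[abs_def] by (rule measurable_from_subalg[OF subalgebra_F, rotated]) simp
  qed
  have Yn: "Y (real n) \<in> borel_measurable P" for n :: nat
    by (rule measurable_from_subalg[OF subalgebra_F[of "real n"]]) (use Y(1) in \<open>auto simp: adapted_def\<close>)
  define conv where "conv \<omega> \<longleftrightarrow> (\<forall>m::nat. \<exists>n::nat. \<forall>q::rat. \<forall>r::rat.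
      real n \<le> real_of_rat q \<and> real n \<le> real_of_rat r \<longrightarrow> \<bar>y q \<omega> - y r \<omega>\<bar> \<le> 1 / real (Suc m))" for \<omega>
  have cm: "Measurable.pred P conv"
  proof -
    have "Measurable.pred P (\<lambda>\<omega>. \<bar>y q \<omega> - y r \<omega>\<bar> \<le> 1 / real (Suc m))" for q r m
      using ym[of q] ym[of r] by measurable
    then show ?thesis unfolding conv_def[abs_def]
      by (intro pred_intros_countable pred_intros_logic measurable_const) auto
  qed
  \<comment> \<open>the value of \<open>Lim\<close> along a path without limit\<close>
  define c0 :: real where "c0 = (THE l. False)"
  define U where "U \<omega> = (if conv \<omega> then lim (\<lambda>n. Y (real n) \<omega>) else c0)" for \<omega>
  have Um: "U \<in> borel_measurable P"
    unfolding U_def[abs_def] using cm borel_measurable_lim_metric[OF Yn] by measurable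
  have "AE \<omega> in P. U \<omega> = terminal Y \<omega>"
    using Y(2)
  proof eventually_elim
    case (elim \<omega>)
    have iff: "conv \<omega> \<longleftrightarrow> (\<exists>l. ((\<lambda>t. Y t \<omega>) \<longlongrightarrow> l) at_top)"
    proof
      assume cv: "conv \<omega>"
      have close: "\<exists>n::nat. \<forall>s\<ge>real n. \<forall>t\<ge>real n. \<bar>Y s \<omega> - Y t \<omega>\<bar> \<le> e" if e: "0 < e" for e :: real
      proof -
        obtain m :: nat where m: "1 / real (Suc m) < e" using e nat_approx_posE by (metis of_nat_Suc)
        obtain n :: nat where n: "\<And>q r. real n \<le> real_of_rat q \<Longrightarrow> real n \<le> real_of_rat r \<Longrightarrow> \<bar>y q \<omega> - y r \<omega>\<bar> \<le> 1 / real (Suc m)"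
          using cv unfolding conv_def by blast
        have approx: "\<exists>q. (\<forall>k. t \<le> real_of_rat (q k)) \<and> (\<lambda>k. y (q k) \<omega>) \<longlonglongrightarrow> Y t \<omega>" if t: "real n \<le> t" for t
        proof -
          have "\<exists>q. t < real_of_rat q \<and> real_of_rat q < t + 1 / real (Suc k)" for k
            by (rule of_rat_dense) simp
          then obtain q where q: "\<And>k. t < real_of_rat (q k)" "\<And>k. real_of_rat (q k) < t + 1 / real (Suc k)" by metis
          have t0: "0 \<le> t" using t by (rule order_trans[rotated]) simp
          have "(\<lambda>k. real_of_rat (q k)) \<longlonglongrightarrow> t"
          proof (rule tendsto_sandwich[OF _ _ tendsto_const])
            show "(\<lambda>n. t + 1 / real (Suc n)) \<longlonglongrightarrow> t" by (rule tendsto_add_inverse_Suc)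
            show "\<forall>\<^sub>F k in sequentially. t \<le> real_of_rat (q k)" using q(1) by (intro always_eventually allI less_imp_le)
            show "\<forall>\<^sub>F k in sequentially. real_of_rat (q k) \<le> t + 1 / real (Suc k)" using q(2) by (intro always_eventually allI less_imp_le)
          qed
          then have "(\<lambda>k. Y (real_of_rat (q k)) \<omega>) \<longlonglongrightarrow> Y t \<omega>"
            using elim t0 by (intro right_continuous_sequence[where f="\<lambda>t. Y t \<omega>"] less_imp_le[OF q(1)]) auto
          moreover have "Y (real_of_rat (q k)) \<omega> = y (q k) \<omega>" for k
            unfolding y_def using max_absorb2[OF order_trans[OF t0 less_imp_le[OF q(1)]], of k] by metis
          ultimately show ?thesis using less_imp_le[OF q(1)] by auto
        qed
        have "\<bar>Y s \<omega> - Y t \<omega>\<bar> \<le> e" if st: "real n \<le> s" "real n \<le> t" for s t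
        proof -
          obtain q where q: "\<And>k. s \<le> real_of_rat (q k)" "(\<lambda>k. y (q k) \<omega>) \<longlonglongrightarrow> Y s \<omega>" using approx[OF st(1)] by blast
          obtain r where r: "\<And>k. t \<le> real_of_rat (r k)" "(\<lambda>k. y (r k) \<omega>) \<longlonglongrightarrow> Y t \<omega>" using approx[OF st(2)] by blast
          have "(\<lambda>k. \<bar>y (q k) \<omega> - y (r k) \<omega>\<bar>) \<longlonglongrightarrow> \<bar>Y s \<omega> - Y t \<omega>\<bar>" using q r by (intro tendsto_intros)
          then have "\<bar>Y s \<omega> - Y t \<omega>\<bar> \<le> 1 / real (Suc m)"
          proof (rule tendsto_upperbound)
            show "\<forall>\<^sub>F k in sequentially. \<bar>y (q k) \<omega> - y (r k) \<omega>\<bar> \<le> 1 / real (Suc m)"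
              by (intro always_eventually allI n order_trans[OF st(1) q(1)] order_trans[OF st(2) r(1)])
          qed simp
          then show ?thesis using m by simp
        qed
        then show ?thesis by blast
      qed
      have "Cauchy (\<lambda>n::nat. Y (real n) \<omega>)"
      proof (rule metric_CauchyI)
        fix e :: real assume "0 < e"
        then have "0 < e / 2" by simp
        from close[OF this] obtain n :: nat where n: "\<And>s t. real n \<le> s \<Longrightarrow> real n \<le> t \<Longrightarrow> \<bar>Y s \<omega> - Y t \<omega>\<bar> \<le> e / 2" by blast
        show "\<exists>M. \<forall>m\<ge>M. \<forall>n\<ge>M. dist (Y (real m) \<omega>) (Y (real n) \<omega>) < e"
        proof (intro exI[of _ n] allI impI)
          fix i j assume "n \<le> i" "n \<le> j"
          then show "dist (Y (real i) \<omega>) (Y (real j) \<omega>) < e" using n[of "real i" "real j"] \<open>0 < e\<close> by (simp add: dist_real_def)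
        qed
      qed
      then obtain l where l: "(\<lambda>n::nat. Y (real n) \<omega>) \<longlonglongrightarrow> l" using Cauchy_convergent_iff convergent_def by blast
      have "((\<lambda>t. Y t \<omega>) \<longlongrightarrow> l) at_top"
      proof (rule tendstoI)
        fix e :: real assume "0 < e"
        then have "0 < e / 2" by simp
        from close[OF this] obtain n :: nat where n: "\<And>s t. real n \<le> s \<Longrightarrow> real n \<le> t \<Longrightarrow> \<bar>Y s \<omega> - Y t \<omega>\<bar> \<le> e / 2" by blast
        have "dist (Y t \<omega>) l < e" if t: "real n \<le> t" for t
        proof -
          have "(\<lambda>k::nat. \<bar>Y t \<omega> - Y (real k) \<omega>\<bar>) \<longlonglongrightarrow> \<bar>Y t \<omega> - l\<bar>" using l by (intro tendsto_intros)
          then have "\<bar>Y t \<omega> - l\<bar> \<le> e / 2"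
          proof (rule tendsto_upperbound)
            show "\<forall>\<^sub>F k in sequentially. \<bar>Y t \<omega> - Y (real k) \<omega>\<bar> \<le> e / 2"
              using eventually_ge_at_top[of n] by eventually_elim (use n t in simp)
          qed simp
          then show ?thesis using \<open>0 < e\<close> by (simp add: dist_real_def)
        qed
        then show "\<forall>\<^sub>F t in at_top. dist (Y t \<omega>) l < e" unfolding eventually_at_top_linorder by blast
      qed
      then show "\<exists>l. ((\<lambda>t. Y t \<omega>) \<longlongrightarrow> l) at_top" by blast
    next
      assume "\<exists>l. ((\<lambda>t. Y t \<omega>) \<longlongrightarrow> l) at_top"
      then obtain l where l: "((\<lambda>t. Y t \<omega>) \<longlongrightarrow> l) at_top" by blast
      show "conv \<omega>" unfolding conv_def
      proof
        fix m :: nat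
        have "0 < 1 / real (Suc m) / 2" by simp
        from tendstoD[OF l this] obtain t0 where t0: "\<And>t. t0 \<le> t \<Longrightarrow> dist (Y t \<omega>) l < 1 / real (Suc m) / 2"
          unfolding eventually_at_top_linorder by blast
        obtain n :: nat where n: "t0 \<le> real n" using real_arch_simple by blast
        show "\<exists>n::nat. \<forall>q r. real n \<le> real_of_rat q \<and> real n \<le> real_of_rat r \<longrightarrow> \<bar>y q \<omega> - y r \<omega>\<bar> \<le> 1 / real (Suc m)"
        proof (intro exI[of _ n] allI impI)
          fix q r assume qr: "real n \<le> real_of_rat q \<and> real n \<le> real_of_rat r"
          have "dist (y q \<omega>) l < 1 / real (Suc m) / 2" "dist (y r \<omega>) l < 1 / real (Suc m) / 2"
            using t0[of "max 0 (real_of_rat q)"] t0[of "max 0 (real_of_rat r)"] qr n by (auto simp: y_def)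
          then have "dist (y q \<omega>) (y r \<omega>) < 1 / real (Suc m)" by (rule dist_triangle_half_l)
          then show "\<bar>y q \<omega> - y r \<omega>\<bar> \<le> 1 / real (Suc m)" unfolding dist_real_def by (rule less_imp_le)
        qed
      qed
    qed
    show ?case
    proof (cases "conv \<omega>")
      case True
      then obtain l where l: "((\<lambda>t. Y t \<omega>) \<longlongrightarrow> l) at_top" using iff by blast
      have "(\<lambda>n::nat. Y (real n) \<omega>) \<longlonglongrightarrow> l" using filterlim_compose[OF l filterlim_real_sequentially] .
      then have "U \<omega> = l" using True by (simp add: U_def limI)
      moreover have "terminal Y \<omega> = l" unfolding terminal_def by (rule tendsto_Lim[OF _ l]) simp
      ultimately show ?thesis by simp
    next
      case False
      then have "\<And>l. \<not> ((\<lambda>t. Y t \<omega>) \<longlongrightarrow> l) at_top" using iff by blast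
      then show ?thesis using False by (simp add: U_def terminal_def t2_space_class.Lim_def c0_def)
    qed
  qed
  then show ?thesis by (rule measurable_cong_AE_complete[OF refl _ Um, rotated]) auto
qed

section \<open>The normalised total variation\<close>

definition D_norm :: real where "D_norm = (\<integral>\<omega>. \<bar>D_inf \<omega>\<bar> \<partial>P)"

abbreviation P' :: "'a measure" where "P' \<equiv> P_prime P D_inf"

lemma D_inf_measurable [measurable]: "D_inf \<in> borel_measurable P"
  using D_inf_integrable by auto

lemma D_norm_pos: "0 < D_norm"
proof (rule ccontr)
  assume "\<not> ?thesis"
  then have "D_norm \<le> 0" by simp
  moreover have "0 \<le> D_norm" unfolding D_norm_def by simp
  ultimately have "D_norm = 0" by (rule order_antisym)
  then have "(\<integral>\<omega>. \<bar>D_inf \<omega>\<bar> \<partial>P) = 0" unfolding D_norm_def .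
  then have ae: "AE \<omega> in P. \<bar>D_inf \<omega>\<bar> = 0"
    using integral_nonneg_eq_0_iff_AE[of P "\<lambda>\<omega>. \<bar>D_inf \<omega>\<bar>"] D_inf_integrable by simp
  obtain B where B: "B \<in> sets P" "Q B \<noteq> 0" using Q_nonzero by blast
  have "Q B = (LINT \<omega>:B|P. D_inf \<omega>)" using density_D_inf B by (simp add: is_signed_density_def)
  also have "\<dots> = 0" unfolding set_lebesgue_integral_def
    by (rule integral_eq_zero_AE, use ae in eventually_elim) simp
  finally show False using B by simp
qed

lemma P'_eq: "P' = density P (\<lambda>\<omega>. ennreal (\<bar>D_inf \<omega>\<bar> / D_norm))"
  by (simp add: P_prime_def D_norm_def)

lemma space_P' [simp]: "space P' = space P" and sets_P' [simp, measurable_cong]: "sets P' = sets P"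
  by (simp_all add: P'_eq)

lemma measurable_P' [simp]: "borel_measurable P' = borel_measurable P"
  by (rule measurable_cong_sets) simp_all

lemma AE_P'_iff: "(AE \<omega> in P'. \<phi> \<omega>) \<longleftrightarrow> (AE \<omega> in P. D_inf \<omega> \<noteq> 0 \<longrightarrow> \<phi> \<omega>)"
  unfolding P'_eq using D_norm_pos by (subst AE_density) (auto simp: zero_less_divide_iff)

lemma AE_P'I: "AE \<omega> in P. \<phi> \<omega> \<Longrightarrow> AE \<omega> in P'. \<phi> \<omega>"
  unfolding AE_P'_iff by (auto elim: eventually_mono)

lemma integrable_P'_iff:
  fixes f :: "'a \<Rightarrow> real"
  assumes [measurable]: "f \<in> borel_measurable P"
  shows "integrable P' f \<longleftrightarrow> integrable P (\<lambda>\<omega>. f \<omega> * \<bar>D_inf \<omega>\<bar>)"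
proof -
  have "integrable P' f \<longleftrightarrow> integrable P (\<lambda>\<omega>. (\<bar>D_inf \<omega>\<bar> / D_norm) *\<^sub>R f \<omega>)"
    unfolding P'_eq using D_norm_pos by (intro integrable_density) auto
  also have "(\<lambda>\<omega>. (\<bar>D_inf \<omega>\<bar> / D_norm) *\<^sub>R f \<omega>) = (\<lambda>\<omega>. (1 / D_norm) * (f \<omega> * \<bar>D_inf \<omega>\<bar>))" by auto
  also have "integrable P \<dots> \<longleftrightarrow> integrable P (\<lambda>\<omega>. f \<omega> * \<bar>D_inf \<omega>\<bar>)"
    using D_norm_pos by (subst integrable_mult_left_iff) auto
  finally show ?thesis .
qed

lemma integral_P':
  fixes f :: "'a \<Rightarrow> real"
  assumes [measurable]: "f \<in> borel_measurable P"
  shows "(\<integral>\<omega>. f \<omega> \<partial>P') = (\<integral>\<omega>. f \<omega> * \<bar>D_inf \<omega>\<bar> \<partial>P) / D_norm"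
proof -
  have "(\<integral>\<omega>. f \<omega> \<partial>P') = (\<integral>\<omega>. (\<bar>D_inf \<omega>\<bar> / D_norm) *\<^sub>R f \<omega> \<partial>P)"
    unfolding P'_eq using D_norm_pos by (intro integral_density) auto
  also have "(\<lambda>\<omega>. (\<bar>D_inf \<omega>\<bar> / D_norm) *\<^sub>R f \<omega>) = (\<lambda>\<omega>. (f \<omega> * \<bar>D_inf \<omega>\<bar>) / D_norm)" by auto
  finally show ?thesis by simp
qed

lemma prob_space_P': "prob_space P'"
proof
  have "emeasure P' (space P') = (\<integral>\<^sup>+ \<omega>. ennreal (\<bar>D_inf \<omega>\<bar> / D_norm) \<partial>P)"
    unfolding P'_eq by (subst emeasure_density) (auto intro!: nn_integral_cong)
  also have "\<dots> = ennreal (\<integral>\<omega>. \<bar>D_inf \<omega>\<bar> / D_norm \<partial>P)"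
    using D_inf_integrable D_norm_pos by (intro nn_integral_eq_integral) auto
  also have "(\<integral>\<omega>. \<bar>D_inf \<omega>\<bar> / D_norm \<partial>P) = 1" using D_norm_pos by (simp flip: D_norm_def)
  finally show "emeasure P' (space P') = 1" by simp
qed

text \<open>
  The weight \<open>\<bar>D\<bar>\<close> at time \<open>R\<close> may be exchanged for the weight \<open>\<bar>D_inf\<bar>\<close> of \<open>P'\<close> where \<open>D_inf\<close> has the sign of \<open>D\<close> at
  \<open>R\<close>. Integrability with the new weight comes from the nonnegative version \<open>averaging_abs_eq\<close>.
\<close>

lemma sign_conversion:
  assumes R: "finite_stopping_time P F R" "\<And>\<omega>. \<omega> \<in> space P \<Longrightarrow> R \<omega> \<le> u"
    and f: "f \<in> borel_measurable (pre_sigma R)" "integrable P (\<lambda>\<omega>. f \<omega> * \<bar>D (R \<omega>) \<omega>\<bar>)"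
    and sgn: "AE \<omega> in P. f \<omega> \<noteq> 0 \<longrightarrow> sgn (D (R \<omega>) \<omega>) * D_inf \<omega> = \<bar>D_inf \<omega>\<bar>"
  shows "integrable P (\<lambda>\<omega>. f \<omega> * \<bar>D_inf \<omega>\<bar>)"
    and "(\<integral>\<omega>. f \<omega> * \<bar>D_inf \<omega>\<bar> \<partial>P) = (\<integral>\<omega>. f \<omega> * \<bar>D (R \<omega>) \<omega>\<bar> \<partial>P)"
proof -
  note sub = subalgebra_pre_sigma[OF R(1)]
  have fP [measurable]: "f \<in> borel_measurable P" by (rule measurable_from_subalg[OF sub f(1)])
  have DR: "(\<lambda>\<omega>. D (R \<omega>) \<omega>) \<in> borel_measurable (pre_sigma R)"
    by (rule value_at_stopping_time_measurable[OF adapted_D right_continuous_D R(1)])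
  have Di: "integrable P (\<lambda>\<omega>. D (R \<omega>) \<omega>)" by (rule optional_stopping_D(1)[OF R])
  have DP [measurable]: "(\<lambda>\<omega>. D (R \<omega>) \<omega>) \<in> borel_measurable P" using Di by auto
  have avg: "(LINT \<omega>:B|P. D_inf \<omega>) = (LINT \<omega>:B|P. D (R \<omega>) \<omega>)" if "B \<in> sets (pre_sigma R)" for B
    by (rule optional_stopping_D(2)[OF R that])
  have "(\<integral>\<^sup>+ \<omega>. ennreal \<bar>f \<omega>\<bar> * ennreal \<bar>D (R \<omega>) \<omega>\<bar> \<partial>P) = (\<integral>\<^sup>+ \<omega>. ennreal \<bar>f \<omega>\<bar> * ennreal \<bar>D_inf \<omega>\<bar> \<partial>P)"
  proof (rule averaging_abs_eq[OF prob_space_axioms sub D_inf_integrable DR Di])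
    show "(\<lambda>\<omega>. ennreal \<bar>f \<omega>\<bar>) \<in> borel_measurable (pre_sigma R)" using f(1) by measurable
    show "AE \<omega> in P. ennreal \<bar>f \<omega>\<bar> \<noteq> 0 \<longrightarrow> sgn (D (R \<omega>) \<omega>) * D_inf \<omega> = \<bar>D_inf \<omega>\<bar>"
      using sgn by eventually_elim auto
  qed (rule avg)
  then have nn: "(\<integral>\<^sup>+ \<omega>. ennreal (norm (f \<omega> * \<bar>D_inf \<omega>\<bar>)) \<partial>P) = (\<integral>\<^sup>+ \<omega>. ennreal (norm (f \<omega> * \<bar>D (R \<omega>) \<omega>\<bar>)) \<partial>P)"
    by (simp add: abs_mult ennreal_mult)
  show int: "integrable P (\<lambda>\<omega>. f \<omega> * \<bar>D_inf \<omega>\<bar>)"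
    by (rule integrableI_bounded) (use f(2) nn in \<open>auto simp: integrable_iff_bounded\<close>)
  define h where "h \<omega> = f \<omega> * sgn (D (R \<omega>) \<omega>)" for \<omega>
  have hG: "h \<in> borel_measurable (pre_sigma R)"
    unfolding h_def[abs_def] using f(1) measurable_compose[OF DR borel_measurable_sgn] by (rule borel_measurable_times)
  have hP [measurable]: "h \<in> borel_measurable P" by (rule measurable_from_subalg[OF sub hG])
  have eq: "AE \<omega> in P. h \<omega> * D_inf \<omega> = f \<omega> * \<bar>D_inf \<omega>\<bar>"
    using sgn by eventually_elim (auto simp: h_def)
  have hi: "integrable P (\<lambda>\<omega>. h \<omega> * D_inf \<omega>)"
    by (rule integrable_cong_AE_imp[OF int]) (use eq in \<open>auto elim: eventually_mono\<close>)
  have "(\<integral>\<omega>. f \<omega> * \<bar>D_inf \<omega>\<bar> \<partial>P) = (\<integral>\<omega>. h \<omega> * D_inf \<omega> \<partial>P)"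
    by (rule integral_cong_AE) (use eq in \<open>auto elim: eventually_mono\<close>)
  also have "\<dots> = (\<integral>\<omega>. h \<omega> * D (R \<omega>) \<omega> \<partial>P)"
    by (rule averaging_mult[OF prob_space_axioms sub D_inf_integrable DR Di avg hG hi])
  also have "\<dots> = (\<integral>\<omega>. f \<omega> * \<bar>D (R \<omega>) \<omega>\<bar> \<partial>P)"
    by (rule Bochner_Integration.integral_cong[OF refl]) (simp add: h_def sgn_real_def)
  finally show "(\<integral>\<omega>. f \<omega> * \<bar>D_inf \<omega>\<bar> \<partial>P) = (\<integral>\<omega>. f \<omega> * \<bar>D (R \<omega>) \<omega>\<bar> \<partial>P)" .
qed

end

section \<open>Processes of class \<open>\<Sigma>(H)\<close>\<close>

locale sigma_H_process = signed_measure_setting P F Q D D_inf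
  for P :: "'a measure" and F Q D D_inf +
  fixes X N A :: "real \<Rightarrow> 'a \<Rightarrow> real"
  assumes class_Sigma: "class_Sigma_H P F D X N A"
    and class_D_X: "class_D P' F X"
    and zeros_subset: "AE \<omega> in P. zero_times D \<omega> \<subseteq> {t. 0 \<le> t \<and> X t \<omega> = 0}"
    and A_at_last_zero: "AE \<omega> in P. has_value_at A \<omega> (last_zero_bar D \<omega>) 0"
begin

lemma adapted_X: "adapted F X" and adapted_A: "adapted F A" and adapted_N: "adapted F N"
  using class_Sigma by (auto simp: class_Sigma_H_def semimartingale_def QP_local_martingale_def)

lemma cadlag_X: "AE \<omega> in P. cadlag (\<lambda>t. X t \<omega>)"
  and X_nonneg: "AE \<omega> in P. \<forall>t\<ge>0. 0 \<le> X t \<omega>"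
  and X_decomp: "AE \<omega> in P. \<forall>t\<ge>0. X t \<omega> = N t \<omega> + A t \<omega>"
  and cadlag_N: "AE \<omega> in P. cadlag (\<lambda>t. N t \<omega>)"
  and N_start: "AE \<omega> in P. N 0 \<omega> = 0"
  and A_path: "AE \<omega> in P. continuous_on {0..} (\<lambda>t. A t \<omega>) \<and> mono_on {0..} (\<lambda>t. A t \<omega>) \<and> A 0 \<omega> = 0"
  using class_Sigma by (auto simp: class_Sigma_H_def semimartingale_def)

lemma A_carried: "AE \<omega> in P. AE t in interval_measure (\<lambda>t. A (max 0 t) \<omega>). 0 \<le> t \<longrightarrow> X t \<omega> = 0"
proof -
  have "AE \<omega> in P. AE t in interval_measure (\<lambda>t. A (max 0 t) \<omega>). t \<in> {t. 0 \<le> t \<and> X t \<omega> = 0} \<union> zero_times D \<omega>"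
    using class_Sigma by (simp add: class_Sigma_H_def)
  then show ?thesis using zeros_subset
  proof eventually_elim
    case (elim \<omega>)
    from elim(1) show ?case by eventually_elim (use elim(2) in auto)
  qed
qed

lemma X_zero_of_D_zero: "AE \<omega> in P. \<forall>t\<ge>0. D t \<omega> = 0 \<longrightarrow> X t \<omega> = 0"
  using zeros_subset by eventually_elim (auto simp: zero_times_def)

lemma A_mono: "AE \<omega> in P. \<forall>s t. 0 \<le> s \<longrightarrow> s \<le> t \<longrightarrow> A s \<omega> \<le> A t \<omega>"
  using A_path by eventually_elim (auto simp: mono_on_def)

lemma A_nonneg: "AE \<omega> in P. \<forall>t\<ge>0. 0 \<le> A t \<omega>"
  using A_mono A_path by eventually_elim (metis order_refl)

lemma right_continuous_X: "right_continuous_paths X"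
  using cadlag_X by eventually_elim (simp add: cadlag_def)

lemma right_continuous_N: "right_continuous_paths N"
  using cadlag_N by eventually_elim (simp add: cadlag_def)

lemma right_continuous_A: "right_continuous_paths A"
  using A_path by eventually_elim (simp add: continuous_on_imp_right_continuous)

text \<open>
  A zero of \<open>D\<close> at \<open>v \<ge> u\<close> would place the last zero at or after \<open>u\<close>. But \<open>A\<close> is \<open>0\<close> at the last zero, and
  if that is at infinity then \<open>A\<close> tends to \<open>0\<close>; in both cases monotonicity forces \<open>A u \<le> 0\<close>.
\<close>

lemma D_no_zero_after: "AE \<omega> in P. \<forall>u v. 0 \<le> u \<longrightarrow> u \<le> v \<longrightarrow> 0 < A u \<omega> \<longrightarrow> D v \<omega> \<noteq> 0"
  using A_at_last_zero A_mono
proof eventually_elim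
  case (elim \<omega>)
  show ?case
  proof (intro allI impI notI)
    fix u v :: real assume uv: "0 \<le> u" "u \<le> v" "0 < A u \<omega>" and z: "D v \<omega> = 0"
    have "ereal v \<le> last_zero D \<omega>"
      unfolding last_zero_def by (rule Sup_upper) (use uv z in \<open>auto simp: zero_times_def\<close>)
    then have lv: "ereal v \<le> last_zero_bar D \<omega>" unfolding last_zero_bar_def by (simp add: le_max_iff_disj)
    show False
    proof (cases "last_zero_bar D \<omega>")
      case (real g)
      then have "A g \<omega> = 0" using elim(1) by (simp add: has_value_at_def)
      moreover have "u \<le> g" using lv real uv by simp
      ultimately show False using elim(2) uv by (metis not_le)
    next
      case PInf
      then have lim: "((\<lambda>t. A t \<omega>) \<longlongrightarrow> 0) at_top" using elim(1) by (simp add: has_value_at_def)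
      have "A u \<omega> \<le> 0"
      proof (rule tendsto_lowerbound[OF lim])
        show "\<forall>\<^sub>F t in at_top. A u \<omega> \<le> A t \<omega>"
          using eventually_ge_at_top[of u] by eventually_elim (use elim(2) uv in simp)
      qed simp
      then show False using uv by simp
    next
      case MInf
      then show False using lv by simp
    qed
  qed
qed

lemma D_sign_after: "AE \<omega> in P. \<forall>u. 0 \<le> u \<longrightarrow> 0 < A u \<omega> \<longrightarrow>
    sgn (D u \<omega>) * D_inf \<omega> = \<bar>D_inf \<omega>\<bar> \<and> (\<forall>v\<ge>u. sgn (D v \<omega>) = sgn (D u \<omega>))"
  using D_no_zero_after continuous_D D_tendsto_D_inf
proof eventually_elim
  case (elim \<omega>)
  show ?case
  proof (intro allI impI)
    fix u :: real assume u: "0 \<le> u" "0 < A u \<omega>"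
    have s: "sgn (D v \<omega>) = sgn (D u \<omega>)" if "u \<le> v" for v
      by (rule continuous_sign_constant[OF elim(2) u(1) that]) (use elim(1) u in blast)
    show "sgn (D u \<omega>) * D_inf \<omega> = \<bar>D_inf \<omega>\<bar> \<and> (\<forall>v\<ge>u. sgn (D v \<omega>) = sgn (D u \<omega>))"
      using sign_of_limit[OF elim(3) s] s by blast
  qed
qed

lemma stopping_P': "finite_stopping_time P' F R \<longleftrightarrow> finite_stopping_time P F R"
  by (simp add: finite_stopping_time_def)

lemma X_uniformly_integrable:
  assumes "0 < e"
  shows "\<exists>K. \<forall>R. finite_stopping_time P F R \<longrightarrow>
    (\<integral>\<^sup>+ \<omega>. ennreal \<bar>X (R \<omega>) \<omega>\<bar> * indicator {\<omega>. K < \<bar>X (R \<omega>) \<omega>\<bar>} \<omega> \<partial>P') \<le> ennreal e"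
proof -
  from class_D_X assms obtain K where K: "\<forall>f\<in>{(\<lambda>\<omega>. X (R \<omega>) \<omega>) | R. finite_stopping_time P' F R}.
      (\<integral>\<^sup>+ \<omega>. ennreal \<bar>f \<omega>\<bar> * indicator {\<omega>. K < \<bar>f \<omega>\<bar>} \<omega> \<partial>P') \<le> ennreal e"
    unfolding class_D_def uniformly_integrable_def by blast
  show ?thesis
  proof (intro exI[of _ K] allI impI)
    fix R assume "finite_stopping_time P F R"
    then have "(\<lambda>\<omega>. X (R \<omega>) \<omega>) \<in> {(\<lambda>\<omega>. X (R \<omega>) \<omega>) | R. finite_stopping_time P' F R}"
      unfolding stopping_P' by blast
    from K[rule_format, OF this]
    show "(\<integral>\<^sup>+ \<omega>. ennreal \<bar>X (R \<omega>) \<omega>\<bar> * indicator {\<omega>. K < \<bar>X (R \<omega>) \<omega>\<bar>} \<omega> \<partial>P') \<le> ennreal e" .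
  qed
qed

lemma X_measurable: "finite_stopping_time P F R \<Longrightarrow> (\<lambda>\<omega>. X (R \<omega>) \<omega>) \<in> borel_measurable P"
  by (rule value_measurable_P[OF adapted_X right_continuous_X])

lemma A_measurable: "finite_stopping_time P F R \<Longrightarrow> (\<lambda>\<omega>. A (R \<omega>) \<omega>) \<in> borel_measurable P"
  by (rule value_measurable_P[OF adapted_A right_continuous_A])

lemma X_L1_bounded:
  obtains K where "0 \<le> K" "\<And>R. finite_stopping_time P F R \<Longrightarrow> integrable P' (\<lambda>\<omega>. X (R \<omega>) \<omega>)"
    "\<And>R. finite_stopping_time P F R \<Longrightarrow> (\<integral>\<omega>. \<bar>X (R \<omega>) \<omega>\<bar> \<partial>P') \<le> K"
proof -
  interpret P': prob_space P' by (rule prob_space_P')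
  obtain K where K: "\<And>R. finite_stopping_time P F R \<Longrightarrow>
    (\<integral>\<^sup>+ \<omega>. ennreal \<bar>X (R \<omega>) \<omega>\<bar> * indicator {\<omega>. K < \<bar>X (R \<omega>) \<omega>\<bar>} \<omega> \<partial>P') \<le> ennreal 1"
    using X_uniformly_integrable[of 1] by auto
  define L where "L = max 0 K + 1"
  have nn: "(\<integral>\<^sup>+ \<omega>. ennreal \<bar>X (R \<omega>) \<omega>\<bar> \<partial>P') \<le> ennreal L" if R: "finite_stopping_time P F R" for R
  proof -
    have m: "(\<lambda>\<omega>. X (R \<omega>) \<omega>) \<in> borel_measurable P'" using X_measurable[OF R] by simp
    have ind: "(\<lambda>\<omega>. indicator {\<omega>. K < \<bar>X (R \<omega>) \<omega>\<bar>} \<omega> :: ennreal) \<in> borel_measurable P'"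
      unfolding indicator_def using m by measurable
    have "(\<integral>\<^sup>+ \<omega>. ennreal \<bar>X (R \<omega>) \<omega>\<bar> \<partial>P') \<le>
      (\<integral>\<^sup>+ \<omega>. ennreal (max 0 K) + ennreal \<bar>X (R \<omega>) \<omega>\<bar> * indicator {\<omega>. K < \<bar>X (R \<omega>) \<omega>\<bar>} \<omega> \<partial>P')"
      by (intro nn_integral_mono) (auto simp: indicator_def intro!: ennreal_leI)
    also have "\<dots> = ennreal (max 0 K) + (\<integral>\<^sup>+ \<omega>. ennreal \<bar>X (R \<omega>) \<omega>\<bar> * indicator {\<omega>. K < \<bar>X (R \<omega>) \<omega>\<bar>} \<omega> \<partial>P')"
      using m ind by (subst nn_integral_add) (use P'.emeasure_space_1 in auto)
    also have "\<dots> \<le> ennreal (max 0 K) + ennreal 1" by (intro add_left_mono K R)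
    also have "\<dots> = ennreal L" unfolding L_def by (rule ennreal_plus[symmetric]) auto
    finally show ?thesis .
  qed
  have L: "0 \<le> L" by (simp add: L_def)
  have int: "integrable P' (\<lambda>\<omega>. X (R \<omega>) \<omega>)" if R: "finite_stopping_time P F R" for R
    by (rule integrableI_bounded) (use X_measurable[OF R] le_less_trans[OF nn[OF R], of top] in auto)
  have "(\<integral>\<omega>. \<bar>X (R \<omega>) \<omega>\<bar> \<partial>P') \<le> L" if R: "finite_stopping_time P F R" for R
  proof -
    have "(\<integral>\<^sup>+ \<omega>. ennreal \<bar>X (R \<omega>) \<omega>\<bar> \<partial>P') = ennreal (\<integral>\<omega>. \<bar>X (R \<omega>) \<omega>\<bar> \<partial>P')"
      using int[OF R] by (intro nn_integral_eq_integral) auto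
    then show ?thesis using nn[OF R] L by simp
  qed
  then show thesis using that[OF L int] by blast
qed

section \<open>Identities at bounded stopping times\<close>

definition localises :: "('a \<Rightarrow> real) \<Rightarrow> bool" where
  "localises T \<longleftrightarrow> finite_stopping_time P F T \<and>
     martingale P F (\<lambda>t \<omega>. N (min t (T \<omega>)) \<omega> * D (min t (T \<omega>)) \<omega> - N 0 \<omega> * D 0 \<omega>)"

context
  fixes T :: "'a \<Rightarrow> real" and t :: real
  assumes localises: "localises T" and t: "0 \<le> t"
begin

lemma T_stopping: "finite_stopping_time P F T"
  and T_martingale: "martingale P F (\<lambda>t \<omega>. N (min t (T \<omega>)) \<omega> * D (min t (T \<omega>)) \<omega> - N 0 \<omega> * D 0 \<omega>)"
  using localises by (simp_all add: localises_def)

definition stop :: "real \<Rightarrow> 'a \<Rightarrow> real" where "stop r \<omega> = min (T \<omega>) r"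

lemma stop_stopping: "0 \<le> r \<Longrightarrow> finite_stopping_time P F (stop r)"
  unfolding stop_def[abs_def] by (rule min_const_stopping[OF T_stopping])

lemma stop_le: "stop r \<omega> \<le> r"
  by (simp add: stop_def)

lemma stop_nonneg: "\<omega> \<in> space P \<Longrightarrow> 0 \<le> r \<Longrightarrow> 0 \<le> stop r \<omega>"
  using stopping_nonneg[OF T_stopping] by (simp add: stop_def)

lemma stop_mono: "r \<le> s \<Longrightarrow> stop r \<omega> \<le> stop s \<omega>"
  by (auto simp: stop_def)

text \<open>
  Along a grid the discrete filtration consists of the \<open>\<sigma>\<close>-algebras of the stopped times instead of \<open>F r\<close>: over
  events of \<open>F r\<close> that happen after \<open>T\<close>, the averages of the stopped \<open>D\<close> and of \<open>D_inf\<close> may differ.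
\<close>

abbreviation G :: "real \<Rightarrow> 'a measure" where "G r \<equiv> pre_sigma (stop r)"

lemma G_mono: "0 \<le> r \<Longrightarrow> r \<le> s \<Longrightarrow> sets (G r) \<subseteq> sets (G s)"
  by (rule mono_pre_sigma[OF stopping stopping]) (auto intro: stop_stopping stop_mono)

lemma G_subset_F: "0 \<le> r \<Longrightarrow> sets (G r) \<subseteq> sets (F r)"
  by (rule pre_sigma_subset_F[OF stop_stopping]) (auto simp: stop_le)

lemma G_up: "f \<in> borel_measurable (G r) \<Longrightarrow> 0 \<le> r \<Longrightarrow> r \<le> s \<Longrightarrow> f \<in> borel_measurable (G s)" for f :: "'a \<Rightarrow> real"
  by (rule measurable_from_subalg[of "G s" "G r"]) (auto simp: subalgebra_def space_pre_sigma dest: G_mono)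

lemma G_to_P: "f \<in> borel_measurable (G r) \<Longrightarrow> 0 \<le> r \<Longrightarrow> f \<in> borel_measurable P" for f :: "'a \<Rightarrow> real"
  by (rule measurable_from_subalg[OF subalgebra_pre_sigma[OF stop_stopping]])

definition Ms :: "real \<Rightarrow> 'a \<Rightarrow> real" where "Ms r \<omega> = N (stop r \<omega>) \<omega> * D (stop r \<omega>) \<omega>"
definition Ds :: "real \<Rightarrow> 'a \<Rightarrow> real" where "Ds r \<omega> = D (stop r \<omega>) \<omega>"
definition Xs :: "real \<Rightarrow> 'a \<Rightarrow> real" where "Xs r \<omega> = X (stop r \<omega>) \<omega>"
definition As :: "real \<Rightarrow> 'a \<Rightarrow> real" where "As r \<omega> = A (stop r \<omega>) \<omega>"

lemma Ds_meas: "0 \<le> r \<Longrightarrow> Ds r \<in> borel_measurable (G r)"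
  unfolding Ds_def[abs_def] by (rule value_at_stopping_time_measurable[OF adapted_D right_continuous_D stop_stopping])

lemma Xs_meas: "0 \<le> r \<Longrightarrow> Xs r \<in> borel_measurable (G r)"
  unfolding Xs_def[abs_def] by (rule value_at_stopping_time_measurable[OF adapted_X right_continuous_X stop_stopping])

lemma As_meas: "0 \<le> r \<Longrightarrow> As r \<in> borel_measurable (G r)"
  unfolding As_def[abs_def] by (rule value_at_stopping_time_measurable[OF adapted_A right_continuous_A stop_stopping])

lemma Ms_meas: "0 \<le> r \<Longrightarrow> Ms r \<in> borel_measurable (G r)"
  unfolding Ms_def[abs_def]
  by (intro borel_measurable_times value_at_stopping_time_measurable[OF adapted_D right_continuous_D]
      value_at_stopping_time_measurable[OF adapted_N right_continuous_N] stop_stopping)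

lemma Ds_integrable: "0 \<le> r \<Longrightarrow> integrable P (Ds r)"
  unfolding Ds_def[abs_def] by (rule optional_stopping_D(1)[OF stop_stopping stop_le])

lemma Ds_average:
  assumes "0 \<le> r" "r \<le> s" "B \<in> sets (G r)"
  shows "(LINT \<omega>:B|P. Ds s \<omega>) = (LINT \<omega>:B|P. Ds r \<omega>)"
proof -
  have s: "0 \<le> s" using assms by simp
  have "B \<in> sets (G s)" using assms G_mono by blast
  then have "(LINT \<omega>:B|P. D_inf \<omega>) = (LINT \<omega>:B|P. Ds s \<omega>)"
    unfolding Ds_def by (intro optional_stopping_D(2)[OF stop_stopping[OF s] stop_le])
  moreover have "(LINT \<omega>:B|P. D_inf \<omega>) = (LINT \<omega>:B|P. Ds r \<omega>)"
    unfolding Ds_def by (rule optional_stopping_D(2)[OF stop_stopping[OF assms(1)] stop_le assms(3)])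
  ultimately show ?thesis by simp
qed

lemma Ms_eq: "AE \<omega> in P. N (min r (T \<omega>)) \<omega> * D (min r (T \<omega>)) \<omega> - N 0 \<omega> * D 0 \<omega> = Ms r \<omega>"
  using N_start by eventually_elim (simp add: Ms_def stop_def min.commute)

lemma Ms_integrable:
  assumes "0 \<le> r" shows "integrable P (Ms r)"
proof (rule integrable_cong_AE_imp[OF _ G_to_P[OF Ms_meas[OF assms] assms]])
  show "integrable P (\<lambda>\<omega>. N (min r (T \<omega>)) \<omega> * D (min r (T \<omega>)) \<omega> - N 0 \<omega> * D 0 \<omega>)"
    using T_martingale assms by (simp add: martingale_def)
  show "AE \<omega> in P. N (min r (T \<omega>)) \<omega> * D (min r (T \<omega>)) \<omega> - N 0 \<omega> * D 0 \<omega> = Ms r \<omega>"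
    by (rule Ms_eq)
qed

lemma Ms_average:
  assumes r: "0 \<le> r" "r \<le> s" and B: "B \<in> sets (G r)"
  shows "(LINT \<omega>:B|P. Ms s \<omega>) = (LINT \<omega>:B|P. Ms r \<omega>)"
proof -
  have BF: "B \<in> sets (F r)" using B G_subset_F[OF r(1)] by blast
  have BP: "B \<in> sets P" using BF subalgebra_F[OF r(1)] by (auto simp: subalgebra_def)
  have eq: "(LINT \<omega>:B|P. Ms q \<omega>) = (LINT \<omega>:B|P. N (min q (T \<omega>)) \<omega> * D (min q (T \<omega>)) \<omega> - N 0 \<omega> * D 0 \<omega>)" if q: "0 \<le> q" for q
  proof -
    have i: "integrable P (\<lambda>\<omega>. N (min q (T \<omega>)) \<omega> * D (min q (T \<omega>)) \<omega> - N 0 \<omega> * D 0 \<omega>)"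
      using T_martingale q by (simp add: martingale_def)
    have m: "(\<lambda>\<omega>. indicator B \<omega> *\<^sub>R Ms q \<omega>) \<in> borel_measurable P"
      "(\<lambda>\<omega>. indicator B \<omega> *\<^sub>R (N (min q (T \<omega>)) \<omega> * D (min q (T \<omega>)) \<omega> - N 0 \<omega> * D 0 \<omega>)) \<in> borel_measurable P"
      by (intro borel_measurable_scaleR borel_measurable_indicator BP G_to_P[OF Ms_meas] q borel_measurable_integrable[OF i])+
    show ?thesis unfolding set_lebesgue_integral_def
      by (rule integral_cong_AE[OF m]) (use Ms_eq[of q] in eventually_elim, simp)
  qed
  show ?thesis
    unfolding eq[OF r(1)] eq[OF order_trans[OF r]] by (rule martingale_average[OF T_martingale r BF])
qed

lemma Ms_decomp: "AE \<omega> in P. \<forall>r\<ge>0. Ms r \<omega> = (Xs r \<omega> - As r \<omega>) * Ds r \<omega> \<and> 0 \<le> As r \<omega> \<and> 0 \<le> Xs r \<omega>"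
  using X_decomp A_nonneg X_nonneg AE_space
proof eventually_elim
  case (elim \<omega>)
  show ?case
  proof (intro allI impI)
    fix r :: real assume "0 \<le> r"
    then have "0 \<le> stop r \<omega>" using stop_nonneg elim by simp
    then show "Ms r \<omega> = (Xs r \<omega> - As r \<omega>) * Ds r \<omega> \<and> 0 \<le> As r \<omega> \<and> 0 \<le> Xs r \<omega>"
      using elim by (simp add: Ms_def Xs_def As_def Ds_def)
  qed
qed

lemma As_mono: "AE \<omega> in P. \<forall>r s. 0 \<le> r \<longrightarrow> r \<le> s \<longrightarrow> As r \<omega> \<le> As s \<omega>"
  using A_mono AE_space
proof eventually_elim
  case (elim \<omega>)
  then show ?case using stop_nonneg[OF elim(2)] stop_mono unfolding As_def by blast
qed

lemma Ds_sign: "AE \<omega> in P. \<forall>r s. 0 \<le> r \<longrightarrow> r \<le> s \<longrightarrow> 0 < As r \<omega> \<longrightarrow>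
    sgn (Ds s \<omega>) = sgn (Ds r \<omega>) \<and> sgn (Ds r \<omega>) * D_inf \<omega> = \<bar>D_inf \<omega>\<bar>"
  using D_sign_after AE_space
proof eventually_elim
  case (elim \<omega>)
  then show ?case using stop_nonneg[OF elim(2)] stop_mono unfolding As_def Ds_def by blast
qed

text \<open>
  On an event \<open>c\<close> known at time \<open>r\<close> at which \<open>A\<close> is already positive, the expectation of \<open>X - A\<close> at time \<open>s\<close> under
  \<open>P'\<close> does not depend on \<open>s \<ge> r\<close>: with the weight \<open>\<bar>D\<bar>\<close> and the sign of \<open>D\<close> at \<open>r\<close> it is an expectation of the
  martingale \<open>N D\<close>.
\<close>

lemma entry_identity:
  fixes c :: "'a \<Rightarrow> real"
  assumes r: "0 \<le> r" "r \<le> s" and c: "c \<in> borel_measurable (G r)" "\<And>\<omega>. \<bar>c \<omega>\<bar> \<le> 1" "\<And>\<omega>. 0 \<le> c \<omega>"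
    and pos: "AE \<omega> in P. c \<omega> \<noteq> 0 \<longrightarrow> 0 < As r \<omega>"
  shows "integrable P (\<lambda>\<omega>. c \<omega> * (Xs s \<omega> - As s \<omega>) * \<bar>D_inf \<omega>\<bar>)"
    and "(\<integral>\<omega>. c \<omega> * (Xs s \<omega> - As s \<omega>) * \<bar>D_inf \<omega>\<bar> \<partial>P) = (\<integral>\<omega>. c \<omega> * sgn (Ds r \<omega>) * Ms r \<omega> \<partial>P)"
proof -
  have s: "0 \<le> s" using r by simp
  have cs: "c \<in> borel_measurable (G s)" by (rule G_up[OF c(1) r])
  have cP: "c \<in> borel_measurable P" by (rule G_to_P[OF cs s])
  have sg: "(\<lambda>\<omega>. sgn (Ds r \<omega>)) \<in> borel_measurable (G r)"
    by (rule measurable_compose[OF Ds_meas[OF r(1)] borel_measurable_sgn])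
  have hG: "(\<lambda>\<omega>. c \<omega> * sgn (Ds r \<omega>)) \<in> borel_measurable (G r)"
    by (rule borel_measurable_times[OF c(1) sg])
  have hP: "(\<lambda>\<omega>. c \<omega> * sgn (Ds r \<omega>)) \<in> borel_measurable P" by (rule G_to_P[OF hG r(1)])
  have h1: "\<bar>c \<omega> * sgn (Ds r \<omega>)\<bar> \<le> 1" for \<omega>
    using mult_mono[OF c(2)[of \<omega>] abs_sgn_le_1[of "Ds r \<omega>"]] by (simp add: abs_mult)
  have hM: "integrable P (\<lambda>\<omega>. c \<omega> * sgn (Ds r \<omega>) * Ms s \<omega>)"
    by (rule integrable_bounded_mult[OF Ms_integrable[OF s] hP h1])
  have fs: "(\<lambda>\<omega>. c \<omega> * (Xs s \<omega> - As s \<omega>)) \<in> borel_measurable (G s)"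
    by (intro borel_measurable_times borel_measurable_diff cs Xs_meas As_meas s)
  have DsP: "Ds s \<in> borel_measurable P" by (rule G_to_P[OF Ds_meas[OF s] s])
  have eq: "AE \<omega> in P. c \<omega> * sgn (Ds r \<omega>) * Ms s \<omega> = c \<omega> * (Xs s \<omega> - As s \<omega>) * \<bar>Ds s \<omega>\<bar>"
    using Ms_decomp Ds_sign pos
  proof eventually_elim
    case (elim \<omega>)
    show ?case
    proof (cases "c \<omega> = 0")
      case False
      then have "sgn (Ds s \<omega>) = sgn (Ds r \<omega>)" using elim r by blast
      moreover have "sgn (Ds s \<omega>) * Ds s \<omega> = \<bar>Ds s \<omega>\<bar>" by (simp add: sgn_real_def)
      moreover have "Ms s \<omega> = (Xs s \<omega> - As s \<omega>) * Ds s \<omega>" using elim s by blast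
      ultimately show ?thesis by (metis (no_types, opaque_lifting) mult.assoc mult.commute)
    qed simp
  qed
  have i: "integrable P (\<lambda>\<omega>. c \<omega> * (Xs s \<omega> - As s \<omega>) * \<bar>Ds s \<omega>\<bar>)"
  proof (rule integrable_cong_AE_imp[OF hM])
    show "(\<lambda>\<omega>. c \<omega> * (Xs s \<omega> - As s \<omega>) * \<bar>Ds s \<omega>\<bar>) \<in> borel_measurable P"
      by (intro borel_measurable_times borel_measurable_abs DsP G_to_P[OF fs s])
    show "AE \<omega> in P. c \<omega> * sgn (Ds r \<omega>) * Ms s \<omega> = c \<omega> * (Xs s \<omega> - As s \<omega>) * \<bar>Ds s \<omega>\<bar>"
      by (rule eq)
  qed
  have sg': "AE \<omega> in P. c \<omega> * (Xs s \<omega> - As s \<omega>) \<noteq> 0 \<longrightarrow> sgn (D (stop s \<omega>) \<omega>) * D_inf \<omega> = \<bar>D_inf \<omega>\<bar>"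
    using Ds_sign As_mono pos
  proof eventually_elim
    case (elim \<omega>)
    show ?case
    proof
      assume "c \<omega> * (Xs s \<omega> - As s \<omega>) \<noteq> 0"
      then have "0 < As r \<omega>" using elim(3) by simp
      then have "0 < As s \<omega>" using elim(2) r by (meson less_le_trans)
      then show "sgn (D (stop s \<omega>) \<omega>) * D_inf \<omega> = \<bar>D_inf \<omega>\<bar>" using elim(1) s unfolding Ds_def by blast
    qed
  qed
  note conv = sign_conversion[OF stop_stopping[OF s] stop_le fs i[unfolded Ds_def] sg']
  show "integrable P (\<lambda>\<omega>. c \<omega> * (Xs s \<omega> - As s \<omega>) * \<bar>D_inf \<omega>\<bar>)" by (rule conv(1))
  have "(\<integral>\<omega>. c \<omega> * (Xs s \<omega> - As s \<omega>) * \<bar>D_inf \<omega>\<bar> \<partial>P) = (\<integral>\<omega>. c \<omega> * (Xs s \<omega> - As s \<omega>) * \<bar>Ds s \<omega>\<bar> \<partial>P)"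
    using conv(2) by (simp add: Ds_def)
  also have "\<dots> = (\<integral>\<omega>. c \<omega> * sgn (Ds r \<omega>) * Ms s \<omega> \<partial>P)"
    by (rule integral_cong_AE) (use i hM eq in \<open>auto elim: eventually_mono\<close>)
  also have "\<dots> = (\<integral>\<omega>. c \<omega> * sgn (Ds r \<omega>) * Ms r \<omega> \<partial>P)"
    by (rule averaging_mult[OF prob_space_axioms subalgebra_pre_sigma[OF stop_stopping[OF r(1)]]
          Ms_integrable[OF s] Ms_meas[OF r(1)] Ms_integrable[OF r(1)] Ms_average[OF r] hG hM])
  finally show "(\<integral>\<omega>. c \<omega> * (Xs s \<omega> - As s \<omega>) * \<bar>D_inf \<omega>\<bar> \<partial>P) = (\<integral>\<omega>. c \<omega> * sgn (Ds r \<omega>) * Ms r \<omega> \<partial>P)" .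
qed

text \<open>
  The alternative \<open>j = k\<close> makes the minimum exist: if \<open>A\<close> is never seen above \<open>x\<close>, the first grid time is the
  final time \<open>min T t\<close>.
\<close>

definition first_index :: "real \<Rightarrow> nat \<Rightarrow> 'a \<Rightarrow> nat" where
  "first_index x k \<omega> = (LEAST j. x < As (t * real j / real k) \<omega> \<or> j = k)"

definition first_grid_time :: "real \<Rightarrow> nat \<Rightarrow> 'a \<Rightarrow> real" where
  "first_grid_time x k \<omega> = stop (t * real (first_index x k \<omega>) / real k) \<omega>"

lemma first_index_spec: "x < As (t * real (first_index x k \<omega>) / real k) \<omega> \<or> first_index x k \<omega> = k"
  "first_index x k \<omega> \<le> k" "j < first_index x k \<omega> \<Longrightarrow> \<not> x < As (t * real j / real k) \<omega>"
  "x < As (t * real j / real k) \<omega> \<Longrightarrow> first_index x k \<omega> \<le> j"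
  unfolding first_index_def by (rule LeastI[of _ k], simp) (rule Least_le, simp, drule not_less_Least, simp, rule Least_le, simp)

lemma grid_nonneg: "0 \<le> t * real j / real k"
  using t by simp

lemma first_grid_time_stopping: "finite_stopping_time P F (first_grid_time x k)"
  unfolding finite_stopping_time_def
proof
  show "\<forall>\<omega>\<in>space P. 0 \<le> first_grid_time x k \<omega>"
    unfolding first_grid_time_def using stop_nonneg grid_nonneg by blast
  show "stopping_time F (first_grid_time x k)"
  proof
    fix u
    let ?r = "\<lambda>j. t * real j / real k"
    have eq: "first_grid_time x k \<omega> \<le> u \<longleftrightarrow> T \<omega> \<le> u \<or> (\<exists>j\<in>{j. j \<le> k \<and> ?r j \<le> u}. x < As (?r j) \<omega> \<or> j = k)" for \<omega>
    proof
      assume "first_grid_time x k \<omega> \<le> u"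
      then consider "T \<omega> \<le> u" | "?r (first_index x k \<omega>) \<le> u"
        unfolding first_grid_time_def stop_def by (auto simp: min_le_iff_disj)
      then show "T \<omega> \<le> u \<or> (\<exists>j\<in>{j. j \<le> k \<and> ?r j \<le> u}. x < As (?r j) \<omega> \<or> j = k)"
        using first_index_spec(1,2)[of x k \<omega>] by cases blast+
    next
      assume "T \<omega> \<le> u \<or> (\<exists>j\<in>{j. j \<le> k \<and> ?r j \<le> u}. x < As (?r j) \<omega> \<or> j = k)"
      then show "first_grid_time x k \<omega> \<le> u"
      proof
        assume "T \<omega> \<le> u"
        then show ?thesis by (simp add: first_grid_time_def stop_def min_le_iff_disj)
      next
        assume "\<exists>j\<in>{j. j \<le> k \<and> ?r j \<le> u}. x < As (?r j) \<omega> \<or> j = k"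
        then obtain j where j: "j \<le> k" "?r j \<le> u" "x < As (?r j) \<omega> \<or> j = k" by blast
        then have "first_index x k \<omega> \<le> j" using first_index_spec(2,4) by blast
        then have "?r (first_index x k \<omega>) \<le> ?r j" using t by (intro divide_right_mono mult_left_mono) auto
        then show ?thesis using j(2) stop_le[of "?r (first_index x k \<omega>)" \<omega>] unfolding first_grid_time_def by linarith
      qed
    qed
    have "Measurable.pred (F u) (\<lambda>\<omega>. \<exists>j\<in>{j. j \<le> k \<and> ?r j \<le> u}. x < As (?r j) \<omega> \<or> j = k)"
    proof (rule pred_intros_finite(4))
      fix j assume j: "j \<in> {j. j \<le> k \<and> ?r j \<le> u}"
      have "As (?r j) \<in> borel_measurable (F (?r j))"
        by (rule measurable_from_subalg[OF _ As_meas[OF grid_nonneg]])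
          (use G_subset_F[OF grid_nonneg] in \<open>auto simp: subalgebra_def space_pre_sigma space_F\<close>)
      then have [measurable]: "As (?r j) \<in> borel_measurable (F u)" by (rule measurable_F_mono) (use j in simp)
      show "Measurable.pred (F u) (\<lambda>\<omega>. x < As (?r j) \<omega> \<or> j = k)" by measurable
    qed simp
    then show "Measurable.pred (F u) (\<lambda>\<omega>. first_grid_time x k \<omega> \<le> u)"
      unfolding eq by (intro pred_intros_logic stopping_timeD[OF stopping[OF T_stopping]])
  qed
qed

text \<open>
  Decompose \<open>{x < A}\<close> at the final time according to the grid point at which \<open>A\<close> is first seen above \<open>x\<close>. On each
  piece \<open>entry_identity\<close> replaces the final time by that grid point.
\<close>

lemma grid_tail_identity:
  assumes x: "0 \<le> x" and k: "0 < k"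
  shows "integrable P (\<lambda>\<omega>. of_bool (x < As t \<omega>) * (Xs t \<omega> - As t \<omega>) * \<bar>D_inf \<omega>\<bar>)"
    and "integrable P (\<lambda>\<omega>. of_bool (x < As t \<omega>) * (X (first_grid_time x k \<omega>) \<omega> - A (first_grid_time x k \<omega>) \<omega>) * \<bar>D_inf \<omega>\<bar>)"
    and "(\<integral>\<omega>. of_bool (x < As t \<omega>) * (Xs t \<omega> - As t \<omega>) * \<bar>D_inf \<omega>\<bar> \<partial>P)
      = (\<integral>\<omega>. of_bool (x < As t \<omega>) * (X (first_grid_time x k \<omega>) \<omega> - A (first_grid_time x k \<omega>) \<omega>) * \<bar>D_inf \<omega>\<bar> \<partial>P)"
proof -
  let ?r = "\<lambda>j. t * real j / real k"
  have rk: "?r k = t" using k by simp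
  have rmono: "?r i \<le> ?r j" if "i \<le> j" for i j using t that by (intro divide_right_mono mult_left_mono) auto
  \<comment> \<open>the event that \<open>A\<close> is seen above \<open>x\<close> at the grid point \<open>j\<close> for the first time\<close>
  define c :: "nat \<Rightarrow> 'a \<Rightarrow> real" where "c j \<omega> = of_bool (x < As (?r j) \<omega> \<and> (\<forall>i\<in>{..<j}. \<not> x < As (?r i) \<omega>))" for j \<omega>
  have cm: "c j \<in> borel_measurable (G (?r j))" for j
  proof -
    have a: "As (?r i) \<in> borel_measurable (G (?r j))" if "i \<le> j" for i
      by (rule G_up[OF As_meas[OF grid_nonneg] grid_nonneg rmono[OF that]])
    have p: "Measurable.pred (G (?r j)) (\<lambda>\<omega>. x < As (?r i) \<omega>)" if "i \<le> j" for i
      using a[OF that] by measurable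
    have "Measurable.pred (G (?r j)) (\<lambda>\<omega>. x < As (?r j) \<omega> \<and> (\<forall>i\<in>{..<j}. \<not> x < As (?r i) \<omega>))"
      by (intro pred_intros_logic pred_intros_finite p) auto
    then show ?thesis unfolding c_def[abs_def] of_bool_def pred_def by (intro measurable_If measurable_const) auto
  qed
  have c01: "\<bar>c j \<omega>\<bar> \<le> 1" "0 \<le> c j \<omega>" for j \<omega> by (auto simp: c_def)
  have pos: "AE \<omega> in P. c j \<omega> \<noteq> 0 \<longrightarrow> 0 < As (?r j) \<omega>" for j
    by (rule AE_I2) (use x in \<open>auto simp: c_def\<close>)
  note one = entry_identity[OF grid_nonneg rmono cm c01 pos]
  have cJ: "c j \<omega> = of_bool (j = first_index x k \<omega> \<and> x < As (?r j) \<omega>)" if "j \<le> k" for j \<omega>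
  proof (cases "x < As (?r j) \<omega>")
    case True
    have "(\<forall>i\<in>{..<j}. \<not> x < As (?r i) \<omega>) \<longleftrightarrow> j = first_index x k \<omega>"
    proof
      assume no: "\<forall>i\<in>{..<j}. \<not> x < As (?r i) \<omega>"
      have le: "first_index x k \<omega> \<le> j" by (rule first_index_spec(4)[OF True])
      have "\<not> first_index x k \<omega> < j" using no first_index_spec(1)[of x k \<omega>] that by auto
      then show "j = first_index x k \<omega>" using le by simp
    next
      assume "j = first_index x k \<omega>"
      then show "\<forall>i\<in>{..<j}. \<not> x < As (?r i) \<omega>" using first_index_spec(3) by blast
    qed
    then show ?thesis using True by (simp add: c_def)
  qed (simp add: c_def)
  have sum: "AE \<omega> in P. \<forall>g::nat \<Rightarrow> real. (\<Sum>j\<le>k. c j \<omega> * g j) = of_bool (x < As t \<omega>) * g (first_index x k \<omega>)"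
    using As_mono
  proof eventually_elim
    case (elim \<omega>)
    have iff: "x < As t \<omega> \<longleftrightarrow> x < As (?r (first_index x k \<omega>)) \<omega>"
    proof
      assume "x < As t \<omega>"
      then show "x < As (?r (first_index x k \<omega>)) \<omega>" using first_index_spec(1)[of x k \<omega>] rk by auto
    next
      have "As (?r (first_index x k \<omega>)) \<omega> \<le> As (?r k) \<omega>"
        by (rule elim[rule_format, OF grid_nonneg rmono[OF first_index_spec(2)]])
      then have "As (?r (first_index x k \<omega>)) \<omega> \<le> As t \<omega>" unfolding rk .
      then show "x < As (?r (first_index x k \<omega>)) \<omega> \<Longrightarrow> x < As t \<omega>" by simp
    qed
    show ?case
    proof
      fix g :: "nat \<Rightarrow> real"
      have "(\<Sum>j\<le>k. c j \<omega> * g j) = (\<Sum>j\<le>k. if j = first_index x k \<omega> then of_bool (x < As t \<omega>) * g (first_index x k \<omega>) else 0)"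
        by (intro sum.cong refl) (use iff in \<open>auto simp: cJ\<close>)
      then show "(\<Sum>j\<le>k. c j \<omega> * g j) = of_bool (x < As t \<omega>) * g (first_index x k \<omega>)"
        using first_index_spec(2)[of x k \<omega>] by simp
    qed
  qed
  have stP: "finite_stopping_time P F (stop t)" by (rule stop_stopping[OF t])
  have m1: "(\<lambda>\<omega>. of_bool (x < As t \<omega>) :: real) \<in> borel_measurable P"
  proof -
    have [measurable]: "As t \<in> borel_measurable P" by (rule G_to_P[OF As_meas[OF t] t])
    show ?thesis unfolding of_bool_def by measurable
  qed
  have m2: "(\<lambda>\<omega>. X (first_grid_time x k \<omega>) \<omega> - A (first_grid_time x k \<omega>) \<omega>) \<in> borel_measurable P"
    by (intro borel_measurable_diff X_measurable A_measurable first_grid_time_stopping)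
  have m3: "(\<lambda>\<omega>. Xs t \<omega> - As t \<omega>) \<in> borel_measurable P"
    by (intro borel_measurable_diff G_to_P[OF Xs_meas] G_to_P[OF As_meas] t)
  have i1: "integrable P (\<lambda>\<omega>. \<Sum>j\<le>k. c j \<omega> * (Xs t \<omega> - As t \<omega>) * \<bar>D_inf \<omega>\<bar>)"
  proof (rule Bochner_Integration.integrable_sum)
    fix j assume "j \<in> {..k}"
    then show "integrable P (\<lambda>\<omega>. c j \<omega> * (Xs t \<omega> - As t \<omega>) * \<bar>D_inf \<omega>\<bar>)"
      using one(1)[of j k] unfolding rk by simp
  qed
  have i2: "integrable P (\<lambda>\<omega>. \<Sum>j\<le>k. c j \<omega> * (Xs (?r j) \<omega> - As (?r j) \<omega>) * \<bar>D_inf \<omega>\<bar>)"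
    by (rule Bochner_Integration.integrable_sum) (rule one(1), simp)
  have e1: "AE \<omega> in P. of_bool (x < As t \<omega>) * (Xs t \<omega> - As t \<omega>) * \<bar>D_inf \<omega>\<bar> = (\<Sum>j\<le>k. c j \<omega> * (Xs t \<omega> - As t \<omega>) * \<bar>D_inf \<omega>\<bar>)"
    using sum by eventually_elim (simp add: mult.assoc)
  have e2: "AE \<omega> in P. of_bool (x < As t \<omega>) * (X (first_grid_time x k \<omega>) \<omega> - A (first_grid_time x k \<omega>) \<omega>) * \<bar>D_inf \<omega>\<bar>
      = (\<Sum>j\<le>k. c j \<omega> * (Xs (?r j) \<omega> - As (?r j) \<omega>) * \<bar>D_inf \<omega>\<bar>)"
    using sum
  proof eventually_elim
    case (elim \<omega>)
    show ?case using elim[rule_format, of "\<lambda>j. (Xs (?r j) \<omega> - As (?r j) \<omega>) * \<bar>D_inf \<omega>\<bar>"]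
      by (simp add: mult.assoc Xs_def As_def first_grid_time_def)
  qed
  show I1: "integrable P (\<lambda>\<omega>. of_bool (x < As t \<omega>) * (Xs t \<omega> - As t \<omega>) * \<bar>D_inf \<omega>\<bar>)"
    by (rule integrable_cong_AE_imp[OF i1]) (intro borel_measurable_times m1 m3 borel_measurable_abs D_inf_measurable,
        use e1 in eventually_elim, simp)
  show I2: "integrable P (\<lambda>\<omega>. of_bool (x < As t \<omega>) * (X (first_grid_time x k \<omega>) \<omega> - A (first_grid_time x k \<omega>) \<omega>) * \<bar>D_inf \<omega>\<bar>)"
    by (rule integrable_cong_AE_imp[OF i2]) (intro borel_measurable_times m1 m2 borel_measurable_abs D_inf_measurable,
        use e2 in eventually_elim, simp)
  have "(\<integral>\<omega>. of_bool (x < As t \<omega>) * (Xs t \<omega> - As t \<omega>) * \<bar>D_inf \<omega>\<bar> \<partial>P)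
      = (\<integral>\<omega>. (\<Sum>j\<le>k. c j \<omega> * (Xs t \<omega> - As t \<omega>) * \<bar>D_inf \<omega>\<bar>) \<partial>P)"
    by (rule integral_cong_AE[OF borel_measurable_integrable[OF I1] borel_measurable_integrable[OF i1] e1])
  also have "\<dots> = (\<Sum>j\<le>k. \<integral>\<omega>. c j \<omega> * (Xs t \<omega> - As t \<omega>) * \<bar>D_inf \<omega>\<bar> \<partial>P)"
    by (rule Bochner_Integration.integral_sum) (use one(1)[of _ k, unfolded rk] in simp)
  also have "\<dots> = (\<Sum>j\<le>k. \<integral>\<omega>. c j \<omega> * (Xs (?r j) \<omega> - As (?r j) \<omega>) * \<bar>D_inf \<omega>\<bar> \<partial>P)"
  proof (rule sum.cong[OF refl])
    fix j assume j: "j \<in> {..k}"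
    show "(\<integral>\<omega>. c j \<omega> * (Xs t \<omega> - As t \<omega>) * \<bar>D_inf \<omega>\<bar> \<partial>P) = (\<integral>\<omega>. c j \<omega> * (Xs (?r j) \<omega> - As (?r j) \<omega>) * \<bar>D_inf \<omega>\<bar> \<partial>P)"
      using one(2)[of j k] one(2)[of j j] j unfolding rk by simp
  qed
  also have "\<dots> = (\<integral>\<omega>. (\<Sum>j\<le>k. c j \<omega> * (Xs (?r j) \<omega> - As (?r j) \<omega>) * \<bar>D_inf \<omega>\<bar>) \<partial>P)"
    by (rule Bochner_Integration.integral_sum[symmetric]) (rule one(1), simp)
  also have "\<dots> = (\<integral>\<omega>. of_bool (x < As t \<omega>) * (X (first_grid_time x k \<omega>) \<omega> - A (first_grid_time x k \<omega>) \<omega>) * \<bar>D_inf \<omega>\<bar> \<partial>P)"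
    by (rule integral_cong_AE[OF borel_measurable_integrable[OF I2] borel_measurable_integrable[OF i2] e2, symmetric])
  finally show "(\<integral>\<omega>. of_bool (x < As t \<omega>) * (Xs t \<omega> - As t \<omega>) * \<bar>D_inf \<omega>\<bar> \<partial>P)
      = (\<integral>\<omega>. of_bool (x < As t \<omega>) * (X (first_grid_time x k \<omega>) \<omega> - A (first_grid_time x k \<omega>) \<omega>) * \<bar>D_inf \<omega>\<bar> \<partial>P)" .
qed

lemma stopped_path:
  assumes x: "0 \<le> x"
  shows "AE \<omega> in P. x < As t \<omega> \<longrightarrow>
    (\<lambda>k. X (first_grid_time x (Suc k) \<omega>) \<omega>) \<longlonglongrightarrow> 0 \<and> (\<lambda>k. A (first_grid_time x (Suc k) \<omega>) \<omega>) \<longlonglongrightarrow> x"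
  using A_path A_carried right_continuous_X As_mono AE_space
proof eventually_elim
  case (elim \<omega>)
  show ?case
  proof
    assume gt: "x < As t \<omega>"
    let ?r = "\<lambda>k j. t * real j / real (Suc k)"
    define J where "J k = first_index x (Suc k) \<omega>" for k
    define p where "p k = stop (?r k (J k - 1)) \<omega>" for k
    define q where "q k = first_grid_time x (Suc k) \<omega>" for k
    have qJ: "q k = stop (?r k (J k)) \<omega>" for k by (simp add: q_def J_def first_grid_time_def)
    have A0: "As 0 \<omega> = 0" using elim stop_nonneg[OF elim(5), of 0] stop_le[of 0 \<omega>] by (simp add: As_def)
    have above: "x < As (?r k (J k)) \<omega>" for k
      using first_index_spec(1)[of x "Suc k" \<omega>] gt unfolding J_def[symmetric] by auto
    have Jpos: "0 < J k" for k
    proof (rule ccontr)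
      assume "\<not> 0 < J k"
      then show False using above[of k] A0 x by simp
    qed
    have pq: "\<forall>\<^sub>F k in sequentially. 0 \<le> p k \<and> p k \<le> q k \<and> A (p k) \<omega> \<le> x \<and> x < A (q k) \<omega> \<and> q k - p k \<le> t / real (Suc k)"
    proof (intro always_eventually allI conjI)
      fix k
      have nn: "0 \<le> ?r k j" for j by (rule grid_nonneg)
      have step: "?r k (J k) = ?r k (J k - 1) + t / real (Suc k)"
        using Jpos[of k] by (simp add: of_nat_diff field_simps del: of_nat_Suc)
      have tk: "0 \<le> t / real (Suc k)" using t by simp
      show "0 \<le> p k" unfolding p_def by (rule stop_nonneg[OF elim(5) nn])
      show "p k \<le> q k" unfolding p_def qJ by (rule stop_mono) (use step tk in linarith)
      have "J k - 1 < J k" using Jpos[of k] by simp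
      then have "\<not> x < As (?r k (J k - 1)) \<omega>" unfolding J_def by (rule first_index_spec(3))
      then show "A (p k) \<omega> \<le> x" by (simp add: p_def As_def)
      show "x < A (q k) \<omega>" using above[of k] by (simp add: qJ As_def)
      show "q k - p k \<le> t / real (Suc k)" unfolding p_def qJ stop_def using step tk by (simp add: min_def del: of_nat_Suc)
    qed
    have e: "(\<lambda>k. t / real (Suc k)) \<longlonglongrightarrow> 0"
      using tendsto_mult[OF tendsto_const LIMSEQ_inverse_real_of_nat, of t] by (simp add: divide_inverse)
    have rcX: "continuous (at_right s) (\<lambda>s. X s \<omega>)" if "0 \<le> s" for s using elim(3) that by simp
    note * = values_after_level_crossing[where a="\<lambda>s. A s \<omega>" and x="\<lambda>s. X s \<omega>", OF _ _ _ x elim(2) rcX pq e]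
    show "(\<lambda>k. X (first_grid_time x (Suc k) \<omega>) \<omega>) \<longlonglongrightarrow> 0 \<and> (\<lambda>k. A (first_grid_time x (Suc k) \<omega>) \<omega>) \<longlonglongrightarrow> x"
      using * elim(1) unfolding q_def by blast
  qed
qed

text \<open>
  As the grid is refined, \<open>X\<close> tends to \<open>0\<close> and \<open>A\<close> to \<open>x\<close> at the first grid time above the level. The values of
  \<open>X\<close> are uniformly integrable under \<open>P'\<close> by class (D), since first grid times are stopping times; those of
  \<open>A\<close> are dominated by the final value of \<open>A\<close>.
\<close>

lemma stopped_tail_identity:
  assumes x: "0 \<le> x"
  shows "integrable P' (\<lambda>\<omega>. of_bool (x < As t \<omega>) * As t \<omega>)" "integrable P' (Xs t)"
    and "(\<integral>\<omega>. of_bool (x < As t \<omega>) * Xs t \<omega> \<partial>P') = (\<integral>\<omega>. of_bool (x < As t \<omega>) * (As t \<omega> - x) \<partial>P')"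
proof -
  interpret P': prob_space P' by (rule prob_space_P')
  obtain K where XK: "\<And>R. finite_stopping_time P F R \<Longrightarrow> integrable P' (\<lambda>\<omega>. X (R \<omega>) \<omega>)"
    using X_L1_bounded by blast
  have [measurable]: "As t \<in> borel_measurable P" by (rule G_to_P[OF As_meas[OF t] t])
  have [measurable]: "Xs t \<in> borel_measurable P" by (rule G_to_P[OF Xs_meas[OF t] t])
  define b :: "'a \<Rightarrow> real" where "b \<omega> = of_bool (x < As t \<omega>)" for \<omega>
  have bm [measurable]: "b \<in> borel_measurable P" unfolding b_def[abs_def] of_bool_def by measurable
  have b1: "\<bar>b \<omega>\<bar> \<le> 1" for \<omega> by (simp add: b_def)
  show Xi: "integrable P' (Xs t)" unfolding Xs_def[abs_def] by (rule XK[OF stop_stopping[OF t]])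
  have bX: "integrable P' (\<lambda>\<omega>. b \<omega> * Xs t \<omega>)" by (rule integrable_bounded_mult[OF Xi _ b1]) simp
  define \<sigma> where "\<sigma> k = first_grid_time x (Suc k)" for k
  have \<sigma>: "finite_stopping_time P F (\<sigma> k)" for k unfolding \<sigma>_def by (rule first_grid_time_stopping)
  have X\<sigma>m [measurable]: "(\<lambda>\<omega>. X (\<sigma> k \<omega>) \<omega>) \<in> borel_measurable P" for k by (rule X_measurable[OF \<sigma>])
  have A\<sigma>m [measurable]: "(\<lambda>\<omega>. A (\<sigma> k \<omega>) \<omega>) \<in> borel_measurable P" for k by (rule A_measurable[OF \<sigma>])
  note grid = grid_tail_identity[OF x zero_less_Suc, folded b_def \<sigma>_def]
  have V: "integrable P' (\<lambda>\<omega>. b \<omega> * (Xs t \<omega> - As t \<omega>))"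
    by (subst integrable_P'_iff) (simp, rule grid(1))
  have V\<sigma>: "integrable P' (\<lambda>\<omega>. b \<omega> * (X (\<sigma> k \<omega>) \<omega> - A (\<sigma> k \<omega>) \<omega>))" for k
    by (subst integrable_P'_iff) (simp, rule grid(2))
  have eq: "(\<integral>\<omega>. b \<omega> * (Xs t \<omega> - As t \<omega>) \<partial>P') = (\<integral>\<omega>. b \<omega> * (X (\<sigma> k \<omega>) \<omega> - A (\<sigma> k \<omega>) \<omega>) \<partial>P')" for k
  proof -
    have "(\<integral>\<omega>. b \<omega> * (Xs t \<omega> - As t \<omega>) * \<bar>D_inf \<omega>\<bar> \<partial>P) = (\<integral>\<omega>. b \<omega> * (X (\<sigma> k \<omega>) \<omega> - A (\<sigma> k \<omega>) \<omega>) * \<bar>D_inf \<omega>\<bar> \<partial>P)"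
      by (rule grid(3))
    then show ?thesis by (subst (1 2) integral_P') simp_all
  qed
  have bA: "integrable P' (\<lambda>\<omega>. b \<omega> * As t \<omega>)"
    using Bochner_Integration.integrable_diff[OF bX V] by (simp add: algebra_simps)
  then show "integrable P' (\<lambda>\<omega>. of_bool (x < As t \<omega>) * As t \<omega>)" by (simp add: b_def)
  have path: "AE \<omega> in P'. b \<omega> \<noteq> 0 \<longrightarrow> (\<lambda>k. X (\<sigma> k \<omega>) \<omega>) \<longlonglongrightarrow> 0 \<and> (\<lambda>k. A (\<sigma> k \<omega>) \<omega>) \<longlonglongrightarrow> x"
    using AE_P'I[OF stopped_path[OF x]] by eventually_elim (simp add: b_def \<sigma>_def)
  have limX: "(\<lambda>k. \<integral>\<omega>. b \<omega> * X (\<sigma> k \<omega>) \<omega> \<partial>P') \<longlonglongrightarrow> (\<integral>\<omega>. 0 \<partial>P')"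
  proof (rule vitali_convergence_dominated(2))
    show "finite_measure P'" by unfold_locales
    show "AE \<omega> in P'. (\<lambda>k. b \<omega> * X (\<sigma> k \<omega>) \<omega>) \<longlonglongrightarrow> 0"
      using path
    proof eventually_elim
      case (elim \<omega>)
      show ?case
      proof (cases "b \<omega> = 0")
        case False
        then show ?thesis using elim tendsto_mult[OF tendsto_const, of "\<lambda>k. X (\<sigma> k \<omega>) \<omega>" 0 sequentially "b \<omega>"] by simp
      qed simp
    qed
    show "\<bar>b \<omega> * X (\<sigma> k \<omega>) \<omega>\<bar> \<le> \<bar>X (\<sigma> k \<omega>) \<omega>\<bar>" for k \<omega> by (simp add: b_def)
    show "\<exists>K. \<forall>k. (\<integral>\<^sup>+ \<omega>. ennreal \<bar>X (\<sigma> k \<omega>) \<omega>\<bar> * indicator {\<omega>. K < \<bar>X (\<sigma> k \<omega>) \<omega>\<bar>} \<omega> \<partial>P') \<le> ennreal e" if "0 < e" for e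
      using X_uniformly_integrable[OF that] \<sigma> by meson
  qed simp_all
  have Amon: "AE \<omega> in P'. \<forall>k. \<bar>A (\<sigma> k \<omega>) \<omega>\<bar> \<le> As t \<omega>"
  proof (rule AE_P'I)
    show "AE \<omega> in P. \<forall>k. \<bar>A (\<sigma> k \<omega>) \<omega>\<bar> \<le> As t \<omega>"
      using A_mono A_nonneg AE_space
    proof eventually_elim
      case (elim \<omega>)
      show ?case
      proof
        fix k
        have "t * real (first_index x (Suc k) \<omega>) / real (Suc k) \<le> t * real (Suc k) / real (Suc k)"
          using first_index_spec(2)[of x "Suc k" \<omega>] t by (intro divide_right_mono mult_left_mono) auto
        also have "t * real (Suc k) / real (Suc k) = t" by simp
        finally have "\<sigma> k \<omega> \<le> stop t \<omega>" unfolding \<sigma>_def first_grid_time_def by (rule stop_mono)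
        moreover have "0 \<le> \<sigma> k \<omega>" by (rule stopping_nonneg[OF \<sigma> elim(3)])
        ultimately have "A (\<sigma> k \<omega>) \<omega> \<le> As t \<omega>" "0 \<le> A (\<sigma> k \<omega>) \<omega>" using elim unfolding As_def by blast+
        then show "\<bar>A (\<sigma> k \<omega>) \<omega>\<bar> \<le> As t \<omega>" by simp
      qed
    qed
  qed
  have limA: "(\<lambda>k. \<integral>\<omega>. b \<omega> * A (\<sigma> k \<omega>) \<omega> \<partial>P') \<longlonglongrightarrow> (\<integral>\<omega>. b \<omega> * x \<partial>P')"
  proof (rule integral_dominated_convergence[where w="\<lambda>\<omega>. b \<omega> * As t \<omega>"])
    show "AE \<omega> in P'. (\<lambda>k. b \<omega> * A (\<sigma> k \<omega>) \<omega>) \<longlonglongrightarrow> b \<omega> * x"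
      using path
    proof eventually_elim
      case (elim \<omega>)
      show ?case
      proof (cases "b \<omega> = 0")
        case False
        then show ?thesis using elim by (intro tendsto_mult tendsto_const) simp
      qed simp
    qed
    show "AE \<omega> in P'. norm (b \<omega> * A (\<sigma> k \<omega>) \<omega>) \<le> b \<omega> * As t \<omega>" for k
      using Amon by eventually_elim (simp add: b_def abs_mult)
  qed (use bA in simp_all)
  have iX\<sigma>: "integrable P' (\<lambda>\<omega>. b \<omega> * X (\<sigma> k \<omega>) \<omega>)" for k
    by (rule integrable_bounded_mult[OF XK[OF \<sigma>] _ b1]) simp
  have iA\<sigma>: "integrable P' (\<lambda>\<omega>. b \<omega> * A (\<sigma> k \<omega>) \<omega>)" for k
    using Bochner_Integration.integrable_diff[OF iX\<sigma> V\<sigma>, of k k] by (simp add: algebra_simps)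
  have const: "(\<integral>\<omega>. b \<omega> * X (\<sigma> k \<omega>) \<omega> \<partial>P') - (\<integral>\<omega>. b \<omega> * A (\<sigma> k \<omega>) \<omega> \<partial>P') = (\<integral>\<omega>. b \<omega> * (Xs t \<omega> - As t \<omega>) \<partial>P')" for k
    unfolding eq[of k] by (subst Bochner_Integration.integral_diff[OF iX\<sigma> iA\<sigma>, symmetric]) (simp add: right_diff_distrib)
  have "(\<lambda>k. (\<integral>\<omega>. b \<omega> * X (\<sigma> k \<omega>) \<omega> \<partial>P') - (\<integral>\<omega>. b \<omega> * A (\<sigma> k \<omega>) \<omega> \<partial>P')) \<longlonglongrightarrow> (\<integral>\<omega>. 0 \<partial>P') - (\<integral>\<omega>. b \<omega> * x \<partial>P')"
    by (rule tendsto_diff[OF limX limA])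
  then have "(\<integral>\<omega>. b \<omega> * (Xs t \<omega> - As t \<omega>) \<partial>P') = - (\<integral>\<omega>. b \<omega> * x \<partial>P')"
    unfolding const by (simp add: LIMSEQ_const_iff)
  moreover have "(\<integral>\<omega>. b \<omega> * (Xs t \<omega> - As t \<omega>) \<partial>P') = (\<integral>\<omega>. b \<omega> * Xs t \<omega> \<partial>P') - (\<integral>\<omega>. b \<omega> * As t \<omega> \<partial>P')"
    by (subst Bochner_Integration.integral_diff[OF bX bA, symmetric]) (simp add: right_diff_distrib)
  moreover have "(\<integral>\<omega>. b \<omega> * (As t \<omega> - x) \<partial>P') = (\<integral>\<omega>. b \<omega> * As t \<omega> \<partial>P') - (\<integral>\<omega>. b \<omega> * x \<partial>P')"
  proof -
    have "integrable P' (\<lambda>\<omega>. b \<omega> * x)"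
      by (rule integrable_bounded_mult[OF _ _ b1]) simp_all
    then show ?thesis by (subst Bochner_Integration.integral_diff[OF bA, symmetric]) (simp_all add: right_diff_distrib)
  qed
  ultimately show "(\<integral>\<omega>. of_bool (x < As t \<omega>) * Xs t \<omega> \<partial>P') = (\<integral>\<omega>. of_bool (x < As t \<omega>) * (As t \<omega> - x) \<partial>P')"
    unfolding b_def by linarith
qed

text \<open>
  A sign switch of \<open>D\<close> between grid points leaves a zero of \<open>D\<close> in between. By \<open>small_shortly_after_zero\<close>, on
  almost every path all switches of a fine grid have \<open>X \<le> \<delta>\<close>, so the error terms of \<open>sign_switch_estimate\<close>
  vanish as the grid is refined.
\<close>

lemma signed_stopped_value_nonpos: "(\<integral>\<omega>. sgn (Ds t \<omega>) * Ms t \<omega> \<partial>P) \<le> 0"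
proof (rule field_le_epsilon)
  fix \<epsilon> :: real assume \<epsilon>: "0 < \<epsilon>"
  have DsP [measurable]: "Ds r \<in> borel_measurable P" if "0 \<le> r" for r by (rule G_to_P[OF Ds_meas[OF that] that])
  have MsP: "Ms t \<in> borel_measurable P" by (rule G_to_P[OF Ms_meas[OF t] t])
  have sM: "integrable P (\<lambda>\<omega>. sgn (Ds t \<omega>) * Ms t \<omega>)"
    using measurable_compose[OF DsP[OF t] borel_measurable_sgn] abs_sgn_le_1
    by (rule integrable_bounded_mult[OF Ms_integrable[OF t]])
  define E where "E = (\<integral>\<omega>. \<bar>Ds t \<omega>\<bar> \<partial>P)"
  have E: "0 \<le> E" by (simp add: E_def)
  \<comment> \<open>\<open>E + 1\<close> instead of \<open>E\<close>, which may be \<open>0\<close>\<close>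
  define \<delta> where "\<delta> = \<epsilon> / (E + 1)"
  have \<delta>: "0 < \<delta>" using \<epsilon> E by (simp add: \<delta>_def)
  let ?r = "\<lambda>k j. t * real j / real (Suc k)"
  define bad where "bad k \<omega> \<longleftrightarrow> (\<exists>j<Suc k. sgn (Ds (?r k (Suc j)) \<omega>) \<noteq> sgn (Ds (?r k j) \<omega>) \<and> \<delta> < Xs (?r k (Suc j)) \<omega>)" for k \<omega>
  have rk: "?r k (Suc k) = t" for k by simp
  have rmono: "?r k i \<le> ?r k j" if "i \<le> j" for i j k using t that by (intro divide_right_mono mult_left_mono) auto
  have nn: "0 \<le> ?r k j" for k j by (rule grid_nonneg)
  have est: "(\<integral>\<omega>. of_bool (\<not> bad k \<omega>) * (sgn (Ds t \<omega>) * Ms t \<omega>) \<partial>P)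
      \<le> \<delta> * (\<integral>\<omega>. \<bar>Ds t \<omega>\<bar> \<partial>P) + (\<integral>\<omega>. of_bool (bad k \<omega>) * \<bar>Ms t \<omega>\<bar> \<partial>P)" for k
  proof -
    have start: "AE \<omega> in P. Ms (?r k 0) \<omega> = 0"
      using N_start AE_space
    proof eventually_elim
      case (elim \<omega>)
      have "stop 0 \<omega> = 0" using stop_nonneg[OF elim(2), of 0] stop_le[of 0 \<omega>] by simp
      then show ?case using elim by (simp add: Ms_def)
    qed
    have prod: "AE \<omega> in P. \<forall>i\<le>Suc k. Ms (?r k i) \<omega> = (Xs (?r k i) \<omega> - As (?r k i) \<omega>) * Ds (?r k i) \<omega>
        \<and> Xs (?r k i) \<omega> - As (?r k i) \<omega> \<le> Xs (?r k i) \<omega>"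
      using Ms_decomp
    proof eventually_elim
      case (elim \<omega>)
      show ?case
      proof (intro allI impI)
        fix i
        show "Ms (?r k i) \<omega> = (Xs (?r k i) \<omega> - As (?r k i) \<omega>) * Ds (?r k i) \<omega> \<and> Xs (?r k i) \<omega> - As (?r k i) \<omega> \<le> Xs (?r k i) \<omega>"
          using elim[rule_format, OF nn[of i k]] by auto
      qed
    qed
    have "(\<integral>\<omega>. of_bool (\<not> bad k \<omega>) * (sgn (Ds (?r k (Suc k)) \<omega>) * Ms (?r k (Suc k)) \<omega>) \<partial>P)
      \<le> \<delta> * (\<integral>\<omega>. \<bar>Ds (?r k (Suc k)) \<omega>\<bar> \<partial>P) + (\<integral>\<omega>. of_bool (bad k \<omega>) * \<bar>Ms (?r k (Suc k)) \<omega>\<bar> \<partial>P)"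
      unfolding bad_def
      by (rule sign_switch_estimate[where m="\<lambda>i. Ms (?r k i)" and d="\<lambda>i. Ds (?r k i)" and x="\<lambda>i. Xs (?r k i)"
            and v="\<lambda>i \<omega>. Xs (?r k i) \<omega> - As (?r k i) \<omega>" and G="\<lambda>i. G (?r k i)" and k="Suc k",
            OF prob_space_axioms less_imp_le[OF \<delta>] subalgebra_pre_sigma[OF stop_stopping[OF nn]] G_mono[OF nn rmono]
             Ms_meas[OF nn] Ds_meas[OF nn] Xs_meas[OF nn] Ms_integrable[OF nn] Ds_integrable[OF nn]
             Ms_average[OF nn rmono] Ds_average[OF nn rmono] start prod])
    then show ?thesis unfolding rk .
  qed
  have ev: "AE \<omega> in P. \<forall>\<^sub>F k in sequentially. \<not> bad k \<omega>"
    using continuous_D cadlag_X X_zero_of_D_zero AE_space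
  proof eventually_elim
    case (elim \<omega>)
    have e: "(\<lambda>k. t / real (Suc k)) \<longlonglongrightarrow> 0"
      using tendsto_mult[OF tendsto_const LIMSEQ_inverse_real_of_nat, of t] by (simp add: divide_inverse)
    have "\<forall>\<^sub>F k in sequentially. \<forall>z r. 0 \<le> z \<longrightarrow> z \<le> r \<longrightarrow> r \<le> t \<longrightarrow> r - z \<le> t / real (Suc k) \<longrightarrow> D z \<omega> = 0 \<longrightarrow> X r \<omega> \<le> \<delta>"
      by (rule small_shortly_after_zero[OF elim(1,2) _ \<delta> t e]) (use elim(3) in blast)
    then show ?case
    proof eventually_elim
      case (elim k)
      show ?case
      proof
        assume "bad k \<omega>"
        then obtain j where j: "j < Suc k" "sgn (Ds (?r k (Suc j)) \<omega>) \<noteq> sgn (Ds (?r k j) \<omega>)" "\<delta> < Xs (?r k (Suc j)) \<omega>"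
          unfolding bad_def by blast
        define p where "p = stop (?r k j) \<omega>"
        define q where "q = stop (?r k (Suc j)) \<omega>"
        have p0: "0 \<le> p" unfolding p_def by (rule stop_nonneg[OF \<open>\<omega> \<in> space P\<close> nn])
        have pq: "p \<le> q" unfolding p_def q_def by (rule stop_mono[OF rmono]) simp
        have step: "?r k (Suc j) = ?r k j + t / real (Suc k)" by (simp add: field_simps del: of_nat_Suc) (simp add: algebra_simps)
        have tk: "0 \<le> t / real (Suc k)" using t by simp
        have qp: "q - p \<le> t / real (Suc k)" unfolding p_def q_def stop_def using step tk by (simp add: min_def del: of_nat_Suc)
        have "?r k (Suc j) \<le> ?r k (Suc k)" by (rule rmono) (use j in simp)
        then have qt: "q \<le> t" unfolding q_def rk using stop_le[of "?r k (Suc j)" \<omega>] by linarith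
        have "\<exists>z\<ge>p. z \<le> q \<and> D z \<omega> = 0"
        proof (rule ccontr)
          assume "\<not> ?thesis"
          then have "sgn (D q \<omega>) = sgn (D p \<omega>)"
            by (intro continuous_sign_constant[OF \<open>continuous_on {0..} (\<lambda>t. D t \<omega>)\<close> p0 pq]) blast
          then show False using j(2) unfolding Ds_def p_def q_def by simp
        qed
        then obtain z where z: "p \<le> z" "z \<le> q" "D z \<omega> = 0" by blast
        have "X q \<omega> \<le> \<delta>" using elim[rule_format, of z q] z p0 qp qt by simp
        then show False using j(3) unfolding Xs_def q_def by simp
      qed
    qed
  qed
  have badm [measurable]: "Measurable.pred P (bad k)" for k
  proof -
    have "Measurable.pred P (\<lambda>\<omega>. \<exists>j\<in>{..<Suc k}. sgn (Ds (?r k (Suc j)) \<omega>) \<noteq> sgn (Ds (?r k j) \<omega>) \<and> \<delta> < Xs (?r k (Suc j)) \<omega>)"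
    proof (rule pred_intros_finite(4))
      fix j
      have [measurable]: "Ds (?r k (Suc j)) \<in> borel_measurable P" "Ds (?r k j) \<in> borel_measurable P" "Xs (?r k (Suc j)) \<in> borel_measurable P"
        by (intro G_to_P[OF Ds_meas] G_to_P[OF Xs_meas] nn)+
      show "Measurable.pred P (\<lambda>\<omega>. sgn (Ds (?r k (Suc j)) \<omega>) \<noteq> sgn (Ds (?r k j) \<omega>) \<and> \<delta> < Xs (?r k (Suc j)) \<omega>)"
        by measurable
    qed simp
    moreover have "bad k = (\<lambda>\<omega>. \<exists>j\<in>{..<Suc k}. sgn (Ds (?r k (Suc j)) \<omega>) \<noteq> sgn (Ds (?r k j) \<omega>) \<and> \<delta> < Xs (?r k (Suc j)) \<omega>)"
      unfolding bad_def[abs_def] by auto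
    ultimately show ?thesis by (rule ssubst[rotated])
  qed
  have bm: "(\<lambda>\<omega>. of_bool (bad k \<omega>) :: real) \<in> borel_measurable P" "(\<lambda>\<omega>. of_bool (\<not> bad k \<omega>) :: real) \<in> borel_measurable P" for k
    unfolding of_bool_def using badm[of k] pred_intros_logic(2)[OF badm[of k]] unfolding pred_def by (auto intro!: measurable_If)
  have l1: "(\<lambda>k. \<integral>\<omega>. of_bool (\<not> bad k \<omega>) * (sgn (Ds t \<omega>) * Ms t \<omega>) \<partial>P) \<longlonglongrightarrow> (\<integral>\<omega>. sgn (Ds t \<omega>) * Ms t \<omega> \<partial>P)"
  proof (rule integral_dominated_convergence[where w="\<lambda>\<omega>. \<bar>sgn (Ds t \<omega>) * Ms t \<omega>\<bar>"])
    show "AE \<omega> in P. (\<lambda>k. of_bool (\<not> bad k \<omega>) * (sgn (Ds t \<omega>) * Ms t \<omega>)) \<longlonglongrightarrow> sgn (Ds t \<omega>) * Ms t \<omega>"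
      using ev
    proof eventually_elim
      case (elim \<omega>)
      show ?case by (rule tendsto_eventually) (use elim in eventually_elim, simp)
    qed
    show "(\<lambda>\<omega>. of_bool (\<not> bad k \<omega>) * (sgn (Ds t \<omega>) * Ms t \<omega>)) \<in> borel_measurable P" for k
      by (rule borel_measurable_times[OF bm(2) borel_measurable_integrable[OF sM]])
  qed (use sM in auto)
  have l2: "(\<lambda>k. \<integral>\<omega>. of_bool (bad k \<omega>) * \<bar>Ms t \<omega>\<bar> \<partial>P) \<longlonglongrightarrow> (\<integral>\<omega>. 0 \<partial>P)"
  proof (rule integral_dominated_convergence[where w="\<lambda>\<omega>. \<bar>Ms t \<omega>\<bar>"])
    show "AE \<omega> in P. (\<lambda>k. of_bool (bad k \<omega>) * \<bar>Ms t \<omega>\<bar>) \<longlonglongrightarrow> 0"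
      using ev
    proof eventually_elim
      case (elim \<omega>)
      show ?case by (rule tendsto_eventually) (use elim in eventually_elim, simp)
    qed
    show "(\<lambda>\<omega>. of_bool (bad k \<omega>) * \<bar>Ms t \<omega>\<bar>) \<in> borel_measurable P" for k
      by (rule borel_measurable_times[OF bm(1) borel_measurable_abs[OF MsP]])
  qed (use Ms_integrable[OF t] in auto)
  have "(\<integral>\<omega>. sgn (Ds t \<omega>) * Ms t \<omega> \<partial>P) \<le> \<delta> * (\<integral>\<omega>. \<bar>Ds t \<omega>\<bar> \<partial>P) + (\<integral>\<omega>. 0 \<partial>P)"
    by (rule LIMSEQ_le[OF l1 tendsto_add[OF tendsto_const l2]]) (use est in blast)
  also have "\<dots> \<le> 0 + \<epsilon>"
    using \<epsilon> E by (simp add: \<delta>_def field_simps flip: E_def)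
  finally show "(\<integral>\<omega>. sgn (Ds t \<omega>) * Ms t \<omega> \<partial>P) \<le> 0 + \<epsilon>" .
qed

text \<open>
  On \<open>{A > 0}\<close> the expectation of \<open>sgn D * N D\<close> is \<open>0\<close>, by \<open>stopped_tail_identity\<close> at level \<open>0\<close>. On \<open>{A = 0}\<close> the
  variable is \<open>X * \<bar>D\<bar> \<ge> 0\<close>, so a nonpositive total expectation makes it vanish.
\<close>

lemma stopped_X_zero: "AE \<omega> in P. As t \<omega> = 0 \<longrightarrow> Xs t \<omega> = 0"
proof -
  have AsP [measurable]: "As t \<in> borel_measurable P" by (rule G_to_P[OF As_meas[OF t] t])
  have XsP [measurable]: "Xs t \<in> borel_measurable P" by (rule G_to_P[OF Xs_meas[OF t] t])
  have DsP [measurable]: "Ds t \<in> borel_measurable P" by (rule G_to_P[OF Ds_meas[OF t] t])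
  have MsP [measurable]: "Ms t \<in> borel_measurable P" by (rule G_to_P[OF Ms_meas[OF t] t])
  have sM: "integrable P (\<lambda>\<omega>. sgn (Ds t \<omega>) * Ms t \<omega>)"
    using measurable_compose[OF DsP borel_measurable_sgn] abs_sgn_le_1
    by (rule integrable_bounded_mult[OF Ms_integrable[OF t]])
  define c :: "'a \<Rightarrow> real" where "c \<omega> = of_bool (0 < As t \<omega>)" for \<omega>
  have cG: "c \<in> borel_measurable (G t)"
  proof -
    have "Measurable.pred (G t) (\<lambda>\<omega>. 0 < As t \<omega>)" using As_meas[OF t] by measurable
    then show ?thesis unfolding c_def[abs_def] of_bool_def pred_def by (intro measurable_If measurable_const) auto
  qed
  have cP [measurable]: "c \<in> borel_measurable P" by (rule G_to_P[OF cG t])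
  have c1: "\<bar>c \<omega>\<bar> \<le> 1" "0 \<le> c \<omega>" for \<omega> by (auto simp: c_def)
  have pos: "AE \<omega> in P. c \<omega> \<noteq> 0 \<longrightarrow> 0 < As t \<omega>" by (rule AE_I2) (simp add: c_def)
  note E = entry_identity[OF t order_refl cG c1 pos]
  have zero: "(\<integral>\<omega>. c \<omega> * sgn (Ds t \<omega>) * Ms t \<omega> \<partial>P) = 0"
  proof -
    note S = stopped_tail_identity[OF order_refl, folded c_def]
    have iX: "integrable P' (\<lambda>\<omega>. c \<omega> * Xs t \<omega>)" by (rule integrable_bounded_mult[OF S(2) _ c1(1)]) simp
    have "(\<integral>\<omega>. c \<omega> * (Xs t \<omega> - As t \<omega>) \<partial>P') = (\<integral>\<omega>. c \<omega> * Xs t \<omega> \<partial>P') - (\<integral>\<omega>. c \<omega> * As t \<omega> \<partial>P')"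
      by (subst Bochner_Integration.integral_diff[OF iX S(1), symmetric]) (simp add: right_diff_distrib)
    then have "(\<integral>\<omega>. c \<omega> * (Xs t \<omega> - As t \<omega>) \<partial>P') = 0" using S(3) by simp
    then have "(\<integral>\<omega>. c \<omega> * (Xs t \<omega> - As t \<omega>) * \<bar>D_inf \<omega>\<bar> \<partial>P) = 0"
      using D_norm_pos by (subst (asm) integral_P') auto
    then show ?thesis using E(2) by simp
  qed
  define h where "h \<omega> = (1 - c \<omega>) * (sgn (Ds t \<omega>) * Ms t \<omega>)" for \<omega>
  have hi: "integrable P h" unfolding h_def[abs_def]
    by (rule integrable_bounded_mult[OF sM]) (auto simp: c_def)
  have ci: "integrable P (\<lambda>\<omega>. c \<omega> * sgn (Ds t \<omega>) * Ms t \<omega>)"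
    using integrable_bounded_mult[OF sM cP c1(1)] by (simp add: mult.assoc)
  have "(\<integral>\<omega>. sgn (Ds t \<omega>) * Ms t \<omega> \<partial>P) = (\<integral>\<omega>. c \<omega> * sgn (Ds t \<omega>) * Ms t \<omega> + h \<omega> \<partial>P)"
    by (rule Bochner_Integration.integral_cong[OF refl]) (simp add: h_def algebra_simps)
  also have "\<dots> = (\<integral>\<omega>. h \<omega> \<partial>P)" using zero ci hi by simp
  finally have hle: "(\<integral>\<omega>. h \<omega> \<partial>P) \<le> 0" using signed_stopped_value_nonpos by simp
  have hval: "AE \<omega> in P. h \<omega> = of_bool (As t \<omega> = 0) * Xs t \<omega> * \<bar>Ds t \<omega>\<bar> \<and> 0 \<le> h \<omega>"
    using Ms_decomp
  proof eventually_elim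
    case (elim \<omega>)
    have m: "Ms t \<omega> = (Xs t \<omega> - As t \<omega>) * Ds t \<omega>" "0 \<le> As t \<omega>" "0 \<le> Xs t \<omega>" using elim t by blast+
    have s: "sgn (Ds t \<omega>) * (y * Ds t \<omega>) = y * \<bar>Ds t \<omega>\<bar>" for y by (simp add: sgn_real_def)
    have "h \<omega> = of_bool (As t \<omega> = 0) * Xs t \<omega> * \<bar>Ds t \<omega>\<bar>"
    proof (cases "As t \<omega> = 0")
      case True
      then show ?thesis unfolding h_def m(1) s by (simp add: c_def)
    next
      case False
      then have "c \<omega> = 1" using m(2) by (simp add: c_def)
      then show ?thesis using False by (simp add: h_def)
    qed
    then show ?case using m(3) by simp
  qed
  then have "AE \<omega> in P. 0 \<le> h \<omega>" by eventually_elim simp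
  moreover from this have "(\<integral>\<omega>. h \<omega> \<partial>P) = 0" using hle integral_nonneg_AE by (metis order_antisym)
  ultimately have "AE \<omega> in P. h \<omega> = 0" using integral_nonneg_eq_0_iff_AE[OF hi] by blast
  then show ?thesis using hval X_zero_of_D_zero AE_space
  proof eventually_elim
    case (elim \<omega>)
    show ?case
    proof
      assume "As t \<omega> = 0"
      then have "Xs t \<omega> = 0 \<or> Ds t \<omega> = 0" using elim(1,2) by simp
      then show "Xs t \<omega> = 0" using elim(3) stop_nonneg[OF elim(4) t] unfolding Xs_def Ds_def by blast
    qed
  qed
qed

text \<open>
  The identity at level \<open>0\<close> bounds the expectation of \<open>A\<close> by that of \<open>X\<close>, and \<open>\<bar>N D\<bar> \<le> (X + A) \<bar>D\<bar>\<close> with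
  \<open>\<bar>D\<bar>\<close> at most the conditional expectation of \<open>\<bar>D_inf\<bar>\<close>.
\<close>

lemma stopped_martingale_L1_bound:
  assumes K: "\<And>R. finite_stopping_time P F R \<Longrightarrow> (\<integral>\<omega>. \<bar>X (R \<omega>) \<omega>\<bar> \<partial>P') \<le> K"
  shows "(\<integral>\<omega>. \<bar>Ms t \<omega>\<bar> \<partial>P) \<le> D_norm * (2 * K)" "(\<integral>\<omega>. As t \<omega> \<partial>P') \<le> K" "integrable P' (As t)"
proof -
  have AsP [measurable]: "As t \<in> borel_measurable P" by (rule G_to_P[OF As_meas[OF t] t])
  have XsP [measurable]: "Xs t \<in> borel_measurable P" by (rule G_to_P[OF Xs_meas[OF t] t])
  have DsP [measurable]: "Ds t \<in> borel_measurable P" by (rule G_to_P[OF Ds_meas[OF t] t])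
  note S = stopped_tail_identity[OF order_refl]
  have "AE \<omega> in P. 0 \<le> Xs t \<omega> \<and> 0 \<le> As t \<omega>"
    using Ms_decomp
  proof eventually_elim
    case (elim \<omega>)
    then show ?case using t by blast
  qed
  then have nnP: "AE \<omega> in P'. 0 \<le> Xs t \<omega> \<and> 0 \<le> As t \<omega>" by (rule AE_P'I)
  have nnA: "AE \<omega> in P'. of_bool (0 < As t \<omega>) * As t \<omega> = As t \<omega>"
    using nnP by eventually_elim (auto simp: order_le_less)
  show Ai: "integrable P' (As t)"
    by (rule integrable_cong_AE_imp[OF S(1) _ nnA]) simp
  have nnX: "AE \<omega> in P'. 0 \<le> Xs t \<omega>" "AE \<omega> in P'. 0 \<le> As t \<omega>"
    using nnP by (eventually_elim, simp)+
  have "(\<integral>\<omega>. As t \<omega> \<partial>P') = (\<integral>\<omega>. of_bool (0 < As t \<omega>) * (As t \<omega> - 0) \<partial>P')"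
  proof (rule integral_cong_AE)
    show "(\<lambda>\<omega>. of_bool (0 < As t \<omega>) * (As t \<omega> - 0)) \<in> borel_measurable P'"
      using borel_measurable_integrable[OF S(1)] by simp
    show "AE \<omega> in P'. As t \<omega> = of_bool (0 < As t \<omega>) * (As t \<omega> - 0)" using nnA by eventually_elim simp
  qed simp
  also have "\<dots> = (\<integral>\<omega>. of_bool (0 < As t \<omega>) * Xs t \<omega> \<partial>P')" using S(3) by simp
  also have "\<dots> \<le> (\<integral>\<omega>. \<bar>Xs t \<omega>\<bar> \<partial>P')"
  proof (rule integral_mono)
    show "integrable P' (\<lambda>\<omega>. of_bool (0 < As t \<omega>) * Xs t \<omega>)"
      by (rule integrable_bounded_mult[OF S(2)]) (simp_all add: of_bool_def)
    show "of_bool (0 < As t \<omega>) * Xs t \<omega> \<le> \<bar>Xs t \<omega>\<bar>" for \<omega> by (auto simp: of_bool_def)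
  qed (use S(2) in simp)
  also have XK: "(\<integral>\<omega>. \<bar>Xs t \<omega>\<bar> \<partial>P') \<le> K" unfolding Xs_def by (rule K[OF stop_stopping[OF t]])
  finally show AK: "(\<integral>\<omega>. As t \<omega> \<partial>P') \<le> K" .
  define w where "w \<omega> = \<bar>Xs t \<omega> - As t \<omega>\<bar>" for \<omega>
  have wG: "w \<in> borel_measurable (G t)" unfolding w_def[abs_def]
    by (intro borel_measurable_abs borel_measurable_diff Xs_meas As_meas t)
  have wP [measurable]: "w \<in> borel_measurable P" by (rule G_to_P[OF wG t])
  have wi: "integrable P' w" unfolding w_def[abs_def] using S(2) Ai by (intro integrable_abs Bochner_Integration.integrable_diff)
  have "(\<integral>\<omega>. w \<omega> \<partial>P') \<le> (\<integral>\<omega>. \<bar>Xs t \<omega>\<bar> + As t \<omega> \<partial>P')"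
    by (rule integral_mono_AE[OF wi]) (use S(2) Ai nnX(2) in \<open>auto simp: w_def elim!: eventually_mono\<close>)
  also have "\<dots> = (\<integral>\<omega>. \<bar>Xs t \<omega>\<bar> \<partial>P') + (\<integral>\<omega>. As t \<omega> \<partial>P')" using S(2) Ai by simp
  finally have w2K: "(\<integral>\<omega>. w \<omega> \<partial>P') \<le> 2 * K" using XK AK by simp
  have wD: "integrable P (\<lambda>\<omega>. w \<omega> * \<bar>D_inf \<omega>\<bar>)" using wi by (subst (asm) integrable_P'_iff) auto
  have "(\<integral>\<omega>. w \<omega> * \<bar>D_inf \<omega>\<bar> \<partial>P) = D_norm * (\<integral>\<omega>. w \<omega> \<partial>P')"
    using D_norm_pos by (subst integral_P') auto
  then have wDK: "(\<integral>\<omega>. w \<omega> * \<bar>D_inf \<omega>\<bar> \<partial>P) \<le> D_norm * (2 * K)"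
    using w2K D_norm_pos by (simp add: mult_left_mono)
  have "ennreal (\<integral>\<omega>. \<bar>Ms t \<omega>\<bar> \<partial>P) = (\<integral>\<^sup>+ \<omega>. ennreal \<bar>Ms t \<omega>\<bar> \<partial>P)"
    by (rule nn_integral_eq_integral[symmetric]) (use Ms_integrable[OF t] in auto)
  also have "\<dots> = (\<integral>\<^sup>+ \<omega>. ennreal (w \<omega>) * ennreal \<bar>Ds t \<omega>\<bar> \<partial>P)"
  proof (rule nn_integral_cong_AE, use Ms_decomp in eventually_elim)
    fix \<omega> assume "\<forall>r\<ge>0. Ms r \<omega> = (Xs r \<omega> - As r \<omega>) * Ds r \<omega> \<and> 0 \<le> As r \<omega> \<and> 0 \<le> Xs r \<omega>"
    then have "Ms t \<omega> = (Xs t \<omega> - As t \<omega>) * Ds t \<omega>" using t by blast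
    then show "ennreal \<bar>Ms t \<omega>\<bar> = ennreal (w \<omega>) * ennreal \<bar>Ds t \<omega>\<bar>"
      by (simp add: w_def abs_mult ennreal_mult)
  qed
  also have "\<dots> \<le> (\<integral>\<^sup>+ \<omega>. ennreal (w \<omega>) * ennreal \<bar>D_inf \<omega>\<bar> \<partial>P)"
  proof (rule averaging_abs_le[OF prob_space_axioms subalgebra_pre_sigma[OF stop_stopping[OF t]] D_inf_integrable Ds_meas[OF t] Ds_integrable[OF t]])
    show "(LINT \<omega>:B|P. D_inf \<omega>) = (LINT \<omega>:B|P. Ds t \<omega>)" if "B \<in> sets (G t)" for B
      unfolding Ds_def by (rule optional_stopping_D(2)[OF stop_stopping[OF t] stop_le that])
    show "(\<lambda>\<omega>. ennreal (w \<omega>)) \<in> borel_measurable (G t)" using wG by measurable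
  qed
  also have "\<dots> = (\<integral>\<^sup>+ \<omega>. ennreal (w \<omega> * \<bar>D_inf \<omega>\<bar>) \<partial>P)"
    by (rule nn_integral_cong) (simp add: w_def ennreal_mult)
  also have "\<dots> = ennreal (\<integral>\<omega>. w \<omega> * \<bar>D_inf \<omega>\<bar> \<partial>P)"
    by (rule nn_integral_eq_integral[OF wD]) (simp add: w_def)
  finally have "(\<integral>\<omega>. \<bar>Ms t \<omega>\<bar> \<partial>P) \<le> (\<integral>\<omega>. w \<omega> * \<bar>D_inf \<omega>\<bar> \<partial>P)"
    by (subst (asm) ennreal_le_iff) (auto intro!: integral_nonneg_AE simp: w_def)
  then show "(\<integral>\<omega>. \<bar>Ms t \<omega>\<bar> \<partial>P) \<le> D_norm * (2 * K)" using wDK by simp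
qed

end

section \<open>Identities at infinity\<close>

lemma localising_sequence:
  obtains T :: "nat \<Rightarrow> 'a \<Rightarrow> real" where "\<And>n. localises (T n)"
    "AE \<omega> in P. filterlim (\<lambda>n. T n \<omega>) at_top sequentially"
    "\<And>n. finite_stopping_time P F (stop (T n) (real n))"
    "AE \<omega> in P. filterlim (\<lambda>n. stop (T n) (real n) \<omega>) at_top sequentially"
proof -
  have "local_martingale P F (\<lambda>t \<omega>. N t \<omega> * D t \<omega>)"
    using class_Sigma by (simp add: class_Sigma_H_def QP_local_martingale_def)
  then obtain T :: "nat \<Rightarrow> 'a \<Rightarrow> real" where T: "\<forall>n. localises (T n)"
    "AE \<omega> in P. incseq (\<lambda>n. T n \<omega>) \<and> filterlim (\<lambda>n. T n \<omega>) at_top sequentially"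
    unfolding local_martingale_def localises_def by blast
  have lim: "AE \<omega> in P. filterlim (\<lambda>n. T n \<omega>) at_top sequentially" using T(2) by eventually_elim simp
  then have "AE \<omega> in P. filterlim (\<lambda>n. stop (T n) (real n) \<omega>) at_top sequentially"
  proof eventually_elim
    case (elim \<omega>)
    show ?case using elim filterlim_real_sequentially
      unfolding filterlim_at_top stop_def[OF T(1)[rule_format] order_refl] by (simp add: eventually_conj_iff)
  qed
  moreover have "finite_stopping_time P F (stop (T n) (real n))" for n
    by (rule stop_stopping[OF T(1)[rule_format] order_refl]) simp
  ultimately show thesis using that T(1) lim by blast
qed

lemma X_zero_while_A_zero: "AE \<omega> in P. \<forall>m::nat. A (real m) \<omega> = 0 \<longrightarrow> X (real m) \<omega> = 0"
proof -
  obtain T :: "nat \<Rightarrow> 'a \<Rightarrow> real" where T: "\<And>n. localises (T n)"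
    "AE \<omega> in P. filterlim (\<lambda>n. T n \<omega>) at_top sequentially"
    "\<And>n. finite_stopping_time P F (stop (T n) (real n))"
    "AE \<omega> in P. filterlim (\<lambda>n. stop (T n) (real n) \<omega>) at_top sequentially"
    by (rule localising_sequence) blast
  have "AE \<omega> in P. As (T n) (real m) \<omega> = 0 \<longrightarrow> Xs (T n) (real m) \<omega> = 0" for n m :: nat
    by (rule stopped_X_zero[OF T(1)]) simp
  then have "AE \<omega> in P. \<forall>n m :: nat. As (T n) (real m) \<omega> = 0 \<longrightarrow> Xs (T n) (real m) \<omega> = 0"
    by (simp add: AE_all_countable)
  then show ?thesis using T(2)
  proof eventually_elim
    case (elim \<omega>)
    show ?case
    proof (intro allI impI)
      fix m :: nat assume A0: "A (real m) \<omega> = 0"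
      have "\<forall>\<^sub>F n in sequentially. real m \<le> T n \<omega>" using elim(2) by (simp add: filterlim_at_top)
      then obtain n where "real m \<le> T n \<omega>" using eventually_happens by (metis trivial_limit_sequentially)
      then have s: "stop (T n) (real m) \<omega> = real m" unfolding stop_def[OF T(1) order_refl] by simp
      have "As (T n) (real m) \<omega> = 0 \<longrightarrow> Xs (T n) (real m) \<omega> = 0" using elim(1) by blast
      then show "X (real m) \<omega> = 0"
        unfolding As_def[OF T(1) order_refl] Xs_def[OF T(1) order_refl] s using A0 by simp
    qed
  qed
qed

text \<open>
  \<open>N D\<close> converges because it is bounded in \<open>L1\<close>, and \<open>D\<close> tends to \<open>D_inf\<close>, which is nonzero under \<open>P'\<close>; so
  \<open>N\<close> converges. For \<open>A\<close>, Fatou's lemma along the localising times bounds the monotone path.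
\<close>

lemma terminal_limits: "AE \<omega> in P'. ((\<lambda>t. X t \<omega>) \<longlongrightarrow> terminal X \<omega>) at_top \<and> ((\<lambda>t. A t \<omega>) \<longlongrightarrow> terminal A \<omega>) at_top"
  and terminal_A_integrable: "integrable P' (terminal A)"
proof -
  interpret P': prob_space P' by (rule prob_space_P')
  obtain T :: "nat \<Rightarrow> 'a \<Rightarrow> real" where T: "\<And>n. localises (T n)"
    "AE \<omega> in P. filterlim (\<lambda>n. T n \<omega>) at_top sequentially"
    "\<And>n. finite_stopping_time P F (stop (T n) (real n))"
    "AE \<omega> in P. filterlim (\<lambda>n. stop (T n) (real n) \<omega>) at_top sequentially"
    by (rule localising_sequence) blast
  obtain K where K: "0 \<le> K" "\<And>R. finite_stopping_time P F R \<Longrightarrow> (\<integral>\<omega>. \<bar>X (R \<omega>) \<omega>\<bar> \<partial>P') \<le> K"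
    by (rule X_L1_bounded) blast
  have conv_M: "AE \<omega> in P. \<exists>l. ((\<lambda>t. N t \<omega> * D t \<omega> - N 0 \<omega> * D 0 \<omega>) \<longlongrightarrow> l) at_top"
  proof (rule bounded_local_martingale_converges[OF _ T(2) T_martingale[OF T(1) order_refl]])
    show "right_continuous_paths (\<lambda>t \<omega>. N t \<omega> * D t \<omega> - N 0 \<omega> * D 0 \<omega>)"
      using right_continuous_N right_continuous_D
    proof eventually_elim
      case (elim \<omega>)
      show ?case using elim by (intro allI impI continuous_diff continuous_mult continuous_const) blast+
    qed
    fix n and t :: real assume t: "0 \<le> t"
    note M = Ms_meas[OF T(1) t t, of n] Ms_integrable[OF T(1) t t, of n]
    have i: "integrable P (\<lambda>\<omega>. N (min t (T n \<omega>)) \<omega> * D (min t (T n \<omega>)) \<omega> - N 0 \<omega> * D 0 \<omega>)"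
      using T_martingale[OF T(1) order_refl, of n] t by (simp add: martingale_def)
    have "(\<integral>\<omega>. \<bar>N (min t (T n \<omega>)) \<omega> * D (min t (T n \<omega>)) \<omega> - N 0 \<omega> * D 0 \<omega>\<bar> \<partial>P) = (\<integral>\<omega>. \<bar>Ms (T n) t \<omega>\<bar> \<partial>P)"
    proof (rule integral_cong_AE)
      show "AE \<omega> in P. \<bar>N (min t (T n \<omega>)) \<omega> * D (min t (T n \<omega>)) \<omega> - N 0 \<omega> * D 0 \<omega>\<bar> = \<bar>Ms (T n) t \<omega>\<bar>"
        using Ms_eq[OF T(1) t, of t n] by eventually_elim simp
    qed (use borel_measurable_integrable[OF i] borel_measurable_integrable[OF M(2)] in \<open>auto intro: borel_measurable_abs\<close>)
    also have "\<dots> \<le> D_norm * (2 * K)" by (rule stopped_martingale_L1_bound(1)[OF T(1) t K(2)])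
    finally show "(\<integral>\<omega>. \<bar>N (min t (T n \<omega>)) \<omega> * D (min t (T n \<omega>)) \<omega> - N 0 \<omega> * D 0 \<omega>\<bar> \<partial>P) \<le> D_norm * (2 * K)" .
  qed
  define S where "S n = stop (T n) (real n)" for n
  note S = T(3)[folded S_def] and Slim = T(4)[folded S_def]
  have Am [measurable]: "(\<lambda>\<omega>. A (S n \<omega>) \<omega>) \<in> borel_measurable P" for n by (rule A_measurable[OF S])
  have AK: "(\<integral>\<^sup>+ \<omega>. ennreal (A (S n \<omega>) \<omega>) \<partial>P') \<le> ennreal K" for n
  proof -
    note B = stopped_martingale_L1_bound[OF T(1) _ K(2), of "real n" n]
    have eq: "As (T n) (real n) = (\<lambda>\<omega>. A (S n \<omega>) \<omega>)"
      by (rule ext) (simp add: As_def[OF T(1) order_refl] S_def)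
    have "AE \<omega> in P'. 0 \<le> A (S n \<omega>) \<omega>"
    proof (rule AE_P'I, use A_nonneg AE_space in eventually_elim)
      fix \<omega> assume "\<forall>t\<ge>0. 0 \<le> A t \<omega>" "\<omega> \<in> space P"
      then show "0 \<le> A (S n \<omega>) \<omega>" using stopping_nonneg[OF S] by blast
    qed
    then have "(\<integral>\<^sup>+ \<omega>. ennreal (A (S n \<omega>) \<omega>) \<partial>P') = ennreal (\<integral>\<omega>. A (S n \<omega>) \<omega> \<partial>P')"
      using B(3) unfolding eq by (intro nn_integral_eq_integral) auto
    also have "\<dots> \<le> ennreal K" using B(2) unfolding eq by (intro ennreal_leI) simp
    finally show ?thesis .
  qed
  have liminf_le: "(\<integral>\<^sup>+ \<omega>. liminf (\<lambda>n. ennreal (A (S n \<omega>) \<omega>)) \<partial>P') \<le> ennreal K"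
  proof -
    have "(\<integral>\<^sup>+ \<omega>. liminf (\<lambda>n. ennreal (A (S n \<omega>) \<omega>)) \<partial>P') \<le> liminf (\<lambda>n. \<integral>\<^sup>+ \<omega>. ennreal (A (S n \<omega>) \<omega>) \<partial>P')"
      by (intro nn_integral_liminf) simp
    also have "\<dots> \<le> liminf (\<lambda>n. ennreal K)" by (intro Liminf_mono always_eventually allI AK)
    finally show ?thesis by (simp add: Liminf_const)
  qed
  have fin: "AE \<omega> in P'. liminf (\<lambda>n. ennreal (A (S n \<omega>) \<omega>)) \<noteq> \<infinity>"
  proof (rule nn_integral_noteq_infinite)
    show "(\<integral>\<^sup>+ \<omega>. liminf (\<lambda>n. ennreal (A (S n \<omega>) \<omega>)) \<partial>P') \<noteq> \<infinity>"
      using liminf_le by (auto simp: top_unique)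
  qed simp
  have limA: "AE \<omega> in P'. ((\<lambda>t. A t \<omega>) \<longlongrightarrow> terminal A \<omega>) at_top"
    using fin AE_P'I[OF A_mono] AE_P'I[OF A_nonneg] AE_P'I[OF Slim]
  proof eventually_elim
    case (elim \<omega>)
    define L where "L = liminf (\<lambda>n. ennreal (A (S n \<omega>) \<omega>))"
    have "A t \<omega> \<le> enn2real L" if t: "0 \<le> t" for t
    proof -
      have "\<forall>\<^sub>F n in sequentially. t \<le> S n \<omega>" using elim(4) by (simp add: filterlim_at_top)
      then have "\<forall>\<^sub>F n in sequentially. ennreal (A t \<omega>) \<le> ennreal (A (S n \<omega>) \<omega>)"
      proof eventually_elim
        case (elim n)
        then show ?case using \<open>\<forall>s t. 0 \<le> s \<longrightarrow> s \<le> t \<longrightarrow> A s \<omega> \<le> A t \<omega>\<close> t by (intro ennreal_leI) blast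
      qed
      then have "ennreal (A t \<omega>) \<le> L" unfolding L_def by (rule Liminf_bounded)
      moreover have "L < top" using elim(1) unfolding L_def by (simp add: less_top)
      ultimately have "enn2real (ennreal (A t \<omega>)) \<le> enn2real L" by (rule enn2real_mono)
      then show ?thesis using elim(3) t by simp
    qed
    then obtain l where "((\<lambda>t. A t \<omega>) \<longlongrightarrow> l) at_top"
      using bounded_mono_converges[of "\<lambda>t. A t \<omega>" "enn2real L"] elim(2) by blast
    then show ?case using terminal_eqI by metis
  qed
  have Zm [measurable]: "terminal A \<in> borel_measurable P" by (rule terminal_measurable[OF adapted_A right_continuous_A])
  have Z: "AE \<omega> in P'. liminf (\<lambda>n. ennreal (A (S n \<omega>) \<omega>)) = ennreal (terminal A \<omega>) \<and> 0 \<le> terminal A \<omega>"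
    using limA AE_P'I[OF A_nonneg] AE_P'I[OF Slim]
  proof eventually_elim
    case (elim \<omega>)
    have l: "(\<lambda>n. A (S n \<omega>) \<omega>) \<longlonglongrightarrow> terminal A \<omega>" using filterlim_compose[OF elim(1,3)] .
    have "liminf (\<lambda>n. ennreal (A (S n \<omega>) \<omega>)) = ennreal (terminal A \<omega>)"
      by (rule lim_imp_Liminf) (simp_all add: tendsto_ennrealI[OF l])
    moreover have "\<forall>\<^sub>F t in at_top. 0 \<le> A t \<omega>" using eventually_ge_at_top[of 0] by eventually_elim (use elim(2) in simp)
    then have "0 \<le> terminal A \<omega>" by (rule tendsto_lowerbound[OF elim(1)]) simp
    ultimately show ?case by simp
  qed
  show "integrable P' (terminal A)"
  proof (rule integrableI_bounded)
    have "(\<integral>\<^sup>+ \<omega>. ennreal (norm (terminal A \<omega>)) \<partial>P') = (\<integral>\<^sup>+ \<omega>. liminf (\<lambda>n. ennreal (A (S n \<omega>) \<omega>)) \<partial>P')"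
      by (rule nn_integral_cong_AE, use Z in eventually_elim) simp
    then show "(\<integral>\<^sup>+ \<omega>. ennreal (norm (terminal A \<omega>)) \<partial>P') < \<infinity>"
      using le_less_trans[OF liminf_le, of top] by simp
  qed simp
  have Dnz: "AE \<omega> in P'. D_inf \<omega> \<noteq> 0" unfolding AE_P'_iff by simp
  show "AE \<omega> in P'. ((\<lambda>t. X t \<omega>) \<longlongrightarrow> terminal X \<omega>) at_top \<and> ((\<lambda>t. A t \<omega>) \<longlongrightarrow> terminal A \<omega>) at_top"
    using limA Dnz AE_P'I[OF conv_M] AE_P'I[OF D_tendsto_D_inf] AE_P'I[OF X_decomp]
  proof eventually_elim
    case (elim \<omega>)
    obtain l where l: "((\<lambda>t. N t \<omega> * D t \<omega> - N 0 \<omega> * D 0 \<omega>) \<longlongrightarrow> l) at_top" using elim(3) by blast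
    have "((\<lambda>t. (N t \<omega> * D t \<omega> - N 0 \<omega> * D 0 \<omega> + N 0 \<omega> * D 0 \<omega>) / D t \<omega> + A t \<omega>)
        \<longlongrightarrow> (l + N 0 \<omega> * D 0 \<omega>) / D_inf \<omega> + terminal A \<omega>) at_top"
      by (intro tendsto_add tendsto_divide l elim(1,4) tendsto_const elim(2))
    moreover have "\<forall>\<^sub>F t in at_top. (N t \<omega> * D t \<omega> - N 0 \<omega> * D 0 \<omega> + N 0 \<omega> * D 0 \<omega>) / D t \<omega> + A t \<omega> = X t \<omega>"
      using tendsto_imp_eventually_ne[OF elim(4,2)] eventually_ge_at_top[of 0]
      by eventually_elim (use elim(5) in simp)
    ultimately have "((\<lambda>t. X t \<omega>) \<longlongrightarrow> (l + N 0 \<omega> * D 0 \<omega>) / D_inf \<omega> + terminal A \<omega>) at_top"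
      by (rule Lim_transform_eventually)
    then show ?case using elim(1) terminal_eqI by metis
  qed
qed

lemma terminal_nonneg: "AE \<omega> in P'. 0 \<le> terminal X \<omega> \<and> 0 \<le> terminal A \<omega>"
  using terminal_limits AE_P'I[OF X_nonneg] AE_P'I[OF A_nonneg]
proof eventually_elim
  case (elim \<omega>)
  have "\<forall>\<^sub>F t in at_top. 0 \<le> X t \<omega>" using eventually_ge_at_top[of 0] by eventually_elim (use elim(2) in simp)
  moreover have "\<forall>\<^sub>F t in at_top. 0 \<le> A t \<omega>" using eventually_ge_at_top[of 0] by eventually_elim (use elim(3) in simp)
  ultimately show ?case using elim(1) tendsto_lowerbound trivial_limit_at_top_linorder by metis
qed

lemma terminal_X_zero: "AE \<omega> in P'. terminal A \<omega> \<le> 0 \<longrightarrow> terminal X \<omega> = 0"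
  using terminal_limits AE_P'I[OF A_mono] AE_P'I[OF A_nonneg] AE_P'I[OF X_zero_while_A_zero]
proof eventually_elim
  case (elim \<omega>)
  show ?case
  proof
    assume le: "terminal A \<omega> \<le> 0"
    have "A (real m) \<omega> = 0" for m :: nat
    proof -
      have "\<forall>\<^sub>F t in at_top. A (real m) \<omega> \<le> A t \<omega>"
        using eventually_ge_at_top[of "real m"] by eventually_elim (use elim(2) in simp)
      then have "A (real m) \<omega> \<le> terminal A \<omega>" by (rule tendsto_lowerbound[OF conjunct2[OF elim(1)]]) simp
      moreover have "0 \<le> A (real m) \<omega>" using elim(3) by simp
      ultimately show ?thesis using le by linarith
    qed
    then have "X (real m) \<omega> = 0" for m :: nat using elim(4) by blast
    moreover have "(\<lambda>m. X (real m) \<omega>) \<longlonglongrightarrow> terminal X \<omega>"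
      using filterlim_compose[OF conjunct1[OF elim(1)] filterlim_real_sequentially] .
    ultimately show "terminal X \<omega> = 0" by (simp add: LIMSEQ_const_iff)
  qed
qed

text \<open>
  \<open>stopped_tail_identity\<close> in the limit along the times \<open>min (T n) n\<close>: the left-hand side converges by class (D),
  the right-hand side by domination with \<open>A_inf\<close>. On \<open>{A_inf \<le> u}\<close> the approximating indicators vanish, as
  \<open>A\<close> stays below its limit; so the boundary \<open>A_inf = u\<close> causes no harm.
\<close>

lemma terminal_tail_identity:
  shows "integrable P' (terminal X)"
    and "0 \<le> u \<Longrightarrow> (\<integral>\<omega>. indicator {\<omega>. u < terminal A \<omega>} \<omega> * terminal X \<omega> \<partial>P') = (\<integral>\<omega>. max 0 (terminal A \<omega> - u) \<partial>P')"
proof -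
  interpret P': prob_space P' by (rule prob_space_P')
  obtain T :: "nat \<Rightarrow> 'a \<Rightarrow> real" where T: "\<And>n. localises (T n)"
    "AE \<omega> in P. filterlim (\<lambda>n. T n \<omega>) at_top sequentially"
    "\<And>n. finite_stopping_time P F (stop (T n) (real n))"
    "AE \<omega> in P. filterlim (\<lambda>n. stop (T n) (real n) \<omega>) at_top sequentially"
    by (rule localising_sequence) blast
  define S where "S n = stop (T n) (real n)" for n
  note S = T(3)[folded S_def] and Slim = T(4)[folded S_def]
  have Am [measurable]: "(\<lambda>\<omega>. A (S n \<omega>) \<omega>) \<in> borel_measurable P" for n by (rule A_measurable[OF S])
  have Xm [measurable]: "(\<lambda>\<omega>. X (S n \<omega>) \<omega>) \<in> borel_measurable P" for n by (rule X_measurable[OF S])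
  have Zm [measurable]: "terminal A \<in> borel_measurable P" by (rule terminal_measurable[OF adapted_A right_continuous_A])
  have Ym [measurable]: "terminal X \<in> borel_measurable P" by (rule terminal_measurable[OF adapted_X right_continuous_X])
  have lims: "AE \<omega> in P'. (\<lambda>n. X (S n \<omega>) \<omega>) \<longlonglongrightarrow> terminal X \<omega> \<and> (\<lambda>n. A (S n \<omega>) \<omega>) \<longlonglongrightarrow> terminal A \<omega>
      \<and> (\<forall>n. 0 \<le> A (S n \<omega>) \<omega> \<and> A (S n \<omega>) \<omega> \<le> terminal A \<omega>)"
    using terminal_limits AE_P'I[OF Slim] AE_P'I[OF A_mono] AE_P'I[OF A_nonneg] AE_space
  proof eventually_elim
    case (elim \<omega>)
    have S0: "0 \<le> S n \<omega>" for n using stopping_nonneg[OF S] elim(5) by simp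
    have "A (S n \<omega>) \<omega> \<le> terminal A \<omega>" for n
    proof (rule tendsto_lowerbound[OF conjunct2[OF elim(1)]])
      show "\<forall>\<^sub>F t in at_top. A (S n \<omega>) \<omega> \<le> A t \<omega>"
        using eventually_ge_at_top[of "S n \<omega>"] by eventually_elim (use elim(3) S0[of n] in simp)
    qed simp
    then show ?case
      using filterlim_compose[OF conjunct1[OF elim(1)] elim(2)] filterlim_compose[OF conjunct2[OF elim(1)] elim(2)] elim(4) S0
      by blast
  qed
  have ui: "\<exists>K. \<forall>n. (\<integral>\<^sup>+ \<omega>. ennreal \<bar>X (S n \<omega>) \<omega>\<bar> * indicator {\<omega>. K < \<bar>X (S n \<omega>) \<omega>\<bar>} \<omega> \<partial>P') \<le> ennreal e"
    if "0 < e" for e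
    using X_uniformly_integrable[OF that] S by meson
  have fm: "finite_measure P'" by unfold_locales
  show "integrable P' (terminal X)"
  proof (rule vitali_convergence(2)[OF fm _ _ _ ui])
    show "AE \<omega> in P'. (\<lambda>n. X (S n \<omega>) \<omega>) \<longlonglongrightarrow> terminal X \<omega>" using lims by eventually_elim simp
  qed simp_all
  assume u: "0 \<le> u"
  define b :: "nat \<Rightarrow> 'a \<Rightarrow> real" where "b n \<omega> = of_bool (u < A (S n \<omega>) \<omega>)" for n \<omega>
  define B :: "'a \<Rightarrow> real" where "B \<omega> = of_bool (u < terminal A \<omega>)" for \<omega>
  have [measurable]: "b n \<in> borel_measurable P" for n unfolding b_def[abs_def] of_bool_def by measurable
  have [measurable]: "B \<in> borel_measurable P" unfolding B_def[abs_def] of_bool_def by measurable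
  have bB: "(\<lambda>n. b n \<omega> * X (S n \<omega>) \<omega>) \<longlonglongrightarrow> B \<omega> * terminal X \<omega>"
    if "(\<lambda>n. X (S n \<omega>) \<omega>) \<longlonglongrightarrow> terminal X \<omega> \<and> (\<lambda>n. A (S n \<omega>) \<omega>) \<longlonglongrightarrow> terminal A \<omega>
      \<and> (\<forall>n. 0 \<le> A (S n \<omega>) \<omega> \<and> A (S n \<omega>) \<omega> \<le> terminal A \<omega>)" for \<omega>
  proof (cases "u < terminal A \<omega>")
    case True
    have "(\<lambda>n. A (S n \<omega>) \<omega>) \<longlonglongrightarrow> terminal A \<omega>" using that by blast
    from order_tendstoD(1)[OF this True] have "\<forall>\<^sub>F n in sequentially. X (S n \<omega>) \<omega> = b n \<omega> * X (S n \<omega>) \<omega>"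
      by eventually_elim (simp add: b_def)
    moreover have "(\<lambda>n. X (S n \<omega>) \<omega>) \<longlonglongrightarrow> terminal X \<omega>" using that by blast
    ultimately have "(\<lambda>n. b n \<omega> * X (S n \<omega>) \<omega>) \<longlonglongrightarrow> terminal X \<omega>" by (rule Lim_transform_eventually[rotated])
    then show ?thesis using True by (simp add: B_def)
  next
    case False
    have "A (S n \<omega>) \<omega> \<le> terminal A \<omega>" for n using that by blast
    then have "\<not> u < A (S n \<omega>) \<omega>" for n using False by (meson less_le_trans)
    then show ?thesis using False by (simp add: B_def b_def)
  qed
  have L1: "(\<lambda>n. \<integral>\<omega>. b n \<omega> * X (S n \<omega>) \<omega> \<partial>P') \<longlonglongrightarrow> (\<integral>\<omega>. B \<omega> * terminal X \<omega> \<partial>P')"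
  proof (rule vitali_convergence_dominated(2)[OF fm _ _ _ _ ui])
    show "AE \<omega> in P'. (\<lambda>n. b n \<omega> * X (S n \<omega>) \<omega>) \<longlonglongrightarrow> B \<omega> * terminal X \<omega>"
      using lims by eventually_elim (rule bB)
  qed (simp_all add: b_def)
  have L2: "(\<lambda>n. \<integral>\<omega>. max 0 (A (S n \<omega>) \<omega> - u) \<partial>P') \<longlonglongrightarrow> (\<integral>\<omega>. max 0 (terminal A \<omega> - u) \<partial>P')"
  proof (rule integral_dominated_convergence[where w="terminal A"])
    show "AE \<omega> in P'. (\<lambda>n. max 0 (A (S n \<omega>) \<omega> - u)) \<longlonglongrightarrow> max 0 (terminal A \<omega> - u)"
      using lims by eventually_elim (intro tendsto_max tendsto_diff tendsto_const, blast)
    show "AE \<omega> in P'. norm (max 0 (A (S n \<omega>) \<omega> - u)) \<le> terminal A \<omega>" for n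
      using lims
    proof eventually_elim
      case (elim \<omega>)
      then have "0 \<le> A (S n \<omega>) \<omega>" "A (S n \<omega>) \<omega> \<le> terminal A \<omega>" by blast+
      then show ?case using u by simp
    qed
  qed (simp_all add: terminal_A_integrable)
  have eq: "(\<integral>\<omega>. b n \<omega> * X (S n \<omega>) \<omega> \<partial>P') = (\<integral>\<omega>. max 0 (A (S n \<omega>) \<omega> - u) \<partial>P')" for n
  proof -
    have e: "As (T n) (real n) \<omega> = A (S n \<omega>) \<omega>" "Xs (T n) (real n) \<omega> = X (S n \<omega>) \<omega>" for \<omega>
      by (simp_all add: As_def[OF T(1) order_refl] Xs_def[OF T(1) order_refl] S_def)
    have "(\<integral>\<omega>. b n \<omega> * X (S n \<omega>) \<omega> \<partial>P') = (\<integral>\<omega>. of_bool (u < A (S n \<omega>) \<omega>) * (A (S n \<omega>) \<omega> - u) \<partial>P')"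
      using stopped_tail_identity(3)[OF T(1) _ u, of "real n" n] unfolding e b_def by simp
    also have "\<dots> = (\<integral>\<omega>. max 0 (A (S n \<omega>) \<omega> - u) \<partial>P')"
      by (rule Bochner_Integration.integral_cong[OF refl]) (simp add: of_bool_def max_def)
    finally show ?thesis .
  qed
  have "(\<integral>\<omega>. B \<omega> * terminal X \<omega> \<partial>P') = (\<integral>\<omega>. max 0 (terminal A \<omega> - u) \<partial>P')"
    by (rule LIMSEQ_unique[OF L1[unfolded eq] L2])
  then show "(\<integral>\<omega>. indicator {\<omega>. u < terminal A \<omega>} \<omega> * terminal X \<omega> \<partial>P') = (\<integral>\<omega>. max 0 (terminal A \<omega> - u) \<partial>P')"
    by (simp add: B_def indicator_def of_bool_def)
qed

end

theorem theorem2p3: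
  fixes P :: "'a measure" and F :: "real \<Rightarrow> 'a measure"
    and Q :: "'a set \<Rightarrow> real" and D :: "real \<Rightarrow> 'a \<Rightarrow> real" and D_inf :: "'a \<Rightarrow> real"
    and X N A :: "real \<Rightarrow> 'a \<Rightarrow> real" and lam :: "real \<Rightarrow> real" and x :: real
  assumes "signed_measure_setting P F Q D D_inf"
    and "class_Sigma_H P F D X N A"
    and "class_D (P_prime P D_inf) F X"
    and "AE \<omega> in P. zero_times D \<omega> \<subseteq> {t. 0 \<le> t \<and> X t \<omega> = 0}"
    and "AE \<omega> in P. has_value_at A \<omega> (last_zero_bar D \<omega>) 0"
    and "is_cond_exp_given (P_prime P D_inf) (terminal X) (terminal A) lam"
    and "AE \<omega> in P_prime P D_inf. lam (terminal A \<omega>) \<noteq> 0"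
    and "0 \<le> x"
    and "ereal x < upper_end (P_prime P D_inf) (terminal A)"
  shows "set_integrable lborel {0..x} (\<lambda>z. 1 / lam z) \<and>
    measure (P_prime P D_inf) {\<omega> \<in> space (P_prime P D_inf). x < terminal A \<omega>} =
      exp (- (LINT z:{0..x}|lborel. 1 / lam z))"
proof -
  interpret signed_measure_setting P F Q D D_inf by fact
  interpret sigma_H_process P F Q D D_inf X N A by unfold_locales (fact assms)+
  interpret P': prob_space "P_prime P D_inf" by (rule prob_space_P')
  show ?thesis
  proof (rule P'.tail_exponential_of_cond_exp[OF _ _ _ terminal_tail_identity(1) terminal_A_integrable
        terminal_tail_identity(2) terminal_X_zero assms(6-9)])
    show "terminal X \<in> borel_measurable (P_prime P D_inf)"
      using terminal_measurable[OF adapted_X right_continuous_X] by simp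
    show "terminal A \<in> borel_measurable (P_prime P D_inf)"
      using terminal_measurable[OF adapted_A right_continuous_A] by simp
    show "AE \<omega> in P_prime P D_inf. 0 \<le> terminal X \<omega>" using terminal_nonneg by eventually_elim simp
  qed
qed

end
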